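(* Let $p\in\mathbb N$, $r>0$, $J=\begin{bmatrix}0&I_p\\ I_p&0\end{bmatrix}$, and let $\beta\in\mathcal U^{p\times 2p}[0,r]$ satisfy $$\beta(x)J\beta(x)^*\equiv 0,\qquad \beta'(x)J\beta(x)^*\equiv \mathrm{i} I_p \quad (0\le x\le r).$$ Write $\beta=\begin{bmatrix}\beta_1&\beta_2\end{bmatrix}$ with $p\times p$ blocks $\beta_1,\beta_2$, and assume $\det\beta_2(0)\neq 0$. Let $A$ and $K$ be the operators on $L_2^p(0,r)$ given by $$(Af)(x)=\int_0^x(t-x)f(t)\,dt,\qquad (Kf)(x)=\mathrm{i}\,\beta(x)J\int_0^x\beta(t)^*f(t)\,dt .$$ Then there is a bounded operator $E$ on $L_2^p(0,r)$ with bounded inverse, of the form $$(Ef)(x)=u(x)\beta_2(0)f(x)+\int_0^x\mathcal E(x,t)f(t)\,dt,$$ where $u\in\mathcal U^{p\times p}[0,r]$, $u(x)^*=u(x)^{-1}$ for all $x$, and $u(0)=I_p$, such that the following hold. (i) $K=EAE^{-1}$. (ii) $E^{-1}\beta_2\equiv I_p$, where $E^{-1}$ is applied to $\beta_2$ column by column. (iii) Both $E$ and $E^{-1}$ map $\mathcal U^{p}[0,r]$ into $\mathcal U^{p}[0,r]$.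
   Context: For $q\in\mathbb N$, $\mathcal U^{p\times q}[0,r]$ denotes the class of $p\times q$ matrix functions $\mathcal G$ on $[0,r]$ that are differentiable and satisfy $\mathcal G'(x)=\mathcal G'(0)+\int_0^x\mathcal G''(t)\,dt$ for some $\mathcal G''\in L_2^{p\times q}(0,r)$, the class of $p\times q$ matrix functions with entries in $L_2(0,r)$. We write $\mathcal U^p[0,r]:=\mathcal U^{p\times 1}[0,r]$ and $L_2^p(0,r):=L_2^{p\times 1}(0,r)$. *)

theory Defs
  imports "HOL-Analysis.Analysis"
begin

definition cnj_transpose :: "complex^'n^'m \<Rightarrow> complex^'m^'n" where
  "cnj_transpose M = (\<chi> i j. cnj (M $ j $ i))"

definition L2_on :: "real \<Rightarrow> (real \<Rightarrow> 'a::euclidean_space) \<Rightarrow> bool" where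
  "L2_on r f \<longleftrightarrow> set_borel_measurable lborel {0..r} f \<and>
      set_integrable lborel {0..r} (\<lambda>t. (norm (f t))^2)"

definition L2_norm :: "real \<Rightarrow> (real \<Rightarrow> 'a::euclidean_space) \<Rightarrow> real" where
  "L2_norm r f = sqrt (LINT t:{0..r}|lborel. (norm (f t))^2)"

definition ae_eq_on :: "real \<Rightarrow> (real \<Rightarrow> 'a) \<Rightarrow> (real \<Rightarrow> 'a) \<Rightarrow> bool" where
  "ae_eq_on r f g \<longleftrightarrow> (AE t in lborel. t \<in> {0..r} \<longrightarrow> f t = g t)"

text \<open>The class U[0,r]: differentiable on [0,r], with derivative G' satisfying
  G'(x) = G'(0) + int_0^x G'' for some G'' in L2(0,r).  Instantiate 'a with
  complex^'q^'p for U^{p x q} and with complex^'p for U^p.\<close>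
definition U_class :: "real \<Rightarrow> (real \<Rightarrow> 'a::euclidean_space) \<Rightarrow> bool" where
  "U_class r G \<longleftrightarrow> (\<exists>G1 G2.
      (\<forall>x\<in>{0..r}. (G has_vector_derivative G1 x) (at x within {0..r})) \<and>
      L2_on r G2 \<and>
      (\<forall>x\<in>{0..r}. G1 x = G1 0 + integral {0..x} G2))"

text \<open>J = [[0, I_p], [I_p, 0]], indexed by 'p + 'p (Inl = first block, Inr = second block).\<close>
definition Jmat :: "complex^('p::finite + 'p)^('p + 'p)" where
  "Jmat = (\<chi> a b. case (a, b) of
      (Inl i, Inr j) \<Rightarrow> (if i = j then 1 else 0)
    | (Inr i, Inl j) \<Rightarrow> (if i = j then 1 else 0)
    | _ \<Rightarrow> 0)"

definition blk1 :: "complex^('p::finite + 'p)^'p \<Rightarrow> complex^'p^'p" where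
  "blk1 M = (\<chi> i j. M $ i $ Inl j)"

definition blk2 :: "complex^('p::finite + 'p)^'p \<Rightarrow> complex^'p^'p" where
  "blk2 M = (\<chi> i j. M $ i $ Inr j)"

end

theory Submission
  imports Defs
begin

text \<open>
  Put \<open>\<phi> = \<beta>\<^sub>1 + \<beta>\<^sub>2\<close> and \<open>\<psi> = \<beta>\<^sub>1 - \<beta>\<^sub>2\<close>. The hypotheses say \<open>\<phi>\<phi>\<^sup>* = \<psi>\<psi>\<^sup>*\<close> and
  \<open>\<phi>'\<phi>\<^sup>* - \<psi>'\<psi>\<^sup>* = 2\<i>\<close>; hence \<open>\<phi>\<close>, \<open>\<psi>\<close> are invertible everywhere, and with
  \<open>\<omega> = (\<psi>\<^sup>*)\<^sup>-\<^sup>1\<close> and integration \<open>I\<close> from \<open>0\<close> one gets the factorization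
  \<open>K = - (\<phi> I \<phi>\<^sup>-\<^sup>1) (\<omega> I \<omega>\<^sup>-\<^sup>1)\<close>, whereas \<open>A = - I I\<close>. So it suffices to find operators
  \<open>X = 1 + (Volterra)\<close> and \<open>Y = 1 + (Volterra)\<close> with \<open>u X I = \<phi> I \<phi>\<^sup>-\<^sup>1 u Y\<close> and
  \<open>u Y I = \<omega> I \<omega>\<^sup>-\<^sup>1 u X\<close>. The leading coefficients force \<open>u' = B u\<close> with
  \<open>B = (\<phi>'\<phi>\<^sup>-\<^sup>1 + \<omega>'\<omega>\<^sup>-\<^sup>1) / 2\<close>, which is skew-adjoint, so \<open>u\<close> is unitary. For the kernels
  \<open>k\<^sub>X\<close>, \<open>k\<^sub>Y\<close> the sum \<open>p\<close> and the difference \<open>m\<close> satisfy the characteristic system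
  \<open>p\<^sub>x + p\<^sub>t = - \<tau> m\<close>, \<open>m\<^sub>x - m\<^sub>t = - \<tau> p\<close>, \<open>m(x,x) = - \<tau>(x)\<close>, with a continuous \<open>\<tau>\<close>.
  The boundary values \<open>k\<^sub>Y(x,0)\<close> remain free and are chosen so that \<open>u X\<close> maps the constant
  \<open>\<beta>\<^sub>2(0)\<close> to \<open>\<beta>\<^sub>2\<close>. The operator \<open>E\<close> is \<open>u X \<beta>\<^sub>2(0)\<close>. Since every function in U is
  \<open>v + x w + I I g\<close>, the intertwining relations also give the invariance of U.
\<close>

section \<open>Volterra fixed points and Fubini on plane regions\<close>

text \<open>Formally \<open>K\<close> inverts minus the product of the first-order operators
  \<open>d - \<omega>' \<omega>\<^sup>-\<^sup>1\<close> and
  \<open>d - \<phi>' \<phi>\<^sup>-\<^sup>1\<close>, while \<open>A\<close> inverts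
  \<open>- d d\<close>. Conjugation by \<open>u\<close> removes the first-order term of that
  product: the two factors become \<open>d - \<tau>\<close> and \<open>d + \<tau>\<close> with one
  and the same \<open>\<tau>\<close>. Because the signs differ, the factors are treated by a pair of
  operators with \<open>(d + \<tau>) X I = Y\<close> and \<open>(d - \<tau>) Y I = X\<close>;
  composing both relations leads from \<open>X\<close> back to \<open>X\<close>. The obstacle is
  regularity. Only continuity of \<open>\<tau>\<close> and of the boundary datum enters, so the
  kernels are merely continuous and satisfy their system only in integrated form. All relations are
  therefore stated between primitives and obtained by Fubini; no derivative of a kernel ever occurs,
  not even in the proof that U is invariant. Operators act on functions, not on classes. The inverse
  of \<open>E\<close> comes from a choice of solutions and is pinned down almost everywhere by
  injectivity.\<close>

lemmas HK_add = Henstock_Kurzweil_Integration.integral_add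
  and HK_diff = Henstock_Kurzweil_Integration.integral_diff
  and HK_combine = Henstock_Kurzweil_Integration.integral_combine
  and HK_norm_bound = Henstock_Kurzweil_Integration.integral_norm_bound_integral

lemma continuous_image_norm_bound:
  fixes f :: "'z::topological_space \<Rightarrow> 'a::real_normed_vector"
  assumes "continuous_on S f" "compact S"
  obtains M where "M \<ge> 0" "\<And>x. x \<in> S \<Longrightarrow> norm (f x) \<le> M"
proof -
  have "bounded (f ` S)" by (rule compact_imp_bounded[OF compact_continuous_image[OF assms]])
  then obtain M where "\<And>x. x \<in> S \<Longrightarrow> norm (f x) \<le> M" unfolding bounded_iff by blast
  then show thesis using that[of "max 0 M"] by fastforce
qed

lemma kernel_norm_bound:
  fixes k :: "real \<Rightarrow> real \<Rightarrow> 'a::real_normed_vector"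
  assumes "continuous_on UNIV (\<lambda>(x, t). k x t)"
  obtains M where "M \<ge> 0" "\<And>x t. x \<in> {a..b} \<Longrightarrow> t \<in> {a..b} \<Longrightarrow> norm (k x t) \<le> M"
proof -
  have "continuous_on ({a..b} \<times> {a..b}) (\<lambda>(x, t). k x t)" using assms by (rule continuous_on_subset) simp
  then obtain M where "M \<ge> 0" "\<And>z. z \<in> {a..b} \<times> {a..b} \<Longrightarrow> norm (case z of (x, t) \<Rightarrow> k x t) \<le> M"
    by (rule continuous_image_norm_bound) (auto intro: compact_Times)
  then show thesis using that[of M] by fastforce
qed

text \<open>Banach's principle in a weighted sup norm: a Volterra-type map gains a factor
  \<open>1 / L\<close> against the weight \<open>exp (L * l)\<close>, so it contracts for large
  \<open>L\<close> however large \<open>C\<close> is, and the whole of \<open>D\<close> is treated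
  at once.\<close>

lemma weighted_contraction_fixpoint:
  fixes D :: "'z::euclidean_space set" and T :: "('z \<Rightarrow> 'a::banach) \<Rightarrow> 'z \<Rightarrow> 'a"
    and l :: "'z \<Rightarrow> real"
  assumes D: "compact D" "convex D" "D \<noteq> {}" and l: "continuous_on D l"
    and T: "\<And>f. continuous_on UNIV f \<Longrightarrow> continuous_on D (T f)"
    and contr: "\<And>f g B L z. continuous_on UNIV f \<Longrightarrow> continuous_on UNIV g \<Longrightarrow> B \<ge> 0 \<Longrightarrow> L > 0 \<Longrightarrow> z \<in> D \<Longrightarrow>
        (\<And>w. w \<in> D \<Longrightarrow> norm (f w - g w) \<le> B * exp (L * l w)) \<Longrightarrow>
        norm (T f z - T g z) \<le> C / L * B * exp (L * l z)"
    and C: "C \<ge> 0"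
  shows "\<exists>f. continuous_on UNIV f \<and> (\<forall>z\<in>D. f z = T f z)"
proof -
  \<comment> \<open>Composition with the projection onto \<open>D\<close> turns functions on
    \<open>D\<close> into bounded continuous functions on the whole space, which form a complete
    space as a type.\<close>
  define c where "c = closest_point D"
  have clD: "closed D" using D(1) by (rule compact_imp_closed)
  have c_cont: "continuous_on S c" for S
    unfolding c_def using continuous_on_closest_point[OF D(2) clD D(3)] .
  have c_in: "c z \<in> D" for z unfolding c_def using closest_point_in_set[OF clD D(3)] .
  have c_id: "z \<in> D \<Longrightarrow> c z = z" for z unfolding c_def by (rule closest_point_self)
  \<comment> \<open>Large enough for contraction factor 1/2; the added 1 keeps \<open>L\<close>
    positive when \<open>C = 0\<close>.\<close>
  define L where "L = 2 * C + 1"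
  have L: "L > 0" "C / L \<le> 1/2" using C by (auto simp: L_def field_simps)
  define W where "W = (\<lambda>g z. exp (L * l (c z)) *\<^sub>R g z :: 'a)"
  have lc: "continuous_on UNIV (\<lambda>z. l (c z))"
    by (rule continuous_on_compose2[OF l c_cont]) (use c_in in auto)
  have W_cont: "continuous_on UNIV g \<Longrightarrow> continuous_on UNIV (W g)" for g
    unfolding W_def by (intro continuous_intros lc)
  \<comment> \<open>\<open>T\<close> conjugated by the weight: a fixed point of \<open>S\<close> in
    the plain sup norm becomes one of \<open>T\<close> after multiplication by the weight.\<close>
  define S where "S = (\<lambda>g z. exp (- L * l (c z)) *\<^sub>R T (W g) (c z))"
  have S_cont: "continuous_on UNIV (S g)" if "continuous_on UNIV g" for g
    unfolding S_def
  proof (intro continuous_on_scaleR continuous_on_exp continuous_on_mult continuous_on_const lc)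
    show "continuous_on UNIV (\<lambda>z. T (W g) (c z))"
      by (rule continuous_on_compose2[OF T[OF W_cont[OF that]] c_cont]) (use c_in in auto)
  qed
  have S_bdd: "bounded (range (S g))" if g: "continuous_on UNIV g" for g
  proof -
    have "S g z = S g (c z)" for z using c_id[OF c_in[of z]] by (simp add: S_def)
    then have "range (S g) \<subseteq> S g ` D" using c_in by force
    moreover have "compact (S g ` D)"
      by (rule compact_continuous_image[OF continuous_on_subset[OF S_cont[OF g]] D(1)]) auto
    ultimately show ?thesis using bounded_subset compact_imp_bounded by blast
  qed
  define Sb where "Sb = (\<lambda>g :: 'z \<Rightarrow>\<^sub>C 'a. Bcontfun (S (apply_bcontfun g)))"
  have Sb: "apply_bcontfun (Sb g) = S (apply_bcontfun g)" for g
    unfolding Sb_def by (rule Bcontfun_inverse) (auto simp: bcontfun_def S_cont S_bdd)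
  have "dist (Sb g) (Sb h) \<le> 1/2 * dist g h" for g h
  proof (rule dist_bound)
    fix z
    have "norm (T (W g) (c z) - T (W h) (c z)) \<le> C / L * dist g h * exp (L * l (c z))"
    proof (rule contr[OF W_cont W_cont])
      fix w assume w: "w \<in> D"
      have "norm (W g w - W h w) = exp (L * l w) * dist (g w) (h w)"
        using c_id[OF w] by (simp add: W_def dist_norm scaleR_diff_right[symmetric])
      also have "\<dots> \<le> dist g h * exp (L * l w)"
        using dist_bounded[of g w h] by simp
      finally show "norm (W g w - W h w) \<le> dist g h * exp (L * l w)" .
    qed (use c_in L in auto)
    then have "exp (- L * l (c z)) * norm (T (W g) (c z) - T (W h) (c z))
       \<le> exp (- L * l (c z)) * (C / L * dist g h * exp (L * l (c z)))"
      by (intro mult_left_mono) auto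
    also have "\<dots> = C / L * dist g h" by (simp add: exp_minus field_simps)
    also have "\<dots> \<le> 1/2 * dist g h" using L by (intro mult_right_mono) auto
    finally show "dist (Sb g z) (Sb h z) \<le> 1/2 * dist g h"
      unfolding Sb by (simp add: S_def dist_norm scaleR_diff_right[symmetric])
  qed
  then obtain g where g: "Sb g = g"
    using banach_fix_type[of "1/2" Sb] by auto
  have gS: "g z = S (apply_bcontfun g) z" for z using Sb[of g] g by simp
  define f where "f = W (apply_bcontfun g)"
  have fc: "continuous_on UNIV f"
    unfolding f_def W_def by (intro continuous_intros lc) auto
  have "f z = T f z" if z: "z \<in> D" for z
  proof -
    have "f z = exp (L * l z) *\<^sub>R S (apply_bcontfun g) z"
      using gS[of z] c_id[OF z] by (simp add: f_def W_def)
    also have "\<dots> = T f z"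
      using c_id[OF z] by (simp add: S_def f_def flip: exp_add)
    finally show ?thesis .
  qed
  with fc show ?thesis by auto
qed

text \<open>The integrating factor \<open>exp (- C * x)\<close> turns the inequality into
  monotonicity of \<open>G\<close>. With \<open>S = 0\<close> this is the uniqueness argument for
  Volterra equations.\<close>

lemma gronwall:
  fixes f :: "real \<Rightarrow> real"
  assumes f: "continuous_on {0..r} f" and C: "C \<ge> 0"
    and le: "\<And>x. x \<in> {0..r} \<Longrightarrow> f x \<le> S + C * integral {0..x} f" and x: "x \<in> {0..r}"
  shows "f x \<le> S * exp (C * x)"
proof -
  define G where "G = (\<lambda>x. exp (- C * x) * (S + C * integral {0..x} f))"
  have der: "(G has_real_derivative exp (- C * y) * (C * f y - C * (S + C * integral {0..y} f)))
      (at y within {0..r})" if y: "y \<in> {0..r}" for y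
  proof -
    have "((\<lambda>x. integral {0..x} f) has_real_derivative f y) (at y within {0..r})"
      using integral_has_vector_derivative[OF f y]
      by (simp add: has_real_derivative_iff_has_vector_derivative)
    then show ?thesis unfolding G_def
      by (auto intro!: derivative_eq_intros simp: algebra_simps)
  qed
  have "G x \<le> G 0"
  proof (rule DERIV_nonpos_imp_decreasing_open[where f=G and a=0 and b=x])
    fix y assume "0 < y" "y < x"
    then have y: "y \<in> {0..r}" "y \<in> {0<..<r}" using x by auto
    have "C * f y \<le> C * (S + C * integral {0..y} f)"
      using le[OF y(1)] C by (rule mult_left_mono)
    then have "exp (- C * y) * (C * f y - C * (S + C * integral {0..y} f)) \<le> 0"
      by (simp add: mult_le_0_iff)
    moreover have "(G has_real_derivative exp (- C * y) * (C * f y - C * (S + C * integral {0..y} f))) (at y)"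
      using der[OF y(1)] at_within_interior[of y "{0..r}"] y(2) by simp
    ultimately show "\<exists>D. (G has_real_derivative D) (at y) \<and> D \<le> 0" by blast
  next
    show "continuous_on {0..x} G"
      by (rule continuous_on_subset[OF DERIV_continuous_on[OF der]]) (use x in auto)
  qed (use x in auto)
  then have "S + C * integral {0..x} f \<le> S * exp (C * x)"
    by (simp add: G_def exp_minus field_simps)
  with le[OF x] show ?thesis by simp
qed

lemma set_integrable_HK:
  fixes f :: "real \<Rightarrow> 'a::euclidean_space"
  shows "set_integrable lborel S f \<Longrightarrow> f integrable_on S"
    "set_integrable lborel S f \<Longrightarrow> integral S f = (LINT x:S|lborel. f x)"
  using set_borel_integral_eq_integral[of S f] by auto

text \<open>Fubini for the integrand cut off to \<open>R\<close>. Describing the region by both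
  families of sections leaves the caller only two set equivalences to check.\<close>

lemma integral_swap_region:
  fixes g :: "real \<Rightarrow> real \<Rightarrow> 'a::euclidean_space"
  assumes int: "set_integrable lborel R (\<lambda>(w, y). g w y)"
    and R1: "\<And>w y. (w, y) \<in> R \<longleftrightarrow> w \<in> {a..b} \<and> y \<in> {l1 w..u1 w}"
    and R2: "\<And>w y. (w, y) \<in> R \<longleftrightarrow> y \<in> {c..d} \<and> w \<in> {l2 y..u2 y}"
    and i1: "\<And>w. w \<in> {a..b} \<Longrightarrow> set_integrable lborel {l1 w..u1 w} (g w)"
    and i2: "\<And>y. y \<in> {c..d} \<Longrightarrow> set_integrable lborel {l2 y..u2 y} (\<lambda>w. g w y)"
  shows "integral {a..b} (\<lambda>w. integral {l1 w..u1 w} (g w)) =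
      integral {c..d} (\<lambda>y. integral {l2 y..u2 y} (\<lambda>w. g w y))"
    and "(\<lambda>w. integral {l1 w..u1 w} (g w)) integrable_on {a..b}"
    and "(\<lambda>y. integral {l2 y..u2 y} (\<lambda>w. g w y)) integrable_on {c..d}"
proof -
  define h where "h = (\<lambda>w y. indicator R (w, y) *\<^sub>R g w y)"
  have h: "integrable (lborel \<Otimes>\<^sub>M lborel) (\<lambda>(w, y). h w y)"
    using int unfolding set_integrable_def lborel_prod h_def
    by (rule Bochner_Integration.integrable_cong[THEN iffD1, rotated -1]) auto
  have e1: "(LINT y|lborel. h w y) = indicator {a..b} w *\<^sub>R integral {l1 w..u1 w} (g w)" for w
  proof (cases "w \<in> {a..b}")
    case True
    then have "h w y = indicator {l1 w..u1 w} y *\<^sub>R g w y" for y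
      using R1[of w y] by (auto simp: h_def indicator_def)
    then show ?thesis
      using True set_integrable_HK(2)[OF i1[OF True]]
      by (simp add: set_lebesgue_integral_def)
  next
    case False
    then have "h w y = 0" for y using R1[of w y] by (auto simp: h_def)
    with False show ?thesis by simp
  qed
  have e2: "(LINT w|lborel. h w y) = indicator {c..d} y *\<^sub>R integral {l2 y..u2 y} (\<lambda>w. g w y)" for y
  proof (cases "y \<in> {c..d}")
    case True
    then have "h w y = indicator {l2 y..u2 y} w *\<^sub>R g w y" for w
      using R2[of w y] by (auto simp: h_def indicator_def)
    then show ?thesis
      using True set_integrable_HK(2)[OF i2[OF True]]
      by (simp add: set_lebesgue_integral_def)
  next
    case False
    then have "h w y = 0" for w using R2[of w y] by (auto simp: h_def)
    with False show ?thesis by simp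
  qed
  have o1: "set_integrable lborel {a..b} (\<lambda>w. integral {l1 w..u1 w} (g w))"
    using lborel_pair.integrable_fst[OF h] by (simp add: e1 set_integrable_def)
  have o2: "set_integrable lborel {c..d} (\<lambda>y. integral {l2 y..u2 y} (\<lambda>w. g w y))"
    using lborel_pair.integrable_snd[OF h] by (simp add: e2 set_integrable_def)
  show "(\<lambda>w. integral {l1 w..u1 w} (g w)) integrable_on {a..b}"
    by (rule set_integrable_HK(1)[OF o1])
  show "(\<lambda>y. integral {l2 y..u2 y} (\<lambda>w. g w y)) integrable_on {c..d}"
    by (rule set_integrable_HK(1)[OF o2])
  show "integral {a..b} (\<lambda>w. integral {l1 w..u1 w} (g w)) =
      integral {c..d} (\<lambda>y. integral {l2 y..u2 y} (\<lambda>w. g w y))"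
    unfolding set_integrable_HK(2)[OF o1] set_integrable_HK(2)[OF o2]
    using lborel_pair.Fubini_integral[OF h] by (simp add: e1 e2 set_lebesgue_integral_def)
qed

lemma integral_swap_region_continuous:
  fixes g :: "real \<Rightarrow> real \<Rightarrow> 'a::euclidean_space"
  assumes g: "continuous_on UNIV (\<lambda>(w, y). g w y)" and R: "compact R"
    and R1: "\<And>w y. (w, y) \<in> R \<longleftrightarrow> w \<in> {a..b} \<and> y \<in> {l1 w..u1 w}"
    and R2: "\<And>w y. (w, y) \<in> R \<longleftrightarrow> y \<in> {c..d} \<and> w \<in> {l2 y..u2 y}"
  shows "integral {a..b} (\<lambda>w. integral {l1 w..u1 w} (g w)) =
      integral {c..d} (\<lambda>y. integral {l2 y..u2 y} (\<lambda>w. g w y))"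
proof (rule integral_swap_region(1)[OF _ R1 R2])
  show "set_integrable lborel R (\<lambda>(w, y). g w y)"
    unfolding set_integrable_def
    by (rule borel_integrable_compact[OF R continuous_on_subset[OF g]]) auto
  show "set_integrable lborel {l1 w..u1 w} (g w)" for w
    by (rule borel_integrable_atLeastAtMost')
      (rule continuous_on_compose2[OF g, of _ "\<lambda>y. (w, y)", simplified], intro continuous_intros)
  show "set_integrable lborel {l2 y..u2 y} (\<lambda>w. g w y)" for y
    by (rule borel_integrable_atLeastAtMost')
      (rule continuous_on_compose2[OF g, of _ "\<lambda>w. (w, y)", simplified], intro continuous_intros)
qed

lemma set_integrable_subinterval:
  fixes f :: "real \<Rightarrow> 'a::euclidean_space"
  assumes "set_integrable lborel {a..b} f" "{c..d} \<subseteq> {a..b}"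
  shows "set_integrable lborel {c..d} f"
  by (rule set_integrable_subset[OF assms(1) _ assms(2)]) simp

lemma set_integrable_bilinear_continuous:
  fixes f :: "real \<Rightarrow> 'b::euclidean_space" and k :: "real \<Rightarrow> 'c::euclidean_space"
    and pr :: "'c \<Rightarrow> 'b \<Rightarrow> 'a::euclidean_space"
  assumes pr: "bounded_bilinear pr" and k: "continuous_on {a..b} k"
    and f: "set_integrable lborel {a..b} f"
  shows "set_integrable lborel {a..b} (\<lambda>t. pr (k t) (f t))"
proof -
  interpret bounded_bilinear pr by fact
  obtain K where K: "K \<ge> 0" "\<And>a b. norm (pr a b) \<le> norm a * norm b * K" using nonneg_bounded by auto
  obtain M where M0: "M \<ge> 0" and M: "\<And>t. t \<in> {a..b} \<Longrightarrow> norm (k t) \<le> M"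
    by (rule continuous_image_norm_bound[OF k]) auto
  have ki: "set_integrable lborel {a..b} k" by (rule borel_integrable_atLeastAtMost'[OF k])
  have meas: "(\<lambda>t. pr (indicator {a..b} t *\<^sub>R k t) (indicator {a..b} t *\<^sub>R f t)) \<in> borel_measurable lborel"
    by (rule borel_measurable_continuous_Pair[OF _ _ ])
      (use ki f in \<open>auto simp: set_integrable_def intro!: continuous_on continuous_intros\<close>)
  show ?thesis unfolding set_integrable_def
  proof (rule Bochner_Integration.integrable_bound)
    show "integrable lborel (\<lambda>t. (M * K) *\<^sub>R (indicator {a..b} t *\<^sub>R f t))"
      using f unfolding set_integrable_def by (rule integrable_scaleR_right)
    show "(\<lambda>t. indicator {a..b} t *\<^sub>R pr (k t) (f t)) \<in> borel_measurable lborel"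
      using meas by (rule measurable_cong[THEN iffD1, rotated]) (auto simp: indicator_def zero_left)
    show "AE t in lborel. norm (indicator {a..b} t *\<^sub>R pr (k t) (f t)) \<le> norm ((M * K) *\<^sub>R (indicator {a..b} t *\<^sub>R f t))"
    proof (intro AE_I2)
      fix t
      show "norm (indicator {a..b} t *\<^sub>R pr (k t) (f t)) \<le> norm ((M * K) *\<^sub>R (indicator {a..b} t *\<^sub>R f t))"
      proof (cases "t \<in> {a..b}")
        case True
        have "norm (pr (k t) (f t)) \<le> norm (k t) * norm (f t) * K" by (rule K)
        also have "\<dots> \<le> M * norm (f t) * K" using M[OF True] K(1) by (intro mult_right_mono) auto
        finally show ?thesis using True K(1) M0 by (auto simp: abs_mult mult_ac)
      qed simp
    qed
  qed
qed

text \<open>\<open>f\<close> is merely integrable here, as second derivatives and arguments of the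
  operators are. Joint integrability on the triangle comes from domination by a constant times
  \<open>norm (f t)\<close> on the surrounding square.\<close>

lemma integral_swap_triangle:
  fixes f :: "real \<Rightarrow> 'b::euclidean_space" and k :: "real \<Rightarrow> real \<Rightarrow> 'c::euclidean_space"
    and pr :: "'c \<Rightarrow> 'b \<Rightarrow> 'a::euclidean_space"
  assumes pr: "bounded_bilinear pr" and k: "continuous_on UNIV (\<lambda>(s, t). k s t)"
    and f: "set_integrable lborel {0..x} f"
  shows "integral {0..x} (\<lambda>s. integral {0..s} (\<lambda>t. pr (k s t) (f t))) =
      integral {0..x} (\<lambda>t. pr (integral {t..x} (\<lambda>s. k s t)) (f t))"
    and "(\<lambda>s. integral {0..s} (\<lambda>t. pr (k s t) (f t))) integrable_on {0..x}"
proof -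
  interpret bounded_bilinear pr by fact
  define R where "R = {(s, t). 0 \<le> t \<and> t \<le> s \<and> s \<le> x}"
  have Rcl: "closed R" unfolding R_def case_prod_beta'
    by (intro closed_Collect_conj closed_Collect_le continuous_intros)
  have Rsub: "R \<subseteq> {0..x} \<times> {0..x}" by (auto simp: R_def)
  have kc1: "continuous_on S (k s)" for s S
    by (rule continuous_on_compose2[OF k, of _ "\<lambda>y. (s, y)", simplified], intro continuous_intros)
  have kc2: "continuous_on S (\<lambda>s. k s t)" for t S
    by (rule continuous_on_compose2[OF k, of _ "\<lambda>w. (w, t)", simplified], intro continuous_intros)
  obtain K where K: "K \<ge> 0" "\<And>a b. norm (pr a b) \<le> norm a * norm b * K" using nonneg_bounded by auto
  obtain M where M0: "M \<ge> 0" and M: "\<And>s t. s \<in> {0..x} \<Longrightarrow> t \<in> {0..x} \<Longrightarrow> norm (k s t) \<le> M"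
    by (rule kernel_norm_bound[OF k, of 0 x]) blast
  \<comment> \<open>The cut-off function is measurable on the whole line, whereas nothing is known
    about \<open>f\<close> outside \<open>{0..x}\<close>.\<close>
  define F where "F = (\<lambda>t. indicator {0..x} t *\<^sub>R f t)"
  have F: "integrable lborel F" using f by (simp add: F_def set_integrable_def)
  have Fm[measurable]: "F \<in> borel_measurable borel" using F by auto
  have Rm[measurable]: "R \<in> sets (borel \<Otimes>\<^sub>M borel)" 
    using borel_closed[OF Rcl] unfolding borel_prod by simp
  have "set_integrable lborel R (\<lambda>(s, t). pr (k s t) (f t))"
    unfolding set_integrable_def
  proof (rule Bochner_Integration.integrable_bound)
    show "integrable lborel (\<lambda>z::real\<times>real. (M * K * indicator {0..x} (fst z)) *\<^sub>R norm (F (snd z)))"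
      unfolding lborel_prod[symmetric]
    proof (rule lborel_pair.Fubini_integrable)
      show "(\<lambda>z::real\<times>real. (M * K * indicator {0..x} (fst z)) *\<^sub>R norm (F (snd z))) \<in> borel_measurable (lborel \<Otimes>\<^sub>M lborel)"
        by measurable
      show "integrable lborel (\<lambda>s. LINT t|lborel. norm ((M * K * indicator {0..x} (fst (s, t))) *\<^sub>R norm (F (snd (s, t)))))"
        by (auto simp: abs_mult mult_ac simp: emeasure_lborel_Icc_eq intro!: integrable_real_indicator)
      show "AE s in lborel. integrable lborel (\<lambda>t. (M * K * indicator {0..x} (fst (s, t))) *\<^sub>R norm (F (snd (s, t))))"
        using F by auto
    qed
    have "(\<lambda>z. pr (k (fst z) (snd z)) (F (snd z))) \<in> borel_measurable (borel :: (real \<times> real) measure)"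
    proof (rule borel_measurable_continuous_Pair[where f="\<lambda>z. k (fst z) (snd z)" and g="\<lambda>z. F (snd z)" and H=pr])
      show "(\<lambda>z. k (fst z) (snd z)) \<in> borel_measurable (borel :: (real \<times> real) measure)"
        using k by (intro borel_measurable_continuous_onI) (simp add: case_prod_beta')
      show "(\<lambda>z. F (snd z)) \<in> borel_measurable (borel :: (real \<times> real) measure)"
        unfolding borel_prod[symmetric] by measurable
    qed (auto intro!: continuous_on continuous_intros)
    then have "(\<lambda>z. indicator R z *\<^sub>R pr (k (fst z) (snd z)) (F (snd z))) \<in> borel_measurable lborel"
      using Rm[unfolded borel_prod] by simp
    then show "(\<lambda>z. indicat_real R z *\<^sub>R (case z of (s, t) \<Rightarrow> pr (k s t) (f t))) \<in> borel_measurable lborel"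
      by (rule measurable_cong[THEN iffD1, rotated]) (auto simp: indicator_def F_def R_def zero_right)
    show "AE z in lborel. norm (indicat_real R z *\<^sub>R (case z of (s, t) \<Rightarrow> pr (k s t) (f t)))
         \<le> norm ((M * K * indicator {0..x} (fst z)) *\<^sub>R norm (F (snd z)))"
    proof (intro AE_I2)
      fix z :: "real \<times> real"
      obtain s t where z: "z = (s, t)" by force
      show "norm (indicat_real R z *\<^sub>R (case z of (s, t) \<Rightarrow> pr (k s t) (f t)))
         \<le> norm ((M * K * indicator {0..x} (fst z)) *\<^sub>R norm (F (snd z)))"
      proof (cases "(s, t) \<in> R")
        case True
        then have st: "s \<in> {0..x}" "t \<in> {0..x}" using Rsub by auto
        have "norm (pr (k s t) (f t)) \<le> norm (k s t) * norm (f t) * K" by (rule K)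
        also have "\<dots> \<le> M * norm (f t) * K" using M[OF st] K(1) by (intro mult_right_mono) auto
        finally have "norm (pr (k s t) (f t)) \<le> M * K * norm (f t)" by (simp add: mult_ac)
        also have "\<dots> \<le> \<bar>M * K * norm (f t)\<bar>" by simp
        finally show ?thesis using True st by (simp add: z F_def abs_mult)
      qed (auto simp: z)
    qed
  qed
  moreover have "set_integrable lborel {0..s} (\<lambda>t. pr (k s t) (f t))" if "s \<in> {0..x}" for s
    by (rule set_integrable_bilinear_continuous[OF pr kc1 set_integrable_subinterval[OF f]]) (use that in auto)
  moreover have "set_integrable lborel {t..x} (\<lambda>s. pr (k s t) (f t))" for t
    by (rule borel_integrable_atLeastAtMost') (intro continuous_on kc2 continuous_intros)
  moreover have "(s, t) \<in> R \<longleftrightarrow> s \<in> {0..x} \<and> t \<in> {0..s}" "(s, t) \<in> R \<longleftrightarrow> t \<in> {0..x} \<and> s \<in> {t..x}" for s t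
    by (auto simp: R_def)
  ultimately have sw: "integral {0..x} (\<lambda>s. integral {0..s} (\<lambda>t. pr (k s t) (f t))) =
      integral {0..x} (\<lambda>t. integral {t..x} (\<lambda>s. pr (k s t) (f t)))"
    "(\<lambda>s. integral {0..s} (\<lambda>t. pr (k s t) (f t))) integrable_on {0..x}"
    using integral_swap_region[of R "\<lambda>s t. pr (k s t) (f t)" 0 x "\<lambda>_. 0" "\<lambda>s. s" 0 x "\<lambda>t. t" "\<lambda>_. x"]
    by blast+
  show "(\<lambda>s. integral {0..s} (\<lambda>t. pr (k s t) (f t))) integrable_on {0..x}" by fact
  have "integral {t..x} (\<lambda>s. pr (k s t) (f t)) = pr (integral {t..x} (\<lambda>s. k s t)) (f t)" for t
    using integral_linear[OF integrable_continuous_real[OF kc2] bounded_linear_left] by (simp add: o_def)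
  with sw(1) show "integral {0..x} (\<lambda>s. integral {0..s} (\<lambda>t. pr (k s t) (f t))) =
      integral {0..x} (\<lambda>t. pr (integral {t..x} (\<lambda>s. k s t)) (f t))" by simp
qed

section \<open>Square-integrable functions on an interval\<close>

lemma L2_on_set_integrable:
  assumes "L2_on r f"
  shows "set_integrable lborel {0..r} f"
  unfolding set_integrable_def
proof (rule Bochner_Integration.integrable_bound)
  have "set_integrable lborel {0..r} (\<lambda>t. (norm (f t))\<^sup>2)" using assms by (simp add: L2_on_def)
  moreover have "set_integrable lborel {0..r} (\<lambda>t. 1::real)"
    by (rule borel_integrable_atLeastAtMost') (rule continuous_on_const)
  ultimately show "integrable lborel (\<lambda>t. indicator {0..r} t *\<^sub>R (1 + (norm (f t))\<^sup>2))"
    using set_integral_add(1)[of lborel "{0..r}" "\<lambda>t. 1::real"] by (simp add: set_integrable_def)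
  show "(\<lambda>t. indicator {0..r} t *\<^sub>R f t) \<in> borel_measurable lborel"
    using assms by (simp add: L2_on_def set_borel_measurable_def)
  \<comment> \<open>On a bounded interval this pointwise bound places L2 inside L1.\<close>
  have "y \<le> 1 + y\<^sup>2" for y :: real
    using zero_le_power2[of "y - 1/2"] by (simp add: power2_eq_square algebra_simps)
  then show "AE t in lborel. norm (indicator {0..r} t *\<^sub>R f t) \<le> norm (indicator {0..r} t *\<^sub>R (1 + (norm (f t))\<^sup>2))"
    by (intro AE_I2) (auto simp: indicator_def abs_of_nonneg add_nonneg_nonneg)
qed

lemma L2_on_integrable:
  assumes "L2_on r f" "x \<le> r"
  shows "f integrable_on {0..x}"
  by (rule set_integrable_HK(1)[OF set_integrable_subinterval[OF L2_on_set_integrable[OF assms(1)]]])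
    (use assms(2) in auto)

lemma square_sum_le: "(a * x + b)\<^sup>2 \<le> 2 * a\<^sup>2 * x\<^sup>2 + 2 * b\<^sup>2" for a b x :: real
  using zero_le_power2[of "a * x - b"] by (simp add: power2_eq_square algebra_simps)

lemma L2_on_dominated:
  fixes f :: "real \<Rightarrow> 'a::euclidean_space" and g :: "real \<Rightarrow> 'b::euclidean_space"
  assumes f: "L2_on r f" and g: "set_borel_measurable lborel {0..r} g" and r: "r \<ge> 0"
    and le: "\<And>x. x \<in> {0..r} \<Longrightarrow> norm (g x) \<le> a * norm (f x) + b"
  shows "L2_on r g" "(L2_norm r g)\<^sup>2 \<le> 2 * a\<^sup>2 * (L2_norm r f)\<^sup>2 + 2 * b\<^sup>2 * r"
proof -
  have f2: "set_integrable lborel {0..r} (\<lambda>t. (norm (f t))\<^sup>2)" using f by (simp add: L2_on_def)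
  have c: "set_integrable lborel {0..r} (\<lambda>t. c::real)" for c
    by (rule borel_integrable_atLeastAtMost') (rule continuous_on_const)
  have bd: "set_integrable lborel {0..r} (\<lambda>t. 2 * a\<^sup>2 * (norm (f t))\<^sup>2 + 2 * b\<^sup>2)"
    using set_integral_add(1)[OF set_integrable_mult_right[OF f2] c] by simp
  have sq: "(norm (g x))\<^sup>2 \<le> 2 * a\<^sup>2 * (norm (f x))\<^sup>2 + 2 * b\<^sup>2" if "x \<in> {0..r}" for x
    using power_mono[OF le[OF that] norm_ge_zero, of 2] square_sum_le[of a "norm (f x)" b] by linarith
  have gm: "(\<lambda>t. indicator {0..r} t *\<^sub>R g t) \<in> borel_measurable lborel"
    using g by (simp add: set_borel_measurable_def)
  have gi: "set_integrable lborel {0..r} (\<lambda>t. (norm (g t))\<^sup>2)"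
    unfolding set_integrable_def
  proof (rule Bochner_Integration.integrable_bound[OF bd[unfolded set_integrable_def]])
    have "(\<lambda>t. (norm (indicator {0..r} t *\<^sub>R g t))\<^sup>2) \<in> borel_measurable lborel"
      using gm by measurable
    then show "(\<lambda>t. indicat_real {0..r} t *\<^sub>R (norm (g t))\<^sup>2) \<in> borel_measurable lborel"
      by (rule measurable_cong[THEN iffD1, rotated]) (auto simp: indicator_def)
    show "AE t in lborel. norm (indicat_real {0..r} t *\<^sub>R (norm (g t))\<^sup>2) \<le>
       norm (indicat_real {0..r} t *\<^sub>R (2 * a\<^sup>2 * (norm (f t))\<^sup>2 + 2 * b\<^sup>2))"
      by (intro AE_I2) (use sq in \<open>auto simp: indicator_def intro!: order_trans[OF _ abs_ge_self]\<close>)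
  qed
  show "L2_on r g" using g gi by (simp add: L2_on_def)
  have nn: "0 \<le> (LINT t:{0..r}|lborel. (norm (f t))\<^sup>2)" "0 \<le> (LINT t:{0..r}|lborel. (norm (g t))\<^sup>2)"
    unfolding set_lebesgue_integral_def by (rule Bochner_Integration.integral_nonneg; auto)+
  have "(LINT t:{0..r}|lborel. (norm (g t))\<^sup>2) \<le> (LINT t:{0..r}|lborel. 2 * a\<^sup>2 * (norm (f t))\<^sup>2 + 2 * b\<^sup>2)"
    by (rule set_integral_mono[OF gi bd]) (use sq in auto)
  also have "\<dots> = 2 * a\<^sup>2 * (LINT t:{0..r}|lborel. (norm (f t))\<^sup>2) + (LINT t:{0..r}|lborel. 2 * b\<^sup>2)"
    using set_integral_add(2)[OF set_integrable_mult_right[OF f2] c] by simp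
  also have "(LINT t:{0..r}|lborel. 2 * b\<^sup>2) = 2 * b\<^sup>2 * r"
    using r by (simp add: set_lebesgue_integral_def)
  finally show "(L2_norm r g)\<^sup>2 \<le> 2 * a\<^sup>2 * (L2_norm r f)\<^sup>2 + 2 * b\<^sup>2 * r"
    unfolding L2_norm_def using nn by simp
qed

text \<open>The hypothesis has the shape produced by \<open>f\<close> plus a Volterra integral of
  \<open>f\<close>: a pointwise part and a constant multiple of the norm of
  \<open>f\<close>.\<close>

lemma L2_norm_bound:
  fixes f :: "real \<Rightarrow> 'a::euclidean_space" and g :: "real \<Rightarrow> 'b::euclidean_space"
  assumes f: "L2_on r f" and g: "set_borel_measurable lborel {0..r} g" and r: "r \<ge> 0"
    and le: "\<And>x. x \<in> {0..r} \<Longrightarrow> norm (g x) \<le> a * norm (f x) + b * L2_norm r f"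
  shows "L2_on r g" "L2_norm r g \<le> sqrt (2 * a\<^sup>2 + 2 * b\<^sup>2 * r) * L2_norm r f"
proof -
  show "L2_on r g" by (rule L2_on_dominated(1)[OF f g r le])
  have nn: "0 \<le> L2_norm r f" unfolding L2_norm_def real_sqrt_ge_0_iff set_lebesgue_integral_def
    by (rule Bochner_Integration.integral_nonneg) auto
  have "(L2_norm r g)\<^sup>2 \<le> 2 * a\<^sup>2 * (L2_norm r f)\<^sup>2 + 2 * (b * L2_norm r f)\<^sup>2 * r"
    by (rule L2_on_dominated(2)[OF f g r le])
  also have "\<dots> = (2 * a\<^sup>2 + 2 * b\<^sup>2 * r) * (L2_norm r f)\<^sup>2" by (simp add: power_mult_distrib algebra_simps)
  finally have "L2_norm r g \<le> sqrt ((2 * a\<^sup>2 + 2 * b\<^sup>2 * r) * (L2_norm r f)\<^sup>2)"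
    by (rule real_le_rsqrt)
  then show "L2_norm r g \<le> sqrt (2 * a\<^sup>2 + 2 * b\<^sup>2 * r) * L2_norm r f"
    using nn by (simp add: real_sqrt_mult)
qed

text \<open>Cauchy-Schwarz, read off from the nonnegative integral of
  \<open>(norm (f t) - s / r)\<^sup>2\<close>, where \<open>s / r\<close> is the mean value of the
  norm.\<close>

lemma integral_norm_le_L2_norm:
  fixes f :: "real \<Rightarrow> 'a::euclidean_space"
  assumes f: "L2_on r f" and r: "r > 0"
  shows "integral {0..r} (\<lambda>t. norm (f t)) \<le> sqrt r * L2_norm r f"
proof -
  define s q where "s = integral {0..r} (\<lambda>t. norm (f t))" and "q = (LINT t:{0..r}|lborel. (norm (f t))\<^sup>2)"
  have f1: "set_integrable lborel {0..r} (\<lambda>t. norm (f t))"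
    using set_integrable_norm[OF L2_on_set_integrable[OF f]] .
  have f2: "set_integrable lborel {0..r} (\<lambda>t. (norm (f t))\<^sup>2)" using f by (simp add: L2_on_def)
  have c: "set_integrable lborel {0..r} (\<lambda>t. c::real)" for c
    by (rule borel_integrable_atLeastAtMost') (rule continuous_on_const)
  have s: "s = (LINT t:{0..r}|lborel. norm (f t))"
    unfolding s_def by (rule set_integrable_HK(2)[OF f1])
  define e where "e = - 2 * (s / r)"
  note i1 = set_integrable_mult_right[OF f1, of e]
  have "0 \<le> (LINT t:{0..r}|lborel. (norm (f t) - s / r)\<^sup>2)"
    unfolding set_lebesgue_integral_def by (rule Bochner_Integration.integral_nonneg) auto
  also have "\<dots> = (LINT t:{0..r}|lborel. ((norm (f t))\<^sup>2 + e * norm (f t)) + (s / r)\<^sup>2)"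
    by (simp add: e_def power2_diff algebra_simps)
  also have "\<dots> = q + e * s + (LINT t:{0..r}|lborel. (s / r)\<^sup>2)"
    unfolding q_def set_integral_add(2)[OF set_integral_add(1)[OF f2 i1] c] set_integral_add(2)[OF f2 i1]
    by (simp add: s[symmetric])
  also have "(LINT t:{0..r}|lborel. (s / r)\<^sup>2) = (s / r)\<^sup>2 * r"
    using r by (simp add: set_lebesgue_integral_def)
  finally have "s\<^sup>2 \<le> r * q" using r by (simp add: e_def power2_eq_square field_simps)
  then have "s \<le> sqrt (r * q)" by (rule real_le_rsqrt)
  then show ?thesis by (simp add: s_def q_def L2_norm_def real_sqrt_mult)
qed

lemma continuous_on_set_borel_measurable:
  fixes f :: "real \<Rightarrow> 'a::euclidean_space"
  assumes "continuous_on {0..r} f"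
  shows "set_borel_measurable lborel {0..r} f"
  using borel_integrable_atLeastAtMost'[OF assms]
  by (auto simp: set_integrable_def set_borel_measurable_def)

lemma continuous_on_L2_on:
  fixes f :: "real \<Rightarrow> 'a::euclidean_space"
  assumes "continuous_on {0..r} f"
  shows "L2_on r f"
  unfolding L2_on_def using continuous_on_set_borel_measurable[OF assms]
  by (auto intro!: borel_integrable_atLeastAtMost' continuous_intros assms)

lemma L2_on_add:
  fixes f g :: "real \<Rightarrow> 'a::euclidean_space"
  assumes "L2_on r f" "L2_on r g"
  shows "L2_on r (\<lambda>x. f x + g x)"
proof -
  have "(\<lambda>x. indicator {0..r} x *\<^sub>R f x + indicator {0..r} x *\<^sub>R g x) \<in> borel_measurable lborel"
    using assms by (auto simp: L2_on_def set_borel_measurable_def)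
  then have m: "set_borel_measurable lborel {0..r} (\<lambda>x. f x + g x)"
    by (simp add: set_borel_measurable_def scaleR_add_right)
  have fg: "set_integrable lborel {0..r} (\<lambda>t. 2 * (norm (f t))\<^sup>2 + 2 * (norm (g t))\<^sup>2)"
    using assms by (intro set_integral_add set_integrable_mult_right) (auto simp: L2_on_def)
  have "set_integrable lborel {0..r} (\<lambda>t. (norm (f t + g t))\<^sup>2)"
  proof (rule set_integrable_bound[OF fg])
    have "(\<lambda>t. (norm (indicator {0..r} t *\<^sub>R (f t + g t)))\<^sup>2) \<in> borel_measurable lborel"
      using m unfolding set_borel_measurable_def by measurable
    then show "set_borel_measurable lborel {0..r} (\<lambda>t. (norm (f t + g t))\<^sup>2)"
      unfolding set_borel_measurable_def
      by (rule measurable_cong[THEN iffD1, rotated]) (auto simp: indicator_def)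
    have "(norm (f t + g t))\<^sup>2 \<le> 2 * (norm (f t))\<^sup>2 + 2 * (norm (g t))\<^sup>2" for t
      using power_mono[OF norm_triangle_ineq norm_ge_zero, of "f t" "g t" 2]
        square_sum_le[of 1 "norm (f t)" "norm (g t)"] by (simp del: power_mono_iff)
    then show "AE t in lborel. t \<in> {0..r} \<longrightarrow> norm ((norm (f t + g t))\<^sup>2) \<le> norm (2 * (norm (f t))\<^sup>2 + 2 * (norm (g t))\<^sup>2)"
      by (intro AE_I2 impI) (auto simp: abs_of_nonneg add_nonneg_nonneg)
  qed
  with m show ?thesis by (simp add: L2_on_def)
qed

lemma L2_on_bilinear:
  fixes f :: "real \<Rightarrow> 'b::euclidean_space" and k :: "real \<Rightarrow> 'c::euclidean_space"
    and pr :: "'c \<Rightarrow> 'b \<Rightarrow> 'a::euclidean_space"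
  assumes pr: "bounded_bilinear pr" and k: "continuous_on {0..r} k" and r: "r \<ge> 0"
    and f: "L2_on r f"
  shows "L2_on r (\<lambda>t. pr (k t) (f t))"
proof -
  interpret bounded_bilinear pr by fact
  obtain K where K: "K \<ge> 0" "\<And>a b. norm (pr a b) \<le> norm a * norm b * K" using nonneg_bounded by auto
  obtain M where M0: "M \<ge> 0" and M: "\<And>t. t \<in> {0..r} \<Longrightarrow> norm (k t) \<le> M"
    by (rule continuous_image_norm_bound[OF k]) auto
  show ?thesis
  proof (rule L2_on_dominated(1)[OF f _ r])
    show "set_borel_measurable lborel {0..r} (\<lambda>t. pr (k t) (f t))"
      using set_integrable_bilinear_continuous[OF pr k L2_on_set_integrable[OF f]]
      by (auto simp: set_integrable_def set_borel_measurable_def)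
    fix x assume x: "x \<in> {0..r}"
    have "norm (pr (k x) (f x)) \<le> norm (k x) * norm (f x) * K" by (rule K)
    also have "\<dots> \<le> M * norm (f x) * K" using M[OF x] K(1) by (intro mult_right_mono) auto
    finally show "norm (pr (k x) (f x)) \<le> M * K * norm (f x) + 0" by (simp add: mult_ac)
  qed
qed

lemma L2_on_bounded_linear:
  fixes f :: "real \<Rightarrow> 'b::euclidean_space" and h :: "'b \<Rightarrow> 'a::euclidean_space"
  assumes h: "bounded_linear h" and f: "L2_on r f" and r: "r \<ge> 0"
  shows "L2_on r (\<lambda>t. h (f t))"
  using L2_on_bilinear[OF bounded_bilinear.comp[OF bounded_bilinear_scaleR bounded_linear_ident h] continuous_on_const[of _ 1] r f]
  by simp

lemma L2_on_diff:
  fixes f g :: "real \<Rightarrow> 'a::euclidean_space"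
  assumes "L2_on r f" "L2_on r g" "r \<ge> 0"
  shows "L2_on r (\<lambda>x. f x - g x)"
  using L2_on_add[OF assms(1) L2_on_bounded_linear[OF bounded_linear_minus[OF bounded_linear_ident] assms(2,3)]] by simp

lemma L2_on_cong:
  assumes "L2_on r f" "\<And>x. x \<in> {0..r} \<Longrightarrow> f x = g x"
  shows "L2_on r g"
proof -
  have "(\<lambda>x. indicator {0..r} x *\<^sub>R f x) = (\<lambda>x. indicator {0..r} x *\<^sub>R g x)"
    "(\<lambda>x. indicator {0..r} x *\<^sub>R (norm (f x))\<^sup>2) = (\<lambda>x. indicator {0..r} x *\<^sub>R (norm (g x))\<^sup>2)"
    using assms(2) by (auto simp: indicator_def fun_eq_iff)
  with assms(1) show ?thesis unfolding L2_on_def set_borel_measurable_def set_integrable_def by simp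
qed

lemma integral_ae_cong:
  fixes f g :: "real \<Rightarrow> 'a::euclidean_space"
  assumes "ae_eq_on r f g" "x \<le> r"
  shows "integral {0..x} f = integral {0..x} g"
proof -
  obtain N where N: "N \<in> null_sets lborel" "{t. \<not> (t \<in> {0..r} \<longrightarrow> f t = g t)} \<subseteq> N"
    using assms(1) unfolding ae_eq_on_def eventually_ae_filter by auto
  have "negligible N"
    unfolding negligible_iff_null_sets by (rule null_sets_completionI[OF N(1)])
  then show ?thesis by (rule integral_spike) (use N(2) assms(2) in auto)
qed

lemma ae_eq_onI: "(\<And>x. x \<in> {0..r} \<Longrightarrow> f x = g x) \<Longrightarrow> ae_eq_on r f g"
  by (simp add: ae_eq_on_def)

lemma ae_eq_on_sym: "ae_eq_on r f g \<Longrightarrow> ae_eq_on r g f"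
  unfolding ae_eq_on_def by (auto elim: eventually_mono)

lemma ae_eq_on_trans: "ae_eq_on r f g \<Longrightarrow> ae_eq_on r g h \<Longrightarrow> ae_eq_on r f h"
  unfolding ae_eq_on_def by (auto elim: eventually_elim2)

lemma ae_eq_on_map2:
  "ae_eq_on r f f' \<Longrightarrow> (\<And>x. x \<in> {0..r} \<Longrightarrow> f x = f' x \<Longrightarrow> h x = h' x) \<Longrightarrow> ae_eq_on r h h'"
  unfolding ae_eq_on_def by (auto elim: eventually_mono)

section \<open>The Sobolev class and the class U\<close>

lemma bilinear_mm:
  "bounded_bilinear ((**) :: complex^'n^'m \<Rightarrow> complex^'k^'n \<Rightarrow> complex^'k^'m)"
  unfolding bilinear_conv_bounded_bilinear[symmetric] bilinear_def
  by (auto simp: matrix_matrix_mult_def vec_eq_iff sum.distrib algebra_simps scaleR_sum_right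
      intro!: linearI)

lemma bilinear_mv:
  "bounded_bilinear ((*v) :: complex^'n^'m \<Rightarrow> complex^'n \<Rightarrow> complex^'m)"
  unfolding bilinear_conv_bounded_bilinear[symmetric] bilinear_def
  by (auto simp: matrix_vector_mult_def vec_eq_iff sum.distrib algebra_simps scaleR_sum_right
      intro!: linearI)

lemma bounded_linear_cnj_transpose:
  "bounded_linear (cnj_transpose :: complex^'n^'m \<Rightarrow> complex^'m^'n)"
  unfolding linear_conv_bounded_linear[symmetric]
  by (auto simp: cnj_transpose_def vec_eq_iff intro!: linearI)

interpretation mm: bounded_bilinear "(**) :: complex^'n^'m \<Rightarrow> complex^'k^'n \<Rightarrow> complex^'k^'m"
  by (rule bilinear_mm)

interpretation mv: bounded_bilinear "(*v) :: complex^'n^'m \<Rightarrow> complex^'n \<Rightarrow> complex^'m"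
  by (rule bilinear_mv)

lemmas cnj_transpose_add = linear_add[OF bounded_linear.linear[OF bounded_linear_cnj_transpose]]
  and cnj_transpose_diff = linear_diff[OF bounded_linear.linear[OF bounded_linear_cnj_transpose]]
  and cnj_transpose_scaleR = linear_scale[OF bounded_linear.linear[OF bounded_linear_cnj_transpose]]

lemma cnj_transpose_mult: "cnj_transpose (A ** B) = cnj_transpose B ** cnj_transpose A"
  by (auto simp: cnj_transpose_def matrix_matrix_mult_def vec_eq_iff mult.commute)

lemma cnj_transpose_cnj_transpose [simp]: "cnj_transpose (cnj_transpose A) = A"
  by (simp add: cnj_transpose_def vec_eq_iff)

lemma cnj_transpose_mat: "cnj_transpose (mat c) = mat (cnj c)"
  by (auto simp: cnj_transpose_def mat_def vec_eq_iff)

lemma has_vector_derivative_continuous_on: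
  assumes "\<And>x. x \<in> S \<Longrightarrow> (f has_vector_derivative f' x) (at x within S)"
  shows "continuous_on S f"
  unfolding continuous_on_eq_continuous_within using has_vector_derivative_continuous[OF assms] by blast

text \<open>Integration by parts for a C1 factor and an absolutely continuous one. Since
  \<open>f\<close> need not be differentiable at any given point, the pointwise product rule is
  replaced by Fubini on the triangle \<open>t \<le> s \<le> x\<close>.\<close>

lemma bilinear_product_rule:
  fixes k :: "real \<Rightarrow> 'c::euclidean_space" and f :: "real \<Rightarrow> 'b::euclidean_space"
    and pr :: "'c \<Rightarrow> 'b \<Rightarrow> 'a::euclidean_space"
  assumes pr: "bounded_bilinear pr" and x: "x \<in> {0..r}"
    and k: "\<And>s. s \<in> {0..r} \<Longrightarrow> (k has_vector_derivative k' s) (at s within {0..r})"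
    and k': "continuous_on {0..r} k'"
    and g: "set_integrable lborel {0..r} g"
    and f: "\<And>s. s \<in> {0..r} \<Longrightarrow> f s = f 0 + integral {0..s} g"
  shows "pr (k x) (f x) = pr (k 0) (f 0) + integral {0..x} (\<lambda>s. pr (k' s) (f s) + pr (k s) (g s))"
proof -
  interpret bounded_bilinear pr by fact
  have sub: "{0..x} \<subseteq> {0..r}" using x by auto
  \<comment> \<open>\<open>k'\<close> is controlled on \<open>{0..r}\<close> only, but the triangle
    swap asks for a kernel continuous on the whole plane; hence the clamped argument.\<close>
  define kc where "kc = (\<lambda>s. k' (max 0 (min r s)))"
  have kc: "continuous_on UNIV kc" unfolding kc_def
    by (rule continuous_on_compose2[OF k']) (use x in \<open>auto intro!: continuous_intros\<close>)
  have kc_eq: "kc s = k' s" if "s \<in> {0..r}" for s using that by (simp add: kc_def)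
  have ftc: "integral {t..x} kc = k x - k t" if "t \<in> {0..x}" for t
  proof -
    have "(k' has_integral k x - k t) {t..x}"
      by (rule fundamental_theorem_of_calculus)
        (use that x in \<open>auto intro!: has_vector_derivative_within_subset[OF k]\<close>)
    then show ?thesis
      using that x by (intro integral_unique) (rule has_integral_cong[THEN iffD1, rotated], auto simp: kc_eq)
  qed
  have gx: "set_integrable lborel {0..x} g" by (rule set_integrable_subinterval[OF g sub])
  have kcont: "continuous_on {0..r} k"
    by (rule has_vector_derivative_continuous_on[OF k])
  have int_kg: "(\<lambda>t. pr (k t) (g t)) integrable_on {0..x}"
    by (rule set_integrable_HK(1)[OF set_integrable_bilinear_continuous[OF pr continuous_on_subset[OF kcont sub] gx]])
  have "integral {0..x} (\<lambda>s. integral {0..s} (\<lambda>t. pr (kc s) (g t))) =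
      integral {0..x} (\<lambda>t. pr (integral {t..x} kc) (g t))"
    by (rule integral_swap_triangle(1)[OF pr _ gx])
      (auto simp: case_prod_beta' intro!: continuous_on_compose2[OF kc] continuous_intros)
  also have "\<dots> = integral {0..x} (\<lambda>t. pr (k x) (g t) - pr (k t) (g t))"
    by (rule integral_cong) (simp add: ftc diff_left)
  also have "\<dots> = pr (k x) (integral {0..x} g) - integral {0..x} (\<lambda>t. pr (k t) (g t))"
  proof (subst HK_diff[OF _ int_kg])
    show "(\<lambda>t. pr (k x) (g t)) integrable_on {0..x}"
      using integrable_linear[OF set_integrable_HK(1)[OF gx] bounded_linear_right[of "k x"]]
      by (simp add: o_def)
    show "integral {0..x} (\<lambda>t. pr (k x) (g t)) - integral {0..x} (\<lambda>t. pr (k t) (g t)) =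
        pr (k x) (integral {0..x} g) - integral {0..x} (\<lambda>t. pr (k t) (g t))"
      using integral_linear[OF set_integrable_HK(1)[OF gx] bounded_linear_right[of "k x"]]
      by (simp add: o_def)
  qed
  also have "integral {0..x} (\<lambda>s. integral {0..s} (\<lambda>t. pr (kc s) (g t))) =
      integral {0..x} (\<lambda>s. pr (k' s) (integral {0..s} g))"
  proof (rule integral_cong)
    fix s assume s: "s \<in> {0..x}"
    have "g integrable_on {0..s}"
      using s by (intro set_integrable_HK(1)[OF set_integrable_subinterval[OF gx]]) auto
    from integral_linear[OF this bounded_linear_right[of "kc s"]]
    show "integral {0..s} (\<lambda>t. pr (kc s) (g t)) = pr (k' s) (integral {0..s} g)"
      using s sub by (auto simp: o_def kc_eq)
  qed
  finally have 1: "integral {0..x} (\<lambda>s. pr (k' s) (integral {0..s} g)) =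
      pr (k x) (integral {0..x} g) - integral {0..x} (\<lambda>t. pr (k t) (g t))" .
  have gcont: "continuous_on {0..x} (\<lambda>s. integral {0..s} g)"
    by (rule indefinite_integral_continuous_1[OF set_integrable_HK(1)[OF gx]])
  have "continuous_on {0..x} f"
    by (rule continuous_on_cong[THEN iffD2, OF refl f, of "{0..x}"])
      (use sub in \<open>auto intro!: continuous_intros gcont\<close>)
  then have int_kf: "(\<lambda>s. pr (k' s) (f s)) integrable_on {0..x}"
    by (intro integrable_continuous_real continuous_on continuous_on_subset[OF k' sub])
  have "integral {0..x} (\<lambda>s. pr (k' s) (f s)) =
      integral {0..x} (\<lambda>s. pr (k' s) (f 0) + pr (k' s) (integral {0..s} g))"
  proof (rule integral_cong)
    fix s assume "s \<in> {0..x}"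
    with sub have "f s = f 0 + integral {0..s} g" by (intro f) auto
    then show "pr (k' s) (f s) = pr (k' s) (f 0) + pr (k' s) (integral {0..s} g)" by (simp add: add_right)
  qed
  also have "\<dots> = integral {0..x} (\<lambda>s. pr (k' s) (f 0)) + integral {0..x} (\<lambda>s. pr (k' s) (integral {0..s} g))"
    by (intro HK_add integrable_continuous_real continuous_on
        continuous_on_subset[OF k' sub] gcont continuous_on_const)
  also have "integral {0..x} (\<lambda>s. pr (k' s) (f 0)) = pr (k x - k 0) (f 0)"
    using integral_linear[OF integrable_continuous_real[OF continuous_on_subset[OF k' sub]] bounded_linear_left[of "f 0"]]
      ftc[of 0] integral_cong[of "{0..x}" kc k'] kc_eq x sub by (auto simp: o_def)
  finally have "integral {0..x} (\<lambda>s. pr (k' s) (f s) + pr (k s) (g s)) =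
      pr (k x - k 0) (f 0) + pr (k x) (integral {0..x} g)"
    using 1 by (simp add: HK_add[OF int_kf int_kg])
  then show ?thesis using f[OF x] by (simp add: diff_left add_right)
qed

text \<open>The Sobolev space W^{1,2}(0,r) in continuous representatives; U consists of the
  functions whose derivative lies here.\<close>

definition W12_class :: "real \<Rightarrow> (real \<Rightarrow> 'a::euclidean_space) \<Rightarrow> bool" where
  "W12_class r f \<longleftrightarrow> (\<exists>g. L2_on r g \<and> (\<forall>x\<in>{0..r}. f x = f 0 + integral {0..x} g))"

lemma U_class_iff:
  "U_class r G \<longleftrightarrow> (\<exists>G1. (\<forall>x\<in>{0..r}. (G has_vector_derivative G1 x) (at x within {0..r})) \<and> W12_class r G1)"
  unfolding U_class_def W12_class_def by auto

lemma W12_class_continuous: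
  fixes f :: "real \<Rightarrow> 'a::euclidean_space"
  assumes "W12_class r f"
  shows "continuous_on {0..r} f"
proof -
  obtain g where g: "L2_on r g" "\<And>x. x \<in> {0..r} \<Longrightarrow> f x = f 0 + integral {0..x} g"
    using assms unfolding W12_class_def by blast
  have "continuous_on {0..r} (\<lambda>x. f 0 + integral {0..x} g)"
    by (intro continuous_intros indefinite_integral_continuous_1 L2_on_integrable[OF g(1)]) simp
  then show ?thesis by (rule continuous_on_eq) (rule g(2)[symmetric])
qed

lemma W12_class_add:
  fixes f g :: "real \<Rightarrow> 'a::euclidean_space"
  assumes "W12_class r f" "W12_class r g"
  shows "W12_class r (\<lambda>x. f x + g x)"
proof -
  obtain f' g' where L2: "L2_on r f'" "L2_on r g'"
    and eq: "\<And>x. x \<in> {0..r} \<Longrightarrow> f x = f 0 + integral {0..x} f'" "\<And>x. x \<in> {0..r} \<Longrightarrow> g x = g 0 + integral {0..x} g'"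
    using assms unfolding W12_class_def by blast
  show ?thesis unfolding W12_class_def
  proof (intro exI[of _ "\<lambda>x. f' x + g' x"] conjI ballI L2_on_add L2)
    fix x assume x: "x \<in> {0..r}"
    have "integral {0..x} (\<lambda>x. f' x + g' x) = integral {0..x} f' + integral {0..x} g'"
      using x by (intro HK_add L2_on_integrable[OF L2(1)] L2_on_integrable[OF L2(2)]) auto
    with eq(1)[OF x] eq(2)[OF x] show "f x + g x = f 0 + g 0 + integral {0..x} (\<lambda>x. f' x + g' x)" by simp
  qed
qed

lemma W12_class_bounded_linear:
  fixes f :: "real \<Rightarrow> 'b::euclidean_space" and h :: "'b \<Rightarrow> 'a::euclidean_space"
  assumes h: "bounded_linear h" and f: "W12_class r f" and r: "r \<ge> 0"
  shows "W12_class r (\<lambda>x. h (f x))"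
proof -
  interpret bounded_linear h by fact
  obtain g where g: "L2_on r g" "\<And>x. x \<in> {0..r} \<Longrightarrow> f x = f 0 + integral {0..x} g"
    using f unfolding W12_class_def by blast
  have "h (integral {0..x} g) = integral {0..x} (\<lambda>t. h (g t))" if "x \<in> {0..r}" for x
    using integral_linear[OF L2_on_integrable[OF g(1), of x] h] that by (simp add: o_def)
  then show ?thesis unfolding W12_class_def
    by (intro exI[of _ "\<lambda>x. h (g x)"] conjI ballI L2_on_bounded_linear[OF h g(1) r]) (metis add g(2))
qed

lemma C1_imp_W12_class:
  fixes f :: "real \<Rightarrow> 'a::euclidean_space"
  assumes f: "\<And>x. x \<in> {0..r} \<Longrightarrow> (f has_vector_derivative f' x) (at x within {0..r})"
    and f': "continuous_on {0..r} f'"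
  shows "W12_class r f"
  unfolding W12_class_def
proof (intro exI[of _ f'] conjI ballI continuous_on_L2_on[OF f'])
  fix x assume x: "x \<in> {0..r}"
  have "(f' has_integral f x - f 0) {0..x}"
    by (rule fundamental_theorem_of_calculus)
      (use x in \<open>auto intro!: has_vector_derivative_within_subset[OF f]\<close>)
  then show "f x = f 0 + integral {0..x} f'" by (simp add: integral_unique)
qed

text \<open>The asymmetry is deliberate: for a product of two functions in U, each summand of the
  derivative pairs a C1 factor with a Sobolev factor.\<close>

lemma W12_class_bilinear:
  fixes k :: "real \<Rightarrow> 'c::euclidean_space" and f :: "real \<Rightarrow> 'b::euclidean_space"
    and pr :: "'c \<Rightarrow> 'b \<Rightarrow> 'a::euclidean_space"
  assumes pr: "bounded_bilinear pr" and r: "r \<ge> 0"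
    and k: "\<And>s. s \<in> {0..r} \<Longrightarrow> (k has_vector_derivative k' s) (at s within {0..r})"
    and k': "continuous_on {0..r} k'" and f: "W12_class r f"
  shows "W12_class r (\<lambda>x. pr (k x) (f x))"
proof -
  obtain g where g: "L2_on r g" "\<And>x. x \<in> {0..r} \<Longrightarrow> f x = f 0 + integral {0..x} g"
    using f unfolding W12_class_def by blast
  show ?thesis unfolding W12_class_def
  proof (intro exI[of _ "\<lambda>s. pr (k' s) (f s) + pr (k s) (g s)"] conjI ballI)
    show "L2_on r (\<lambda>s. pr (k' s) (f s) + pr (k s) (g s))"
      by (intro L2_on_add L2_on_bilinear[OF pr] k' r continuous_on_L2_on g W12_class_continuous[OF f]
          has_vector_derivative_continuous_on[OF k])
    show "pr (k x) (f x) = pr (k 0) (f 0) + integral {0..x} (\<lambda>s. pr (k' s) (f s) + pr (k s) (g s))"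
      if "x \<in> {0..r}" for x
      by (rule bilinear_product_rule[OF pr that k k' L2_on_set_integrable[OF g(1)] g(2)])
  qed
qed

section \<open>Closure properties of the class U\<close>

lemma U_classE:
  fixes f :: "real \<Rightarrow> 'a::euclidean_space"
  assumes "U_class r f"
  obtains f' where "\<And>x. x \<in> {0..r} \<Longrightarrow> (f has_vector_derivative f' x) (at x within {0..r})"
    "W12_class r f'" "continuous_on {0..r} f'" "continuous_on {0..r} f"
proof -
  obtain f' where "\<And>x. x \<in> {0..r} \<Longrightarrow> (f has_vector_derivative f' x) (at x within {0..r})" "W12_class r f'"
    using assms unfolding U_class_iff by blast
  then show ?thesis by (intro that[of f'] W12_class_continuous has_vector_derivative_continuous_on) auto
qed

lemma U_class_bilinear:
  fixes k :: "real \<Rightarrow> 'c::euclidean_space" and f :: "real \<Rightarrow> 'b::euclidean_space"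
    and pr :: "'c \<Rightarrow> 'b \<Rightarrow> 'a::euclidean_space"
  assumes pr: "bounded_bilinear pr" and r: "r \<ge> 0" and k: "U_class r k" and f: "U_class r f"
  shows "U_class r (\<lambda>x. pr (k x) (f x))"
proof -
  obtain k' where k': "\<And>x. x \<in> {0..r} \<Longrightarrow> (k has_vector_derivative k' x) (at x within {0..r})"
    "W12_class r k'" "continuous_on {0..r} k'" by (rule U_classE[OF k]) auto
  obtain f' where f': "\<And>x. x \<in> {0..r} \<Longrightarrow> (f has_vector_derivative f' x) (at x within {0..r})"
    "W12_class r f'" "continuous_on {0..r} f'" by (rule U_classE[OF f]) auto
  show ?thesis unfolding U_class_iff
    by (intro exI[of _ "\<lambda>x. pr (k x) (f' x) + pr (k' x) (f x)"] conjI ballI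
        bounded_bilinear.has_vector_derivative[OF pr] k' f' W12_class_add
        W12_class_bilinear[OF pr r k'(1,3) f'(2)]
        W12_class_bilinear[OF bounded_bilinear.flip[OF pr] r f'(1,3) k'(2)])
qed

lemma U_class_bounded_linear:
  fixes f :: "real \<Rightarrow> 'b::euclidean_space" and h :: "'b \<Rightarrow> 'a::euclidean_space"
  assumes h: "bounded_linear h" and f: "U_class r f" and r: "r \<ge> 0"
  shows "U_class r (\<lambda>x. h (f x))"
proof -
  obtain f' where f': "\<And>x. x \<in> {0..r} \<Longrightarrow> (f has_vector_derivative f' x) (at x within {0..r})"
    "W12_class r f'" by (rule U_classE[OF f]) auto
  then show ?thesis unfolding U_class_iff
    by (intro exI[of _ "\<lambda>x. h (f' x)"] conjI ballI W12_class_bounded_linear[OF h _ r]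
      bounded_linear.has_vector_derivative[OF h]) auto
qed

lemma U_class_add:
  fixes f g :: "real \<Rightarrow> 'a::euclidean_space"
  assumes "U_class r f" "U_class r g"
  shows "U_class r (\<lambda>x. f x + g x)"
proof -
  obtain f' where f': "\<And>x. x \<in> {0..r} \<Longrightarrow> (f has_vector_derivative f' x) (at x within {0..r})"
    "W12_class r f'" by (rule U_classE[OF assms(1)]) auto
  obtain g' where g': "\<And>x. x \<in> {0..r} \<Longrightarrow> (g has_vector_derivative g' x) (at x within {0..r})"
    "W12_class r g'" by (rule U_classE[OF assms(2)]) auto
  show ?thesis unfolding U_class_iff
    by (intro exI[of _ "\<lambda>x. f' x + g' x"] conjI ballI W12_class_add has_vector_derivative_add f' g')
qed

lemma U_class_diff:
  fixes f g :: "real \<Rightarrow> 'a::euclidean_space"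
  assumes "U_class r f" "U_class r g" "r \<ge> 0"
  shows "U_class r (\<lambda>x. f x - g x)"
  using U_class_add[OF assms(1) U_class_bounded_linear[OF bounded_linear_minus[OF bounded_linear_ident] assms(2,3)]]
  by simp

lemma U_class_linear_function:
  fixes a b :: "'a::euclidean_space"
  shows "U_class r (\<lambda>x. a + x *\<^sub>R b)"
  unfolding U_class_iff
  by (intro exI[of _ "\<lambda>_. b"] conjI ballI C1_imp_W12_class[where f'="\<lambda>_. 0"])
    (auto intro!: derivative_eq_intros)

lemma U_class_const: "U_class r (\<lambda>x. a :: 'a::euclidean_space)"
  using U_class_linear_function[of r a 0] by simp

lemma U_class_integral:
  fixes w :: "real \<Rightarrow> 'a::euclidean_space"
  assumes "W12_class r w"
  shows "U_class r (\<lambda>x. integral {0..x} w)"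
  unfolding U_class_iff using assms
  by (intro exI[of _ w] conjI ballI integral_has_vector_derivative W12_class_continuous)

lemma W12_class_integral:
  fixes g :: "real \<Rightarrow> 'a::euclidean_space"
  assumes "L2_on r g"
  shows "W12_class r (\<lambda>x. integral {0..x} g)"
  unfolding W12_class_def using assms by (intro exI[of _ g]) auto

lemma U_class_cong:
  fixes f g :: "real \<Rightarrow> 'a::euclidean_space"
  assumes f: "U_class r f" and eq: "\<And>x. x \<in> {0..r} \<Longrightarrow> f x = g x"
  shows "U_class r g"
proof -
  obtain f' where f': "\<And>x. x \<in> {0..r} \<Longrightarrow> (f has_vector_derivative f' x) (at x within {0..r})"
    "W12_class r f'" by (rule U_classE[OF f]) auto
  have "(g has_vector_derivative f' x) (at x within {0..r})" if "x \<in> {0..r}" for x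
    using has_vector_derivative_transform[OF that _ f'(1)[OF that]] eq by simp
  with f'(2) show ?thesis unfolding U_class_iff by blast
qed

section \<open>Matrix inverses, Volterra equations and a Goursat problem\<close>

lemma has_vector_derivative_iff_slope:
  fixes f :: "real \<Rightarrow> 'a::real_normed_vector"
  shows "(f has_vector_derivative D) (at x within S) \<longleftrightarrow>
    ((\<lambda>y. (1 / (y - x)) *\<^sub>R (f y - f x)) \<longlongrightarrow> D) (at x within S)"
proof -
  have "(f has_vector_derivative D) (at x within S) \<longleftrightarrow>
      ((\<lambda>y. (1 / norm (y - x)) *\<^sub>R (f y - (f x + (y - x) *\<^sub>R D))) \<longlongrightarrow> 0) (at x within S)"
    by (simp add: has_vector_derivative_def has_derivative_within bounded_linear_scaleR_left)
  also have "\<dots> \<longleftrightarrow> ((\<lambda>y. (1 / (y - x)) *\<^sub>R (f y - f x) - D) \<longlongrightarrow> 0) (at x within S)"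
  proof (subst (1 2) tendsto_norm_zero_iff[symmetric], rule filterlim_cong[OF refl refl], rule eventually_at_filter[THEN iffD2], rule always_eventually, intro allI impI)
    fix y assume "y \<noteq> x"
    then have "(1 / (y - x)) *\<^sub>R (f y - f x) - D = (1 / (y - x)) *\<^sub>R (f y - (f x + (y - x) *\<^sub>R D))"
      by (simp add: scaleR_diff_right scaleR_add_right)
    then show "norm ((1 / norm (y - x)) *\<^sub>R (f y - (f x + (y - x) *\<^sub>R D))) = norm ((1 / (y - x)) *\<^sub>R (f y - f x) - D)"
      by simp
  qed
  also have "\<dots> \<longleftrightarrow> ((\<lambda>y. (1 / (y - x)) *\<^sub>R (f y - f x)) \<longlongrightarrow> D) (at x within S)"
    by (rule Lim_null[symmetric])
  finally show ?thesis .
qed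

text \<open>Everything comes from \<open>B y - B x = - (B y ** (A y - A x) ** B x)\<close>: first
  local boundedness of \<open>B\<close>, then continuity, then the limit of the difference
  quotient.\<close>

lemma has_vector_derivative_matrix_inverse:
  fixes A B :: "real \<Rightarrow> complex^'n^'n"
  assumes inv: "\<And>y. y \<in> S \<Longrightarrow> A y ** B y = mat 1" and x: "x \<in> S"
    and A: "(A has_vector_derivative A') (at x within S)"
  shows "(B has_vector_derivative - (B x ** A' ** B x)) (at x within S)"
proof -
  have diff: "B y - B x = - (B y ** (A y - A x) ** B x)" if "y \<in> S" for y
  proof -
    have "B y ** A y = mat 1" using inv[OF that] matrix_left_right_inverse by blast
    moreover have "B y ** A x ** B x = B y" using inv[OF x] by (simp add: matrix_mul_assoc[symmetric])
    ultimately show ?thesis by (simp add: mm.diff_right mm.diff_left)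
  qed
  obtain K where K: "K > 0" "\<And>(X :: complex^'n^'n) (Y :: complex^'n^'n). norm (X ** Y) \<le> norm X * norm Y * K"
    using mm.pos_bounded by blast
  have A0: "((\<lambda>y. A y - A x) \<longlongrightarrow> 0) (at x within S)"
    using has_vector_derivative_continuous[OF A] by (simp add: continuous_within Lim_null[symmetric])
  have bd: "norm (B y - B x) \<le> norm (B y) * (norm (A y - A x) * norm (B x) * K * K)" if "y \<in> S" for y
  proof -
    have "norm (B y - B x) \<le> norm (B y ** (A y - A x)) * norm (B x) * K"
      using diff[OF that] K(2)[of "B y ** (A y - A x)" "B x"] by simp
    also have "\<dots> \<le> (norm (B y) * norm (A y - A x) * K) * norm (B x) * K"
      using K by (intro mult_right_mono) auto
    finally show ?thesis by (simp add: mult_ac)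
  qed
  have e0: "((\<lambda>y. norm (A y - A x) * norm (B x) * K * K) \<longlongrightarrow> 0) (at x within S)"
    by (intro tendsto_mult_left_zero tendsto_norm_zero A0)
  then have "eventually (\<lambda>y. norm (A y - A x) * norm (B x) * K * K < 1/2) (at x within S)"
    by (rule order_tendstoD) simp
  \<comment> \<open>Near \<open>x\<close> the factor of \<open>norm (B y)\<close> in
    \<open>bd\<close> is below 1/2, so that term is absorbed into the left-hand side.\<close>
  then have "eventually (\<lambda>y. norm (B y) \<le> 2 * norm (B x)) (at x within S)"
    unfolding eventually_at_filter
  proof eventually_elim
    case (elim y)
    show ?case
    proof (intro impI)
      assume y: "y \<noteq> x" "y \<in> S"
      have "norm (B y) \<le> norm (B x) + norm (B y - B x)" by norm
      also have "\<dots> \<le> norm (B x) + norm (B y) * (1/2)"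
        using bd[OF y(2)] elim y mult_left_mono[of "norm (A y - A x) * norm (B x) * K * K" "1/2" "norm (B y)"] by auto
      finally show "norm (B y) \<le> 2 * norm (B x)" by simp
    qed
  qed
  then have "eventually (\<lambda>y. norm (B y - B x) \<le> 2 * norm (B x) * (norm (A y - A x) * norm (B x) * K * K)) (at x within S)"
    unfolding eventually_at_filter
  proof eventually_elim
    case (elim y)
    show ?case
    proof (intro impI)
      assume y: "y \<noteq> x" "y \<in> S"
      have "norm (B y) * (norm (A y - A x) * norm (B x) * K * K) \<le> 2 * norm (B x) * (norm (A y - A x) * norm (B x) * K * K)"
        using elim y K by (intro mult_right_mono) auto
      with bd[OF y(2)] show "norm (B y - B x) \<le> 2 * norm (B x) * (norm (A y - A x) * norm (B x) * K * K)" by linarith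
    qed
  qed
  then have "((\<lambda>y. B y - B x) \<longlongrightarrow> 0) (at x within S)"
    by (rule Lim_null_comparison) (rule tendsto_mult_right_zero[OF e0])
  then have B: "(B \<longlongrightarrow> B x) (at x within S)" by (simp add: Lim_null[symmetric])
  have "((\<lambda>y. - (B y ** ((1 / (y - x)) *\<^sub>R (A y - A x)) ** B x)) \<longlongrightarrow> - (B x ** A' ** B x)) (at x within S)"
    using A unfolding has_vector_derivative_iff_slope by (intro tendsto_minus mm.tendsto B tendsto_const)
  then show ?thesis unfolding has_vector_derivative_iff_slope
  proof (rule Lim_transform_eventually)
    show "\<forall>\<^sub>F y in at x within S. - (B y ** ((1 / (y - x)) *\<^sub>R (A y - A x)) ** B x) = (1 / (y - x)) *\<^sub>R (B y - B x)"
      unfolding eventually_at_filter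
      by (intro always_eventually allI impI) (simp add: diff mm.scaleR_left mm.scaleR_right del: diff_zero)
  qed
qed

text \<open>The derivative \<open>- (B x ** A' x ** B x)\<close> is a Sobolev function between two
  C1 factors, since \<open>B\<close> is already known to be C1.\<close>

lemma U_class_matrix_inverse:
  fixes A B :: "real \<Rightarrow> complex^'n^'n"
  assumes A: "U_class r A" and r: "r \<ge> 0" and inv: "\<And>x. x \<in> {0..r} \<Longrightarrow> A x ** B x = mat 1"
  shows "U_class r B"
proof -
  obtain A' where A': "\<And>x. x \<in> {0..r} \<Longrightarrow> (A has_vector_derivative A' x) (at x within {0..r})"
    "W12_class r A'" "continuous_on {0..r} A'" by (rule U_classE[OF A]) auto
  have B: "(B has_vector_derivative - (B x ** A' x ** B x)) (at x within {0..r})" if "x \<in> {0..r}" for x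
    by (rule has_vector_derivative_matrix_inverse[OF inv that A'(1)[OF that]])
  have Bc: "continuous_on {0..r} B" by (rule has_vector_derivative_continuous_on[OF B])
  have B'c: "continuous_on {0..r} (\<lambda>x. - (B x ** A' x ** B x))"
    by (intro continuous_on_minus mm.continuous_on Bc A')
  have "W12_class r (\<lambda>x. - (B x ** A' x ** B x))"
    by (intro W12_class_bounded_linear[OF bounded_linear_minus[OF bounded_linear_ident]]
        W12_class_bilinear[OF bounded_bilinear.flip[OF bilinear_mm] r B B'c]
        W12_class_bilinear[OF bilinear_mm r B B'c] A' r)
  with B show ?thesis unfolding U_class_iff
    by (intro exI[of _ "\<lambda>x. - (B x ** A' x ** B x)"] conjI ballI)
qed

section \<open>Parametric integrals and Volterra equations\<close>

lemma integral_affine_substitution: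
  fixes f :: "real \<Rightarrow> 'a::euclidean_space"
  assumes "a \<le> b" "continuous_on {a..b} f"
  shows "integral {a..b} f = integral {0..1} (\<lambda>\<theta>. (b - a) *\<^sub>R f (a + \<theta> * (b - a)))"
proof -
  have "((\<lambda>x. (b - a) *\<^sub>R f (a + x * (b - a))) has_integral (integral {a + 0 * (b - a)..a + 1 * (b - a)} f)) {0..1}"
  proof (rule has_integral_substitution[where c=a and d=b])
    show "(\<lambda>x. a + x * (b - a)) ` {0..1} \<subseteq> {a..b}"
      using assms(1) mult_right_mono[of _ 1 "b - a"] by fastforce
  qed (use assms in \<open>auto intro!: derivative_eq_intros\<close>)
  from integral_unique[OF this] show ?thesis by (simp del: integral_cmul)
qed

text \<open>Rescaling to \<open>{0..1}\<close> removes the moving endpoints. The order of the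
  endpoints matters, because an integral over a reversed interval is 0 and not the negative
  one.\<close>

lemma continuous_on_parametric_integral:
  fixes H :: "'z::metric_space \<Rightarrow> real \<Rightarrow> 'a::euclidean_space"
  assumes H: "continuous_on UNIV (\<lambda>(z, s). H z s)"
    and a: "continuous_on D a" and b: "continuous_on D b" and ab: "\<And>z. z \<in> D \<Longrightarrow> a z \<le> b z"
  shows "continuous_on D (\<lambda>z. integral {a z..b z} (H z))"
proof -
  have Hz: "continuous_on S (H z)" for z S
    by (rule continuous_on_compose2[OF H, of _ "\<lambda>y. (z, y)", simplified], intro continuous_intros)
  have "continuous_on D (\<lambda>z. integral (cbox 0 1) (\<lambda>\<theta>. (b z - a z) *\<^sub>R H z (a z + \<theta> * (b z - a z))))"
  proof (rule integral_continuous_on_param)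
    have a': "continuous_on (D \<times> cbox 0 1) (\<lambda>z::'z \<times> real. a (fst z))"
      and b': "continuous_on (D \<times> cbox 0 1) (\<lambda>z::'z \<times> real. b (fst z))"
      by (rule continuous_on_compose2[OF a] continuous_on_compose2[OF b]; auto intro!: continuous_intros)+
    have "continuous_on (D \<times> cbox 0 1) (\<lambda>z::'z \<times> real. H (fst z) (a (fst z) + snd z * (b (fst z) - a (fst z))))"
      by (rule continuous_on_compose2[OF H, of _ "\<lambda>z. (fst z, a (fst z) + snd z * (b (fst z) - a (fst z)))", simplified])
        (intro continuous_intros a' b')
    then show "continuous_on (D \<times> cbox 0 1) (\<lambda>(z, \<theta>). (b z - a z) *\<^sub>R H z (a z + \<theta> * (b z - a z)))"
      unfolding case_prod_beta' by (intro continuous_intros a' b')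
  qed
  then show ?thesis
    by (rule continuous_on_eq) (use integral_affine_substitution[OF ab Hz] in simp)
qed

text \<open>The source of the factor \<open>1 / L\<close> in the weighted contraction.\<close>

lemma norm_integral_le_exp:
  fixes f :: "real \<Rightarrow> 'a::euclidean_space"
  assumes ax: "a \<le> x" and L: "L > 0" and Q: "Q \<ge> 0" and f: "continuous_on {a..x} f"
    and le: "\<And>s. s \<in> {a..x} \<Longrightarrow> norm (f s) \<le> Q * exp (L * s)"
  shows "norm (integral {a..x} f) \<le> Q / L * exp (L * x)"
proof -
  have "((\<lambda>s. Q * exp (L * s)) has_integral Q / L * exp (L * x) - Q / L * exp (L * a)) {a..x}"
    by (rule fundamental_theorem_of_calculus[OF ax])
      (use L in \<open>auto intro!: derivative_eq_intros simp: has_real_derivative_iff_has_vector_derivative[symmetric]\<close>)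
  then have "norm (integral {a..x} f) \<le> Q / L * exp (L * x) - Q / L * exp (L * a)"
    using HK_norm_bound[OF integrable_continuous_real[OF f], of "\<lambda>s. Q * exp (L * s)"] le
    by (auto simp: has_integral_iff)
  also have "\<dots> \<le> Q / L * exp (L * x)" using Q L by simp
  finally show ?thesis .
qed

text \<open>Only values at \<open>t \<le> x\<close> enter, so \<open>x\<close> itself is the weight
  exponent. The product stays abstract because the unknown is a matrix for the gauge
  \<open>u\<close> and a vector for the inverse of a Volterra operator.\<close>

lemma volterra_solution:
  fixes k :: "real \<Rightarrow> real \<Rightarrow> 'c::euclidean_space" and s :: "real \<Rightarrow> 'a::euclidean_space"
    and pr :: "'c \<Rightarrow> 'a \<Rightarrow> 'a"
  assumes pr: "bounded_bilinear pr" and k: "continuous_on UNIV (\<lambda>(x, t). k x t)"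
    and s: "continuous_on {0..r} s" and r: "r \<ge> 0"
  shows "\<exists>h. continuous_on UNIV h \<and> (\<forall>x\<in>{0..r}. h x = s x + integral {0..x} (\<lambda>t. pr (k x t) (h t)))"
proof -
  interpret bounded_bilinear pr by fact
  obtain K where K: "K \<ge> 0" "\<And>a b. norm (pr a b) \<le> norm a * norm b * K" using nonneg_bounded by auto
  obtain M where M0: "M \<ge> 0" and M: "\<And>x t. x \<in> {0..r} \<Longrightarrow> t \<in> {0..r} \<Longrightarrow> norm (k x t) \<le> M"
    by (rule kernel_norm_bound[OF k, of 0 r]) blast
  have kx: "continuous_on S (k x)" for x S
    by (rule continuous_on_compose2[OF k, of _ "\<lambda>y. (x, y)", simplified], intro continuous_intros)
  show ?thesis
  proof (rule weighted_contraction_fixpoint[where l="\<lambda>x. x" and C="M * K"])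
    fix f :: "real \<Rightarrow> 'a" assume f: "continuous_on UNIV f"
    have "continuous_on UNIV (\<lambda>(x, t). pr (k x t) (f t))"
      using continuous_on[OF k, of "\<lambda>z. f (snd z)"] continuous_on_compose2[OF f, of UNIV snd]
      by (simp add: case_prod_beta' continuous_on_snd[OF continuous_on_id])
    then show "continuous_on {0..r} (\<lambda>x. s x + integral {0..x} (\<lambda>t. pr (k x t) (f t)))"
      by (intro continuous_on_add s continuous_on_parametric_integral) auto
  next
    fix f g :: "real \<Rightarrow> 'a" and B L x
    assume f: "continuous_on UNIV f" and g: "continuous_on UNIV g" and B: "B \<ge> 0" and L: "L > 0"
      and x: "x \<in> {0..r}" and le: "\<And>w. w \<in> {0..r} \<Longrightarrow> norm (f w - g w) \<le> B * exp (L * w)"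
    have fc: "continuous_on S f" and gc: "continuous_on S g" for S
      using f g by (auto intro: continuous_on_subset)
    have "(s x + integral {0..x} (\<lambda>t. pr (k x t) (f t))) - (s x + integral {0..x} (\<lambda>t. pr (k x t) (g t)))
        = integral {0..x} (\<lambda>t. pr (k x t) (f t - g t))"
      by (simp add: diff_right HK_diff integrable_continuous_real
          continuous_on kx fc gc)
    also have "norm \<dots> \<le> (M * K * B) / L * exp (L * x)"
    proof (rule norm_integral_le_exp)
      fix t assume t: "t \<in> {0..x}"
      have "norm (pr (k x t) (f t - g t)) \<le> norm (k x t) * norm (f t - g t) * K" by (rule K)
      also have "\<dots> \<le> M * (B * exp (L * t)) * K"
        using x t M0 K B by (intro mult_right_mono mult_mono M le) auto
      finally show "norm (pr (k x t) (f t - g t)) \<le> M * K * B * exp (L * t)" by (simp add: mult_ac)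
    qed (use x L M0 K B in \<open>auto intro!: continuous_on kx continuous_intros fc gc\<close>)
    finally show "norm ((s x + integral {0..x} (\<lambda>t. pr (k x t) (f t))) - (s x + integral {0..x} (\<lambda>t. pr (k x t) (g t))))
        \<le> M * K / L * B * exp (L * x)" by simp
  qed (use r M0 K in auto)
qed

section \<open>A Goursat problem with reflection at \<open>t = 0\<close>\<close>

text \<open>
  \<open>N\<close> encodes both unknowns of the characteristic system in the coordinate \<open>y = x \<plusminus> t\<close>:
  \<open>N(x, x + t) = m(x,t)\<close> and \<open>N(x, x - t) = p(x,t) - 2\<kappa>(x - t)\<close>, where \<open>\<kappa> = k\<^sub>Y(\<cdot>,0)\<close>.
  Subtracting \<open>2\<kappa>\<close> removes the jump across \<open>t = 0\<close>, so that \<open>N\<close> is continuous.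
\<close>

lemma goursat_solution:
  fixes \<tau> \<kappa> :: "real \<Rightarrow> complex^'n^'n"
  assumes \<tau>: "continuous_on UNIV \<tau>" and \<kappa>: "continuous_on UNIV \<kappa>" and r: "r \<ge> 0"
  shows "\<exists>N. continuous_on UNIV N \<and> (\<forall>x y. 0 \<le> y \<longrightarrow> y \<le> 2 * x \<longrightarrow> x \<le> r \<longrightarrow>
      N (x, y) = - \<tau> (y / 2) - integral {y/2..min x y} (\<lambda>s. 2 *\<^sub>R (\<tau> s ** \<kappa> (2 * s - y)))
        - integral {y/2..x} (\<lambda>s. \<tau> s ** N (s, 2 * s - y)))"
proof -
  \<comment> \<open>Two copies of the triangle \<open>0 \<le> t \<le> x \<le> r\<close>, one with
    \<open>y = x + t\<close> and one with \<open>y = x - t\<close>, glued along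
    \<open>t = 0\<close>, that is \<open>y = x\<close>.\<close>
  define D where "D = {z. 0 \<le> snd z \<and> snd z \<le> 2 * fst z \<and> fst z \<le> (r::real)}"
  have Dcl: "closed D" unfolding D_def
    by (intro closed_Collect_conj closed_Collect_le continuous_intros)
  have "D \<subseteq> {0..r} \<times> {0..2 * r}" by (auto simp: D_def)
  then have "bounded D" by (rule bounded_subset[rotated]) (simp add: bounded_Times)
  with Dcl have D: "compact D" by (simp add: compact_eq_bounded_closed)
  have Dcv: "convex D"
  proof (rule convexI)
    fix z w and u v :: real assume "z \<in> D" "w \<in> D" "0 \<le> u" "0 \<le> v" "u + v = 1"
    moreover have "u * fst z + v * fst w \<le> r"
      using \<open>z \<in> D\<close> \<open>w \<in> D\<close> convex_bound_le[of "fst z" r "fst w" u v] \<open>0 \<le> u\<close> \<open>0 \<le> v\<close> \<open>u + v = 1\<close> by (auto simp: D_def)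
    moreover have "u * snd z \<le> u * (2 * fst z)" "v * snd w \<le> v * (2 * fst w)"
      using \<open>z \<in> D\<close> \<open>w \<in> D\<close> \<open>0 \<le> u\<close> \<open>0 \<le> v\<close> by (auto simp: D_def intro!: mult_left_mono)
    ultimately show "u *\<^sub>R z + v *\<^sub>R w \<in> D" by (auto simp: D_def)
  qed
  have Dne: "D \<noteq> {}" using r by (auto simp: D_def intro!: exI[of _ 0])
  obtain K where K: "K > 0" "\<And>(X :: complex^'n^'n) (Y :: complex^'n^'n). norm (X ** Y) \<le> norm X * norm Y * K"
    using mm.pos_bounded by blast
  obtain M where M0: "M \<ge> 0" and M: "\<And>x. x \<in> {0..r} \<Longrightarrow> norm (\<tau> x) \<le> M"
    by (rule continuous_image_norm_bound[OF continuous_on_subset[OF \<tau> subset_UNIV] compact_Icc]) blast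
  have tc: "continuous_on S \<tau>" for S using \<tau> by (rule continuous_on_subset) auto
  note tc2 = continuous_on_compose2[OF \<tau>, of _ _, simplified] and kc2 = continuous_on_compose2[OF \<kappa>, of _ _, simplified]
  \<comment> \<open>A characteristic starts on the diagonal at \<open>s = y / 2\<close>, runs along
    \<open>s + v = y\<close> until \<open>s = y\<close>, where \<open>v = 0\<close> and
    \<open>p = m + 2 \<kappa>\<close>, and continues reflected along \<open>s - v = y\<close>. The
    partner unknown always has the coordinate \<open>2 * s - y\<close>. Only before the reflection
    is the partner \<open>p\<close>, whose share \<open>2 \<kappa>\<close> gives the integral that
    stops at \<open>min x y\<close>.\<close>
  define T where "T = (\<lambda>(N :: real \<times> real \<Rightarrow> complex^'n^'n) z.
    - \<tau> (snd z / 2) - integral {snd z/2..min (fst z) (snd z)} (\<lambda>s. 2 *\<^sub>R (\<tau> s ** \<kappa> (2 * s - snd z)))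
        - integral {snd z/2..fst z} (\<lambda>s. \<tau> s ** N (s, 2 * s - snd z)))"
  \<comment> \<open>\<open>T\<close> looks only at \<open>N (s, _)\<close> with
    \<open>s \<le> x\<close>, so it is of Volterra type in the first coordinate, which becomes the
    weight exponent.\<close>
  have "\<exists>N. continuous_on UNIV N \<and> (\<forall>z\<in>D. N z = T N z)"
  proof (rule weighted_contraction_fixpoint[OF D Dcv Dne, where l=fst and C="M * K"])
    fix f :: "real \<times> real \<Rightarrow> complex^'n^'n" assume f: "continuous_on UNIV f"
    show "continuous_on D (T f)" unfolding T_def
    proof (intro continuous_on_diff continuous_on_minus)
      show "continuous_on D (\<lambda>z. \<tau> (snd z / 2))" by (rule tc2) (auto intro!: continuous_intros)
      show "continuous_on D (\<lambda>z. integral {snd z/2..min (fst z) (snd z)} (\<lambda>s. 2 *\<^sub>R (\<tau> s ** \<kappa> (2 * s - snd z))))"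
      proof (rule continuous_on_parametric_integral)
        show "continuous_on UNIV (\<lambda>(z :: real \<times> real, s). 2 *\<^sub>R (\<tau> s ** \<kappa> (2 * s - snd z)))"
          unfolding case_prod_beta'
          by (intro continuous_on_scaleR continuous_on_const mm.continuous_on tc2 kc2) (intro continuous_intros)+
      qed (auto simp: D_def intro!: continuous_intros)
      show "continuous_on D (\<lambda>z. integral {snd z/2..fst z} (\<lambda>s. \<tau> s ** f (s, 2 * s - snd z)))"
      proof (rule continuous_on_parametric_integral)
        show "continuous_on UNIV (\<lambda>(z :: real \<times> real, s). \<tau> s ** f (s, 2 * s - snd z))"
          unfolding case_prod_beta'
          by (intro mm.continuous_on tc2 continuous_on_compose2[OF f, of _ "\<lambda>z. (snd z, 2 * snd z - snd (fst z))", simplified])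
            (intro continuous_intros)+
      qed (auto simp: D_def intro!: continuous_intros)
    qed
  next
    fix f g :: "real \<times> real \<Rightarrow> complex^'n^'n" and B L z
    assume f: "continuous_on UNIV f" and g: "continuous_on UNIV g" and B: "B \<ge> 0" and L: "L > 0"
      and z: "z \<in> D" and le: "\<And>w. w \<in> D \<Longrightarrow> norm (f w - g w) \<le> B * exp (L * fst w)"
    obtain x y where xy: "z = (x, y)" by force
    have fc: "continuous_on S (\<lambda>s. h (s, 2 * s - y))" if "continuous_on UNIV h" for h :: "real \<times> real \<Rightarrow> complex^'n^'n" and S
      by (rule continuous_on_compose2[OF that, of _ "\<lambda>s. (s, 2 * s - y)", simplified]) (intro continuous_intros)
    have "norm (T f z - T g z) = norm (integral {y/2..x} (\<lambda>s. \<tau> s ** (f (s, 2 * s - y) - g (s, 2 * s - y))))"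
      unfolding T_def xy
      by (simp add: mm.diff_right HK_diff integrable_continuous_real
          mm.continuous_on tc fc f g norm_minus_commute)
    also have "\<dots> \<le> (M * K * B) / L * exp (L * x)"
    proof (rule norm_integral_le_exp)
      fix s assume s: "s \<in> {y/2..x}"
      have "norm (\<tau> s ** (f (s, 2 * s - y) - g (s, 2 * s - y))) \<le> norm (\<tau> s) * norm (f (s, 2 * s - y) - g (s, 2 * s - y)) * K"
        by (rule K)
      also have "\<dots> \<le> M * (B * exp (L * fst (s, 2 * s - y))) * K"
        using z s M0 K B by (intro mult_right_mono mult_mono M le) (auto simp: D_def xy)
      finally show "norm (\<tau> s ** (f (s, 2 * s - y) - g (s, 2 * s - y))) \<le> M * K * B * exp (L * s)" by (simp add: mult_ac)
    qed (use z L M0 K B in \<open>auto simp: D_def xy intro!: mm.continuous_on tc continuous_on_diff fc f g\<close>)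
    finally show "norm (T f z - T g z) \<le> M * K / L * B * exp (L * fst z)" by (simp add: xy)
  qed (use M0 K in \<open>auto intro!: continuous_intros\<close>)
  then show ?thesis unfolding T_def D_def by auto
qed

section \<open>Transmutation kernels\<close>

lemma integral_shift_by:
  fixes f :: "real \<Rightarrow> 'a::euclidean_space"
  shows "integral {a..b} f = integral {a + c..b + c} (\<lambda>y. f (y - c))"
  using integral_shift_Icc_real[of a b "\<lambda>y. f (y - c)" c] by (simp add: o_def)

lemma integral_reflect_about:
  fixes f :: "real \<Rightarrow> 'a::euclidean_space"
  shows "integral {a..b} f = integral {c - b..c - a} (\<lambda>y. f (c - y))"
  using Henstock_Kurzweil_Integration.integral_reflect_real[of b a f]
    integral_shift_by[of "- b" "- a" "\<lambda>y. f (- y)" c] by simp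

text \<open>\<open>mat 1 + integral {t..x} (kX x)\<close> is the kernel of \<open>X I\<close>; the
  two equations thus state \<open>(d + \<tau>) X I = Y\<close> and
  \<open>(d - \<tau>) Y I = X\<close> at the level of kernels, integrated in \<open>x\<close> so
  that continuous kernels suffice.\<close>

lemma transmutation_kernels:
  fixes \<tau> \<kappa> :: "real \<Rightarrow> complex^'n^'n"
  assumes \<tau>: "continuous_on UNIV \<tau>" and \<kappa>: "continuous_on UNIV \<kappa>" and r: "r \<ge> 0"
  obtains kX kY :: "real \<Rightarrow> real \<Rightarrow> complex^'n^'n"
  where "continuous_on UNIV (\<lambda>(x, t). kX x t)" "continuous_on UNIV (\<lambda>(x, t). kY x t)"
    "\<And>x. kY x 0 = \<kappa> x"
    "\<And>t x. 0 \<le> t \<Longrightarrow> t \<le> x \<Longrightarrow> x \<le> r \<Longrightarrow>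
      integral {t..x} (kX x) = integral {t..x} (\<lambda>s. kY s t - \<tau> s ** (mat 1 + integral {t..s} (kX s)))"
    "\<And>t x. 0 \<le> t \<Longrightarrow> t \<le> x \<Longrightarrow> x \<le> r \<Longrightarrow>
      integral {t..x} (kY x) = integral {t..x} (\<lambda>s. kX s t + \<tau> s ** (mat 1 + integral {t..s} (kY s)))"
proof -
  obtain N :: "real \<times> real \<Rightarrow> complex^'n^'n" where N: "continuous_on UNIV N"
    and Neq: "\<And>x y. 0 \<le> y \<Longrightarrow> y \<le> 2 * x \<Longrightarrow> x \<le> r \<Longrightarrow>
      N (x, y) = - \<tau> (y / 2) - integral {y/2..min x y} (\<lambda>s. 2 *\<^sub>R (\<tau> s ** \<kappa> (2 * s - y)))
        - integral {y/2..x} (\<lambda>s. \<tau> s ** N (s, 2 * s - y))"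
    using goursat_solution[OF \<tau> \<kappa> r] by blast
  define m where "m = (\<lambda>x t. N (x, x + t))"
  define p where "p = (\<lambda>x t. N (x, x - t) + 2 *\<^sub>R \<kappa> (x - t))"
  have Nc: "continuous_on S (\<lambda>z. N (f z, g z))" if "continuous_on S f" "continuous_on S g"
    for S :: "'z::topological_space set" and f g
    by (rule continuous_on_compose2[OF N, of _ "\<lambda>z. (f z, g z)", simplified]) (intro continuous_intros that)
  have tc: "continuous_on S (\<lambda>z. \<tau> (f z))" and kc: "continuous_on S (\<lambda>z. \<kappa> (f z))" if "continuous_on S f"
    for S :: "'z::topological_space set" and f
    using that by (auto intro!: continuous_on_compose2[OF \<tau>] continuous_on_compose2[OF \<kappa>])
  have mc: "continuous_on S (\<lambda>z. m (f z) (g z))" and pc: "continuous_on S (\<lambda>z. p (f z) (g z))"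
    if "continuous_on S f" "continuous_on S g" for S :: "'z::topological_space set" and f g
    unfolding m_def p_def by (intro continuous_intros Nc kc that)+
  have int_left: "integral {a..b} (\<lambda>v. M ** f v) = M ** integral {a..b} f"
    if "continuous_on {a..b} f" for M :: "complex^'n^'n" and f :: "real \<Rightarrow> complex^'n^'n" and a b
    using integral_linear[OF integrable_continuous_real[OF that] mm.bounded_linear_right[of M]] by (simp add: o_def)
  \<comment> \<open>The divergence theorem for the characteristic system on the triangle \<open>t \<le> v \<le> s \<le> x\<close>,
    obtained by integrating along characteristics because \<open>p\<close> and \<open>m\<close> are merely continuous.\<close>
  have id_A: "integral {t..x} (p x) = integral {t..x} (\<lambda>s. p s t) - integral {t..x} (\<lambda>s. \<tau> s ** integral {t..s} (m s))"
    if t: "0 \<le> t" "t \<le> x" "x \<le> r" for t x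
  proof -
    have char: "p x (x - y) = p (y + t) t - integral {y + t..x} (\<lambda>w. \<tau> w ** m w (w - y))" if y: "y \<in> {0..x - t}" for y
    proof -
      have split: "integral {y/2..x} (\<lambda>s. \<tau> s ** N (s, 2 * s - y)) =
          integral {y/2..y + t} (\<lambda>s. \<tau> s ** N (s, 2 * s - y)) + integral {y + t..x} (\<lambda>s. \<tau> s ** N (s, 2 * s - y))"
        by (rule HK_combine[symmetric])
          (use y t in \<open>auto intro!: integrable_continuous_real mm.continuous_on tc Nc continuous_intros\<close>)
      \<comment> \<open>Both points of the characteristic lie at or beyond the reflection, so the
        diagonal value and the \<open>\<kappa>\<close> integral coincide and drop out of the
        difference.\<close>
      have min: "min x y = y" "min (y + t) y = y" using y t by auto
      have "N (x, y) = N (y + t, y) - integral {y + t..x} (\<lambda>s. \<tau> s ** N (s, 2 * s - y))"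
        using Neq[of y x, unfolded min split] Neq[of y "y + t", unfolded min] y t by simp
      then show ?thesis by (simp add: p_def m_def algebra_simps)
    qed
    \<comment> \<open>The triangle in characteristic coordinates: the first entry names the line
      \<open>s - v = y\<close>, the second the position on it.\<close>
    define R where "R = {z. 0 \<le> fst z \<and> fst z + t \<le> snd z \<and> snd z \<le> (x::real)}"
    have "closed R" unfolding R_def by (intro closed_Collect_conj closed_Collect_le continuous_intros)
    moreover have "R \<subseteq> {0..x - t} \<times> {t..x}" by (auto simp: R_def)
    then have "bounded R" by (rule bounded_subset[rotated]) (simp add: bounded_Times)
    ultimately have R: "compact R" by (simp add: compact_eq_bounded_closed)
    have gc: "continuous_on UNIV (\<lambda>(y, w). \<tau> w ** m w (w - y))"
      unfolding case_prod_beta' by (intro mm.continuous_on tc mc continuous_intros)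
    have "integral {t..x} (p x) = integral {0..x - t} (\<lambda>y. p x (x - y))"
      using integral_reflect_about[of t x "p x" x] by simp
    also have "\<dots> = integral {0..x - t} (\<lambda>y. p (y + t) t - integral {y + t..x} (\<lambda>w. \<tau> w ** m w (w - y)))"
      by (rule integral_cong) (rule char)
    also have "\<dots> = integral {0..x - t} (\<lambda>y. p (y + t) t) - integral {0..x - t} (\<lambda>y. integral {y + t..x} (\<lambda>w. \<tau> w ** m w (w - y)))"
      by (intro HK_diff integrable_continuous_real pc
          continuous_on_parametric_integral[OF gc]) (auto intro!: continuous_intros)
    also have "integral {0..x - t} (\<lambda>y. p (y + t) t) = integral {t..x} (\<lambda>s. p s t)"
      using integral_shift_by[of 0 "x - t" "\<lambda>y. p (y + t) t" t] by simp
    also have "integral {0..x - t} (\<lambda>y. integral {y + t..x} (\<lambda>w. \<tau> w ** m w (w - y))) =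
        integral {t..x} (\<lambda>w. integral {0..w - t} (\<lambda>y. \<tau> w ** m w (w - y)))"
      by (rule integral_swap_region_continuous[OF gc R]) (auto simp: R_def)
    also have "\<dots> = integral {t..x} (\<lambda>w. \<tau> w ** integral {t..w} (m w))"
    proof (rule integral_cong)
      fix w assume "w \<in> {t..x}"
      have "integral {t..w} (m w) = integral {0..w - t} (\<lambda>y. m w (w - y))"
        using integral_reflect_about[of t w "m w" w] by simp
      then show "integral {0..w - t} (\<lambda>y. \<tau> w ** m w (w - y)) = \<tau> w ** integral {t..w} (m w)"
        by (simp add: int_left mc continuous_intros)
    qed
    finally show ?thesis .
  qed
  have id_B: "integral {t..x} (m x) = - integral {t..x} (\<lambda>s. m s t) - 2 *\<^sub>R integral {t..x} \<tau>
      - integral {t..x} (\<lambda>s. \<tau> s ** integral {t..s} (p s))"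
    if t: "0 \<le> t" "t \<le> x" "x \<le> r" for t x
  proof -
    \<comment> \<open>The place where the line \<open>s + v = y\<close> leaves the triangle: through
      \<open>v = t\<close> if \<open>y \<le> x + t\<close>, through \<open>s = x\<close> otherwise.
      Integrating \<open>N (e y, y)\<close> over \<open>y\<close> collects the flux through both
      sides.\<close>
    define e where "e = (\<lambda>y. min x (y - t))"
    have ec: "continuous_on S e" for S unfolding e_def by (intro continuous_intros)
    have char: "N (e y, y) = - \<tau> (y / 2) - integral {y/2..e y} (\<lambda>w. \<tau> w ** p w (y - w))" if y: "y \<in> {2 * t..2 * x}" for y
    proof -
      have e: "min (e y) y = e y" "y \<le> 2 * e y" "0 \<le> y" "e y \<le> r" using y t by (auto simp: e_def min_def)
      have "integral {y/2..e y} (\<lambda>w. \<tau> w ** p w (y - w)) =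
        integral {y/2..e y} (\<lambda>s. \<tau> s ** N (s, 2 * s - y) + 2 *\<^sub>R (\<tau> s ** \<kappa> (2 * s - y)))"
        by (simp add: p_def mm.add_right mm.scaleR_right)
      also have "\<dots> = integral {y/2..e y} (\<lambda>s. \<tau> s ** N (s, 2 * s - y)) + integral {y/2..e y} (\<lambda>s. 2 *\<^sub>R (\<tau> s ** \<kappa> (2 * s - y)))"
        by (intro HK_add integrable_continuous_real continuous_on_scaleR
            continuous_on_const mm.continuous_on tc kc Nc) (intro continuous_intros)+
      finally show ?thesis using Neq[OF e(3,2,4)] e(1) by simp
    qed
    define R where "R = {z. 2 * t \<le> fst z \<and> fst z \<le> 2 * x \<and> fst z \<le> 2 * snd z \<and> snd z \<le> x \<and> snd z \<le> fst z - t}"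
    have "closed R" unfolding R_def by (intro closed_Collect_conj closed_Collect_le continuous_intros)
    moreover have "R \<subseteq> {2 * t..2 * x} \<times> {t..x}" by (auto simp: R_def)
    then have "bounded R" by (rule bounded_subset[rotated]) (simp add: bounded_Times)
    ultimately have R: "compact R" by (simp add: compact_eq_bounded_closed)
    have gc: "continuous_on UNIV (\<lambda>(y, w). \<tau> w ** p w (y - w))"
      unfolding case_prod_beta' by (intro mm.continuous_on tc pc continuous_intros)
    have "integral {2 * t..2 * x} (\<lambda>y. N (e y, y)) =
        integral {2 * t..x + t} (\<lambda>y. N (e y, y)) + integral {x + t..2 * x} (\<lambda>y. N (e y, y))"
      by (rule HK_combine[symmetric])
        (use t in \<open>auto intro!: integrable_continuous_real Nc ec continuous_intros\<close>)
    also have "integral {2 * t..x + t} (\<lambda>y. N (e y, y)) = integral {2 * t..x + t} (\<lambda>y. m (y - t) t)"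
      by (rule integral_cong) (auto simp: e_def m_def)
    also have "\<dots> = integral {t..x} (\<lambda>s. m s t)"
      using integral_shift_by[of t x "\<lambda>s. m s t" t] by simp
    also have "integral {x + t..2 * x} (\<lambda>y. N (e y, y)) = integral {x + t..2 * x} (\<lambda>y. m x (y - x))"
      by (rule integral_cong) (auto simp: e_def m_def)
    also have "\<dots> = integral {t..x} (m x)"
      using integral_shift_by[of t x "m x" x] by (simp add: add.commute)
    finally have "integral {t..x} (\<lambda>s. m s t) + integral {t..x} (m x) = integral {2 * t..2 * x} (\<lambda>y. N (e y, y))" by simp
    also have "\<dots> = integral {2 * t..2 * x} (\<lambda>y. - \<tau> (y / 2) - integral {y/2..e y} (\<lambda>w. \<tau> w ** p w (y - w)))"
      by (rule integral_cong) (rule char)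
    also have "\<dots> = integral {2 * t..2 * x} (\<lambda>y. - \<tau> (y / 2)) - integral {2 * t..2 * x} (\<lambda>y. integral {y/2..e y} (\<lambda>w. \<tau> w ** p w (y - w)))"
      using t by (intro HK_diff integrable_continuous_real continuous_on_minus tc
          continuous_on_parametric_integral[OF gc]) (auto simp: e_def intro!: continuous_intros)
    \<comment> \<open>The contribution of the diagonal. Halved in the passage from \<open>p\<close>,
      \<open>m\<close> to the kernels, it becomes the \<open>mat 1\<close> terms of both kernel
      equations.\<close>
    also have "integral {2 * t..2 * x} (\<lambda>y. - \<tau> (y / 2)) = - (2 *\<^sub>R integral {t..x} \<tau>)"
    proof -
      have "((\<lambda>s. 2 *\<^sub>R \<tau> (2 * s / 2)) has_integral integral {2 * t..2 * x} (\<lambda>y. \<tau> (y / 2))) {t..x}"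
        by (rule has_integral_substitution[where g="\<lambda>s. 2 * s" and f="\<lambda>y. \<tau> (y / 2)" and c="2 * t" and d="2 * x"])
          (use t in \<open>auto intro!: derivative_eq_intros tc continuous_intros\<close>)
      from integral_unique[OF this] show ?thesis by simp
    qed
    also have "integral {2 * t..2 * x} (\<lambda>y. integral {y/2..e y} (\<lambda>w. \<tau> w ** p w (y - w))) =
       integral {t..x} (\<lambda>w. integral {w + t..2 * w} (\<lambda>y. \<tau> w ** p w (y - w)))"
      by (rule integral_swap_region_continuous[OF gc R]) (auto simp: R_def e_def)
    also have "\<dots> = integral {t..x} (\<lambda>w. \<tau> w ** integral {t..w} (p w))"
    proof (rule integral_cong)
      fix w assume "w \<in> {t..x}"
      have "integral {t..w} (p w) = integral {w + t..2 * w} (\<lambda>y. p w (y - w))"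
        using integral_shift_by[of t w "p w" w] by (simp add: add.commute)
      then show "integral {w + t..2 * w} (\<lambda>y. \<tau> w ** p w (y - w)) = \<tau> w ** integral {t..w} (p w)"
        by (simp add: int_left pc continuous_intros)
    qed
    finally have sum: "integral {t..x} (\<lambda>s. m s t) + integral {t..x} (m x) =
      - (2 *\<^sub>R integral {t..x} \<tau>) - integral {t..x} (\<lambda>w. \<tau> w ** integral {t..w} (p w))" .
    have "integral {t..x} (m x) = (integral {t..x} (\<lambda>s. m s t) + integral {t..x} (m x)) - integral {t..x} (\<lambda>s. m s t)"
      by simp
    also have "\<dots> = - integral {t..x} (\<lambda>s. m s t) - 2 *\<^sub>R integral {t..x} \<tau>
        - integral {t..x} (\<lambda>s. \<tau> s ** integral {t..s} (p s))"
      unfolding sum by (simp add: algebra_simps)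
    finally show ?thesis .
  qed
  define kX kY where "kX = (\<lambda>x t. (1/2) *\<^sub>R (p x t + m x t))" and "kY = (\<lambda>x t. (1/2) *\<^sub>R (p x t - m x t))"
  have pm: "continuous_on S (\<lambda>s. integral {t..s} (p s))" "continuous_on S (\<lambda>s. integral {t..s} (m s))"
    if "S \<subseteq> {t..}" for t S
    by (rule continuous_on_parametric_integral;
        use that in \<open>auto simp: case_prod_beta' intro!: pc mc continuous_intros\<close>)+
  have kX_int: "integral {a..b} (kX x) = (1/2) *\<^sub>R (integral {a..b} (p x) + integral {a..b} (m x))"
    and kY_int: "integral {a..b} (kY x) = (1/2) *\<^sub>R (integral {a..b} (p x) - integral {a..b} (m x))" for a b x
    unfolding kX_def kY_def
    by (simp_all add: HK_add HK_diff
        integrable_continuous_real pc mc continuous_intros)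
  show thesis
  proof
    show "continuous_on UNIV (\<lambda>(x, t). kX x t)" "continuous_on UNIV (\<lambda>(x, t). kY x t)"
      unfolding kX_def kY_def case_prod_beta' by (intro continuous_intros pc mc)+
    show "kY x 0 = \<kappa> x" for x by (simp add: kY_def p_def m_def)
    fix t x assume t: "0 \<le> t" "t \<le> x" "x \<le> r"
    have I: "((\<lambda>s. p s t) has_integral integral {t..x} (\<lambda>s. p s t)) {t..x}"
      "((\<lambda>s. m s t) has_integral integral {t..x} (\<lambda>s. m s t)) {t..x}"
      "(\<tau> has_integral integral {t..x} \<tau>) {t..x}"
      "((\<lambda>s. \<tau> s ** integral {t..s} (p s)) has_integral integral {t..x} (\<lambda>s. \<tau> s ** integral {t..s} (p s))) {t..x}"
      "((\<lambda>s. \<tau> s ** integral {t..s} (m s)) has_integral integral {t..x} (\<lambda>s. \<tau> s ** integral {t..s} (m s))) {t..x}"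
      by (rule integrable_integral, rule integrable_continuous_real,
          auto intro!: pc mc pm mm.continuous_on tc continuous_intros)+
    note cX = has_integral_diff[OF has_integral_diff[OF has_integral_cmul[OF has_integral_diff[OF I(1,2)], of "1/2"] I(3)]
        has_integral_cmul[OF has_integral_add[OF I(4,5)], of "1/2"]]
    note cY = has_integral_add[OF has_integral_add[OF has_integral_cmul[OF has_integral_add[OF I(1,2)], of "1/2"] I(3)]
        has_integral_cmul[OF has_integral_diff[OF I(4,5)], of "1/2"]]
    have eX: "integral {t..x} (\<lambda>s. kY s t - \<tau> s ** (mat 1 + integral {t..s} (kX s))) =
       (1/2) *\<^sub>R (integral {t..x} (\<lambda>s. p s t) - integral {t..x} (\<lambda>s. m s t)) - integral {t..x} \<tau> -
       (1/2) *\<^sub>R (integral {t..x} (\<lambda>s. \<tau> s ** integral {t..s} (p s)) + integral {t..x} (\<lambda>s. \<tau> s ** integral {t..s} (m s)))"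
      by (rule integral_unique, rule has_integral_eq[OF _ cX])
        (simp add: kX_int kY_def mm.add_right mm.scaleR_right)
    show "integral {t..x} (kX x) = integral {t..x} (\<lambda>s. kY s t - \<tau> s ** (mat 1 + integral {t..s} (kX s)))"
      unfolding eX kX_int[of t x x] id_A[OF t] id_B[OF t] by (simp add: algebra_simps flip: scaleR_add_left)
    have eY: "integral {t..x} (\<lambda>s. kX s t + \<tau> s ** (mat 1 + integral {t..s} (kY s))) =
       (1/2) *\<^sub>R (integral {t..x} (\<lambda>s. p s t) + integral {t..x} (\<lambda>s. m s t)) + integral {t..x} \<tau> +
       (1/2) *\<^sub>R (integral {t..x} (\<lambda>s. \<tau> s ** integral {t..s} (p s)) - integral {t..x} (\<lambda>s. \<tau> s ** integral {t..s} (m s)))"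
      by (rule integral_unique, rule has_integral_eq[OF _ cY])
        (simp add: kY_int kX_def mm.add_right mm.diff_right mm.scaleR_right)
    show "integral {t..x} (kY x) = integral {t..x} (\<lambda>s. kX s t + \<tau> s ** (mat 1 + integral {t..s} (kY s)))"
      unfolding eY kY_int[of t x x] id_A[OF t] id_B[OF t] by (simp add: algebra_simps flip: scaleR_add_left)
  qed
qed

section \<open>Volterra operators of the second kind\<close>

lemma kernel_section_continuous:
  fixes k :: "real \<Rightarrow> real \<Rightarrow> 'a::topological_space"
  assumes "continuous_on UNIV (\<lambda>(x, t). k x t)"
  shows "continuous_on S (k x)" "continuous_on S (\<lambda>x. k x t)"
  by (rule continuous_on_compose2[OF assms, of _ "\<lambda>t. (x, t)", simplified], intro continuous_intros)
    (rule continuous_on_compose2[OF assms, of _ "\<lambda>x. (x, t)", simplified], intro continuous_intros)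

text \<open>Dominated convergence along sequences: \<open>f\<close> is only integrable, and both the
  kernel and the upper limit move with \<open>x\<close>.\<close>

lemma continuous_on_volterra_integral:
  fixes f :: "real \<Rightarrow> 'b::euclidean_space" and k :: "real \<Rightarrow> real \<Rightarrow> 'c::euclidean_space"
    and pr :: "'c \<Rightarrow> 'b \<Rightarrow> 'a::euclidean_space"
  assumes pr: "bounded_bilinear pr" and k: "continuous_on UNIV (\<lambda>(x, t). k x t)"
    and f: "set_integrable lborel {0..r} f"
  shows "continuous_on {0..r} (\<lambda>x. integral {0..x} (\<lambda>t. pr (k x t) (f t)))"
proof -
  interpret bounded_bilinear pr by fact
  obtain K where K: "K \<ge> 0" "\<And>a b. norm (pr a b) \<le> norm a * norm b * K" using nonneg_bounded by auto
  obtain M where M0: "M \<ge> 0" and M: "\<And>x t. x \<in> {0..r} \<Longrightarrow> t \<in> {0..r} \<Longrightarrow> norm (k x t) \<le> M"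
    by (rule kernel_norm_bound[OF k, of 0 r]) blast
  have si: "set_integrable lborel {0..x} (\<lambda>t. pr (k x t) (f t))" if "x \<in> {0..r}" for x
    by (rule set_integrable_bilinear_continuous[OF pr kernel_section_continuous(1)[OF k] set_integrable_subinterval[OF f]])
      (use that in auto)
  have eq: "integral {0..x} (\<lambda>t. pr (k x t) (f t)) = (LINT t|lborel. indicator {0..x} t *\<^sub>R pr (k x t) (f t))"
    if "x \<in> {0..r}" for x
    using set_integrable_HK(2)[OF si[OF that]] by (simp add: set_lebesgue_integral_def)
  show ?thesis unfolding continuous_on_sequentially
  proof (intro allI ballI impI, elim conjE)
    fix x :: "nat \<Rightarrow> real" and a
    assume a: "a \<in> {0..r}" and x: "\<forall>n. x n \<in> {0..r}" and lim: "x \<longlonglongrightarrow> a"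
    have "(\<lambda>n. LINT t|lborel. indicator {0..x n} t *\<^sub>R pr (k (x n) t) (f t)) \<longlonglongrightarrow>
        (LINT t|lborel. indicator {0..a} t *\<^sub>R pr (k a t) (f t))"
    proof (rule integral_dominated_convergence[where w="\<lambda>t. (M * K) *\<^sub>R norm (indicator {0..r} t *\<^sub>R f t)"])
      show "integrable lborel (\<lambda>t. (M * K) *\<^sub>R norm (indicator {0..r} t *\<^sub>R f t))"
        by (rule integrable_scaleR_right, rule Bochner_Integration.integrable_norm)
          (use f in \<open>simp add: set_integrable_def\<close>)
      show "(\<lambda>t. indicator {0..a} t *\<^sub>R pr (k a t) (f t)) \<in> borel_measurable lborel"
        using si[OF a] by (simp add: set_integrable_def)
      show "(\<lambda>t. indicator {0..x n} t *\<^sub>R pr (k (x n) t) (f t)) \<in> borel_measurable lborel" for n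
        using si[of "x n"] x by (simp add: set_integrable_def)
      show "AE t in lborel. norm (indicator {0..x n} t *\<^sub>R pr (k (x n) t) (f t)) \<le>
          (M * K) *\<^sub>R norm (indicator {0..r} t *\<^sub>R f t)" for n
      proof (intro AE_I2)
        fix t
        show "norm (indicator {0..x n} t *\<^sub>R pr (k (x n) t) (f t)) \<le> (M * K) *\<^sub>R norm (indicator {0..r} t *\<^sub>R f t)"
        proof (cases "t \<in> {0..x n}")
          case True
          then have t: "t \<in> {0..r}" "x n \<in> {0..r}" using x by (auto intro: order_trans)
          have "norm (pr (k (x n) t) (f t)) \<le> norm (k (x n) t) * norm (f t) * K" by (rule K)
          also have "\<dots> \<le> M * norm (f t) * K" using M[OF t(2,1)] K(1) by (intro mult_right_mono) auto
          finally show ?thesis using True t by (simp add: mult_ac)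
        next
          case False
          with M0 K(1) show ?thesis by simp
        qed
      qed
      \<comment> \<open>The indicators may fail to converge at \<open>t = a\<close>; this single
        point is discarded as a null set.\<close>
      show "AE t in lborel. (\<lambda>n. indicator {0..x n} t *\<^sub>R pr (k (x n) t) (f t)) \<longlonglongrightarrow> indicator {0..a} t *\<^sub>R pr (k a t) (f t)"
        using AE_lborel_singleton[of a]
      proof eventually_elim
        case (elim t)
        have "(\<lambda>n. k (x n) t) \<longlonglongrightarrow> k a t"
          by (rule continuous_on_tendsto_compose[OF kernel_section_continuous(2)[OF k, of UNIV t] lim]) auto
        then have c: "(\<lambda>n. pr (k (x n) t) (f t)) \<longlonglongrightarrow> pr (k a t) (f t)" by (intro tendsto tendsto_const)
        consider "t < 0 \<or> a < t" | "0 \<le> t" "t < a" using elim by linarith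
        then show ?case
        proof cases
          case 1
          have "\<forall>\<^sub>F n in sequentially. indicator {0..x n} t *\<^sub>R pr (k (x n) t) (f t) = 0"
          proof (cases "t < 0")
            case False
            with 1 have "a < t" by simp
            with order_tendstoD(2)[OF lim] have "\<forall>\<^sub>F n in sequentially. x n < t" by simp
            then show ?thesis by eventually_elim simp
          qed simp
          then show ?thesis using 1 by (auto intro!: tendsto_eventually)
        next
          case 2
          with order_tendstoD(1)[OF lim] have "\<forall>\<^sub>F n in sequentially. t < x n" by simp
          then have "\<forall>\<^sub>F n in sequentially. pr (k (x n) t) (f t) = indicator {0..x n} t *\<^sub>R pr (k (x n) t) (f t)"
            by eventually_elim (use 2 in simp)
          with c show ?thesis using 2 by (auto intro: Lim_transform_eventually)
        qed
      qed
    qed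
    then show "((\<lambda>x. integral {0..x} (\<lambda>t. pr (k x t) (f t))) \<circ> x) \<longlonglongrightarrow> integral {0..a} (\<lambda>t. pr (k a t) (f t))"
      using x a by (simp add: o_def eq)
  qed
qed

definition volterra :: "(real \<Rightarrow> real \<Rightarrow> complex^'n^'n) \<Rightarrow> (real \<Rightarrow> complex^'n) \<Rightarrow> real \<Rightarrow> complex^'n" where
  "volterra k f x = f x + integral {0..x} (\<lambda>t. k x t *v f t)"

lemma kernel_mult_integrable:
  fixes k :: "real \<Rightarrow> real \<Rightarrow> complex^'n^'m"
  assumes "continuous_on UNIV (\<lambda>(x, t). k x t)" "set_integrable lborel {0..r} f" "x \<in> {0..r}"
  shows "(\<lambda>t. k x t *v f t) integrable_on {0..x}"
  by (rule set_integrable_HK(1)[OF set_integrable_bilinear_continuous[OF bilinear_mv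
      kernel_section_continuous(1)[OF assms(1)] set_integrable_subinterval[OF assms(2)]]]) (use assms(3) in auto)

lemma volterra_add:
  assumes "continuous_on UNIV (\<lambda>(x, t). k x t)" "set_integrable lborel {0..r} f" "set_integrable lborel {0..r} g" "x \<in> {0..r}"
  shows "volterra k (\<lambda>t. f t + g t) x = volterra k f x + volterra k g x"
  using kernel_mult_integrable[OF assms(1,2,4)] kernel_mult_integrable[OF assms(1,3,4)]
  by (simp add: volterra_def mv.add_right HK_add)

lemma volterra_diff:
  assumes "continuous_on UNIV (\<lambda>(x, t). k x t)" "set_integrable lborel {0..r} f" "set_integrable lborel {0..r} g" "x \<in> {0..r}"
  shows "volterra k (\<lambda>t. f t - g t) x = volterra k f x - volterra k g x"
  using kernel_mult_integrable[OF assms(1,2,4)] kernel_mult_integrable[OF assms(1,3,4)]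
  by (simp add: volterra_def mv.diff_right HK_diff)

lemma volterra_const:
  fixes k :: "real \<Rightarrow> real \<Rightarrow> complex^'n^'n"
  assumes "continuous_on UNIV (\<lambda>(x, t). k x t)"
  shows "volterra k (\<lambda>t. c) x = (mat 1 + integral {0..x} (k x)) *v c"
  using integral_linear[OF integrable_continuous_real[OF kernel_section_continuous(1)[OF assms]] mv.bounded_linear_left[of c]]
  by (simp add: volterra_def o_def mv.add_left)

lemma volterra_cong:
  assumes "\<And>t. t \<in> {0..x} \<Longrightarrow> f t = g t" "x \<ge> 0"
  shows "volterra k f x = volterra k g x"
  using integral_cong[of "{0..x}" "\<lambda>t. k x t *v f t" "\<lambda>t. k x t *v g t"] assms by (simp add: volterra_def)

text \<open>Fubini on the triangle computes the kernel of the composition with integration; it is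
  the expression in which the kernel equations are phrased.\<close>

lemma volterra_primitive:
  fixes k :: "real \<Rightarrow> real \<Rightarrow> complex^'n^'n"
  assumes k: "continuous_on UNIV (\<lambda>(x, t). k x t)" and g: "set_integrable lborel {0..r} g" and x: "x \<in> {0..r}"
  shows "volterra k (\<lambda>s. integral {0..s} g) x = integral {0..x} (\<lambda>t. (mat 1 + integral {t..x} (k x)) *v g t)"
proof -
  have gx: "set_integrable lborel {0..x} g" by (rule set_integrable_subinterval[OF g]) (use x in auto)
  have "integral {0..x} (\<lambda>t. k x t *v integral {0..t} g) = integral {0..x} (\<lambda>t. integral {0..t} (\<lambda>s. k x t *v g s))"
  proof (rule integral_cong)
    fix t assume t: "t \<in> {0..x}"
    have "g integrable_on {0..t}"
      by (rule set_integrable_HK(1)[OF set_integrable_subinterval[OF gx]]) (use t in auto)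
    from integral_linear[OF this mv.bounded_linear_right[of "k x t"]]
    show "k x t *v integral {0..t} g = integral {0..t} (\<lambda>s. k x t *v g s)" by (simp add: o_def)
  qed
  also have "\<dots> = integral {0..x} (\<lambda>s. integral {s..x} (k x) *v g s)"
    by (rule integral_swap_triangle(1)[OF bilinear_mv _ gx])
      (auto simp: case_prod_beta' intro!: continuous_on_compose2[OF kernel_section_continuous(1)[OF k, of UNIV]] continuous_intros)
  finally have 1: "integral {0..x} (\<lambda>t. k x t *v integral {0..t} g) = integral {0..x} (\<lambda>s. integral {s..x} (k x) *v g s)" .
  have "(\<lambda>s. integral {s..x} (k x) *v g s) integrable_on {0..x}"
  proof (rule set_integrable_HK(1)[OF set_integrable_bilinear_continuous[OF bilinear_mv _ gx]])
    show "continuous_on {0..x} (\<lambda>s. integral {s..x} (k x))"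
      by (rule continuous_on_parametric_integral)
        (auto simp: case_prod_beta' intro!: continuous_on_compose2[OF kernel_section_continuous(1)[OF k, of UNIV]] continuous_intros)
  qed
  with 1 set_integrable_HK(1)[OF gx] show ?thesis
    by (simp add: volterra_def mv.add_left HK_add)
qed

text \<open>Passes from kernels to operators: expand the primitive by its kernel, insert the kernel
  equation, undo Fubini. It is applied to \<open>(kX, kY, \<tau>)\<close> and to
  \<open>(kY, kX, - \<tau>)\<close>.\<close>

lemma volterra_intertwining:
  fixes kX kY :: "real \<Rightarrow> real \<Rightarrow> complex^'n^'n"
  assumes kX: "continuous_on UNIV (\<lambda>(x, t). kX x t)" and kY: "continuous_on UNIV (\<lambda>(x, t). kY x t)"
    and \<sigma>: "continuous_on UNIV \<sigma>" and g: "set_integrable lborel {0..r} g" and x: "x \<in> {0..r}"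
    and eq: "\<And>t x. 0 \<le> t \<Longrightarrow> t \<le> x \<Longrightarrow> x \<le> r \<Longrightarrow>
      integral {t..x} (kX x) = integral {t..x} (\<lambda>s. kY s t - \<sigma> s ** (mat 1 + integral {t..s} (kX s)))"
  shows "volterra kX (\<lambda>s. integral {0..s} g) x =
    integral {0..x} (\<lambda>s. volterra kY g s - \<sigma> s *v volterra kX (\<lambda>s. integral {0..s} g) s)"
proof -
  \<comment> \<open>\<open>max t s\<close> keeps the limits ordered, which makes \<open>Z\<close>
    continuous on the whole plane; its values matter only for \<open>t \<le> s\<close>.\<close>
  define Z where "Z = (\<lambda>s t. kY s t - \<sigma> s ** (mat 1 + integral {t..max t s} (kX s)))"
  have gx: "set_integrable lborel {0..x} g" by (rule set_integrable_subinterval[OF g]) (use x in auto)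
  have kXc: "continuous_on UNIV (\<lambda>z :: real \<times> real. integral {snd z..max (snd z) (fst z)} (kX (fst z)))"
  proof (rule continuous_on_parametric_integral)
    show "continuous_on UNIV (\<lambda>(z :: real \<times> real, s). kX (fst z) s)"
      unfolding case_prod_beta'
      by (rule continuous_on_compose2[OF kX, of _ "\<lambda>z. (fst (fst z), snd z)", simplified]) (intro continuous_intros)
  qed (auto intro!: continuous_intros)
  have Z: "continuous_on UNIV (\<lambda>(s, t). Z s t)"
    unfolding Z_def case_prod_beta'
    by (intro continuous_on_diff continuous_on_add mm.continuous_on continuous_on_const kXc
        continuous_on_compose2[OF \<sigma>] kY[unfolded case_prod_beta']) (auto intro!: continuous_intros)
  have Zeq: "integral {t..x} (kX x) = integral {t..x} (\<lambda>s. Z s t)" if "t \<in> {0..x}" for t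
  proof -
    have "integral {t..x} (\<lambda>s. Z s t) = integral {t..x} (\<lambda>s. kY s t - \<sigma> s ** (mat 1 + integral {t..s} (kX s)))"
      by (rule integral_cong) (simp add: Z_def)
    with eq[of t x] that x show ?thesis by simp
  qed
  have gi: "g integrable_on {0..x}" by (rule set_integrable_HK(1)[OF gx])
  have Zx: "continuous_on {0..x} (\<lambda>t. integral {t..x} (\<lambda>s. Z s t))"
  proof (rule continuous_on_parametric_integral)
    show "continuous_on UNIV (\<lambda>(t, s). Z s t)"
      using continuous_on_compose2[OF Z continuous_on_swap, of UNIV] by (simp add: case_prod_beta' prod.swap_def)
  qed (auto intro!: continuous_intros)
  have Zg: "(\<lambda>t. integral {t..x} (\<lambda>s. Z s t) *v g t) integrable_on {0..x}"
    by (rule set_integrable_HK(1)[OF set_integrable_bilinear_continuous[OF bilinear_mv Zx gx]])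
  have "volterra kX (\<lambda>s. integral {0..s} g) x = integral {0..x} (\<lambda>t. g t + integral {t..x} (\<lambda>s. Z s t) *v g t)"
    unfolding volterra_primitive[OF kX g x]
    by (rule integral_cong) (simp add: Zeq mv.add_left)
  also have "\<dots> = integral {0..x} g + integral {0..x} (\<lambda>s. integral {0..s} (\<lambda>t. Z s t *v g t))"
    unfolding integral_swap_triangle(1)[OF bilinear_mv Z gx]
    by (rule HK_add[OF gi Zg])
  also have "\<dots> = integral {0..x} (\<lambda>s. g s + integral {0..s} (\<lambda>t. Z s t *v g t))"
    by (rule HK_add[symmetric, OF gi integral_swap_triangle(2)[OF bilinear_mv Z gx]])
  also have "\<dots> = integral {0..x} (\<lambda>s. volterra kY g s - \<sigma> s *v volterra kX (\<lambda>s. integral {0..s} g) s)"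
  proof (rule integral_cong)
    fix s assume "s \<in> {0..x}"
    then have s: "s \<in> {0..r}" using x by auto
    have gs: "set_integrable lborel {0..s} g" by (rule set_integrable_subinterval[OF g]) (use s in auto)
    have kc: "continuous_on {0..s} (\<lambda>t. mat 1 + integral {t..s} (kX s))"
      by (intro continuous_on_add continuous_on_const continuous_on_parametric_integral)
        (auto simp: case_prod_beta' intro!: continuous_on_compose2[OF kernel_section_continuous(1)[OF kX, of UNIV]] continuous_intros)
    have i1: "(\<lambda>t. (mat 1 + integral {t..s} (kX s)) *v g t) integrable_on {0..s}"
      by (rule set_integrable_HK(1)[OF set_integrable_bilinear_continuous[OF bilinear_mv kc gs]])
    have "integral {0..s} (\<lambda>t. Z s t *v g t) =
        integral {0..s} (\<lambda>t. kY s t *v g t - \<sigma> s *v ((mat 1 + integral {t..s} (kX s)) *v g t))"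
      by (rule integral_cong) (simp add: Z_def mv.diff_left matrix_vector_mul_assoc max_def)
    also have "\<dots> = integral {0..s} (\<lambda>t. kY s t *v g t) - \<sigma> s *v volterra kX (\<lambda>s. integral {0..s} g) s"
      unfolding volterra_primitive[OF kX g s]
      using integral_linear[OF i1 mv.bounded_linear_right[of "\<sigma> s"]] integrable_linear[OF i1 mv.bounded_linear_right[of "\<sigma> s"]]
        kernel_mult_integrable[OF kY g s]
      by (simp add: o_def HK_diff)
    finally show "g s + integral {0..s} (\<lambda>t. Z s t *v g t) = volterra kY g s - \<sigma> s *v volterra kX (\<lambda>s. integral {0..s} g) s"
      by (simp add: volterra_def)
  qed
  finally show ?thesis .
qed

text \<open>The first estimate feeds Gronwall's inequality, the second the bounds in L2
  norm.\<close>

lemma volterra_integral_bound: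
  fixes k :: "real \<Rightarrow> real \<Rightarrow> complex^'n^'n"
  assumes k: "continuous_on UNIV (\<lambda>(x, t). k x t)" and r: "r > 0"
  obtains C where "C \<ge> 0"
    "\<And>f x. set_integrable lborel {0..r} f \<Longrightarrow> x \<in> {0..r} \<Longrightarrow>
      norm (integral {0..x} (\<lambda>t. k x t *v f t)) \<le> C * integral {0..x} (\<lambda>t. norm (f t))"
    "\<And>f x. L2_on r f \<Longrightarrow> x \<in> {0..r} \<Longrightarrow>
      norm (integral {0..x} (\<lambda>t. k x t *v f t)) \<le> C * sqrt r * L2_norm r f"
proof -
  obtain K where K: "K \<ge> 0" "\<And>(X :: complex^'n^'n) (b :: complex^'n). norm (X *v b) \<le> norm X * norm b * K"
    using mv.nonneg_bounded by blast
  obtain M where M0: "M \<ge> 0" and M: "\<And>x t. x \<in> {0..r} \<Longrightarrow> t \<in> {0..r} \<Longrightarrow> norm (k x t) \<le> M"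
    by (rule kernel_norm_bound[OF k, of 0 r]) blast
  have 1: "norm (integral {0..x} (\<lambda>t. k x t *v f t)) \<le> M * K * integral {0..x} (\<lambda>t. norm (f t))"
    if f: "set_integrable lborel {0..r} f" and x: "x \<in> {0..r}" for f x
  proof -
    have nf: "(\<lambda>t. norm (f t)) integrable_on {0..x}"
      by (rule set_integrable_HK(1)[OF set_integrable_subinterval[OF set_integrable_norm[OF f]]]) (use x in auto)
    have "norm (integral {0..x} (\<lambda>t. k x t *v f t)) \<le> integral {0..x} (\<lambda>t. M * K * norm (f t))"
    proof (rule HK_norm_bound[OF kernel_mult_integrable[OF k f x]])
      show "(\<lambda>t. M * K * norm (f t)) integrable_on {0..x}"
        using integrable_cmul[OF nf, of "M * K"] by simp
      fix t assume t: "t \<in> {0..x}"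
      have "norm (k x t *v f t) \<le> norm (k x t) * norm (f t) * K" by (rule K)
      also have "\<dots> \<le> M * norm (f t) * K" using M[of x t] x t K(1) by (intro mult_right_mono) auto
      finally show "norm (k x t *v f t) \<le> M * K * norm (f t)" by (simp add: mult_ac)
    qed
    then show ?thesis by simp
  qed
  show thesis
  proof
    show "M * K \<ge> 0" using M0 K by simp
    show "norm (integral {0..x} (\<lambda>t. k x t *v f t)) \<le> M * K * integral {0..x} (\<lambda>t. norm (f t))"
      if "set_integrable lborel {0..r} f" "x \<in> {0..r}" for f x by (rule 1[OF that])
    show "norm (integral {0..x} (\<lambda>t. k x t *v f t)) \<le> M * K * sqrt r * L2_norm r f"
      if f: "L2_on r f" and x: "x \<in> {0..r}" for f x
    proof -
      note nf = set_integrable_norm[OF L2_on_set_integrable[OF f]]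
      have "integral {0..x} (\<lambda>t. norm (f t)) \<le> integral {0..r} (\<lambda>t. norm (f t))"
        by (rule integral_subset_le) (use x in \<open>auto intro!: set_integrable_HK(1) nf set_integrable_subinterval[OF nf]\<close>)
      also have "\<dots> \<le> sqrt r * L2_norm r f" by (rule integral_norm_le_L2_norm[OF f r])
      finally have "M * K * integral {0..x} (\<lambda>t. norm (f t)) \<le> M * K * (sqrt r * L2_norm r f)"
        using M0 K by (intro mult_left_mono) auto
      with 1[OF L2_on_set_integrable[OF f] x] show ?thesis by (simp add: mult_ac)
    qed
  qed
qed

lemma volterra_bounded:
  fixes k :: "real \<Rightarrow> real \<Rightarrow> complex^'n^'n"
  assumes k: "continuous_on UNIV (\<lambda>(x, t). k x t)" and r: "r > 0"
  obtains C where "C \<ge> 0" "\<And>f. L2_on r f \<Longrightarrow> L2_on r (volterra k f)"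
    "\<And>f. L2_on r f \<Longrightarrow> L2_norm r (volterra k f) \<le> C * L2_norm r f"
proof -
  obtain C where C: "\<And>f x. L2_on r f \<Longrightarrow> x \<in> {0..r} \<Longrightarrow>
      norm (integral {0..x} (\<lambda>t. k x t *v f t)) \<le> C * sqrt r * L2_norm r f"
    by (rule volterra_integral_bound[OF k r]) blast
  have "L2_on r (volterra k f) \<and> L2_norm r (volterra k f) \<le> sqrt (2 * 1\<^sup>2 + 2 * (C * sqrt r)\<^sup>2 * r) * L2_norm r f"
    if f: "L2_on r f" for f
  proof -
    have "L2_on r (volterra k f)" unfolding volterra_def
      by (intro L2_on_add f continuous_on_L2_on
          continuous_on_volterra_integral[OF bilinear_mv k L2_on_set_integrable[OF f]])
    then have m: "set_borel_measurable lborel {0..r} (volterra k f)" by (simp add: L2_on_def)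
    have le: "norm (volterra k f x) \<le> 1 * norm (f x) + C * sqrt r * L2_norm r f" if "x \<in> {0..r}" for x
      using C[OF f that] norm_triangle_ineq[of "f x" "integral {0..x} (\<lambda>t. k x t *v f t)"] by (simp add: volterra_def)
    show ?thesis using L2_norm_bound[OF f m less_imp_le[OF r] le] by blast
  qed
  moreover have "0 \<le> sqrt (2 * 1\<^sup>2 + 2 * (C * sqrt r)\<^sup>2 * r)" using r by simp
  ultimately show thesis using that by blast
qed

text \<open>The difference \<open>d\<close> agrees almost everywhere with the continuous function
  \<open>e\<close>, which solves the homogeneous equation at every point; Gronwall with zero
  inhomogeneity gives \<open>e = 0\<close>.\<close>

lemma volterra_injective:
  fixes k :: "real \<Rightarrow> real \<Rightarrow> complex^'n^'n"
  assumes k: "continuous_on UNIV (\<lambda>(x, t). k x t)" and r: "r > 0"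
    and f: "L2_on r f" and g: "L2_on r g" and eq: "ae_eq_on r (volterra k f) (volterra k g)"
  shows "ae_eq_on r f g"
proof -
  obtain C where C: "C \<ge> 0" "\<And>f x. set_integrable lborel {0..r} f \<Longrightarrow> x \<in> {0..r} \<Longrightarrow>
      norm (integral {0..x} (\<lambda>t. k x t *v f t)) \<le> C * integral {0..x} (\<lambda>t. norm (f t))"
    by (rule volterra_integral_bound[OF k r]) blast
  define d where "d = (\<lambda>x. f x - g x)"
  define e where "e = (\<lambda>x. - integral {0..x} (\<lambda>t. k x t *v d t))"
  have d: "L2_on r d" unfolding d_def using r by (intro L2_on_diff f g) auto
  have de: "ae_eq_on r d e"
    using eq
  proof (rule ae_eq_on_map2)
    fix x assume x: "x \<in> {0..r}" and "volterra k f x = volterra k g x"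
    then have "volterra k d x = 0"
      unfolding d_def using volterra_diff[OF k L2_on_set_integrable[OF f] L2_on_set_integrable[OF g] x] by simp
    then show "d x = e x" by (simp add: volterra_def e_def eq_neg_iff_add_eq_0)
  qed
  have ec: "continuous_on {0..r} e" unfolding e_def
    by (intro continuous_on_minus continuous_on_volterra_integral[OF bilinear_mv k L2_on_set_integrable[OF d]])
  have ee: "e x = - integral {0..x} (\<lambda>t. k x t *v e t)" if "x \<in> {0..r}" for x
    unfolding e_def[THEN fun_cong, of x]
    using that integral_ae_cong[of r "\<lambda>t. k x t *v d t" "\<lambda>t. k x t *v e t" x] ae_eq_on_map2[OF de, of "\<lambda>t. k x t *v d t" "\<lambda>t. k x t *v e t"]
    by auto
  have "norm (e x) \<le> 0 * exp (C * x)" if "x \<in> {0..r}" for x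
  proof (rule gronwall[OF _ C(1) _ that])
    show "continuous_on {0..r} (\<lambda>x. norm (e x))" by (intro continuous_intros ec)
    show "norm (e x) \<le> 0 + C * integral {0..x} (\<lambda>t. norm (e t))" if "x \<in> {0..r}" for x
      using C(2)[OF borel_integrable_atLeastAtMost'[OF ec] that] ee[OF that] by simp
  qed
  then have e0: "e x = 0" if "x \<in> {0..r}" for x using that by simp
  show ?thesis using de by (rule ae_eq_on_map2) (simp add: d_def e0)
qed

text \<open>The solution is sought as \<open>f\<close> plus a continuous correction
  \<open>h\<close>: although \<open>f\<close> is only in L2, \<open>h\<close> solves a Volterra
  equation with continuous right-hand side. \<open>R\<close> arises by choice and is a right inverse
  at every point; uniqueness up to null sets is a matter of injectivity.\<close>

lemma volterra_inverse:
  fixes k :: "real \<Rightarrow> real \<Rightarrow> complex^'n^'n"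
  assumes k: "continuous_on UNIV (\<lambda>(x, t). k x t)" and r: "r > 0"
  obtains R C where "C \<ge> 0"
    "\<And>f. L2_on r f \<Longrightarrow> L2_on r (R f)" "\<And>f. L2_on r f \<Longrightarrow> L2_norm r (R f) \<le> C * L2_norm r f"
    "\<And>f x. L2_on r f \<Longrightarrow> x \<in> {0..r} \<Longrightarrow> volterra k (R f) x = f x"
proof -
  obtain C where C: "C \<ge> 0" "\<And>f x. set_integrable lborel {0..r} f \<Longrightarrow> x \<in> {0..r} \<Longrightarrow>
      norm (integral {0..x} (\<lambda>t. k x t *v f t)) \<le> C * integral {0..x} (\<lambda>t. norm (f t))"
    "\<And>f x. L2_on r f \<Longrightarrow> x \<in> {0..r} \<Longrightarrow>
      norm (integral {0..x} (\<lambda>t. k x t *v f t)) \<le> C * sqrt r * L2_norm r f"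
    by (rule volterra_integral_bound[OF k r]) blast
  \<comment> \<open>Gronwall's bound for the correction relative to \<open>L2_norm r f\<close>,
    since the inhomogeneity is at most \<open>C * sqrt r * L2_norm r f\<close>.\<close>
  define b where "b = C * sqrt r * exp (C * r)"
  have "\<exists>g. L2_on r g \<and> L2_norm r g \<le> sqrt (2 * 1\<^sup>2 + 2 * b\<^sup>2 * r) * L2_norm r f \<and>
      (\<forall>x\<in>{0..r}. volterra k g x = f x)" if f: "L2_on r f" for f
  proof -
    define s where "s = (\<lambda>x. - integral {0..x} (\<lambda>t. k x t *v f t))"
    have sc: "continuous_on {0..r} s" unfolding s_def
      by (intro continuous_on_minus continuous_on_volterra_integral[OF bilinear_mv k L2_on_set_integrable[OF f]])
    have mk: "continuous_on UNIV (\<lambda>(x, t). - k x t)"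
      using continuous_on_minus[OF k] by (simp add: case_prod_beta')
    obtain h where hc: "continuous_on UNIV h"
      and h: "\<And>x. x \<in> {0..r} \<Longrightarrow> h x = s x + integral {0..x} (\<lambda>t. (- k x t) *v h t)"
      using volterra_solution[OF bilinear_mv mk sc] r by auto
    have hc': "continuous_on {0..r} h" using hc by (rule continuous_on_subset) auto
    have h': "h x = s x - integral {0..x} (\<lambda>t. k x t *v h t)" if "x \<in> {0..r}" for x
      using h[OF that] by (simp add: mv.minus_left)
    have n0: "0 \<le> L2_norm r f" unfolding L2_norm_def real_sqrt_ge_0_iff set_lebesgue_integral_def
      by (rule Bochner_Integration.integral_nonneg) auto
    have hb: "norm (h x) \<le> b * L2_norm r f" if x: "x \<in> {0..r}" for x
    proof -
      have "norm (h x) \<le> (C * sqrt r * L2_norm r f) * exp (C * x)"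
      proof (rule gronwall[OF _ C(1) _ x])
        show "continuous_on {0..r} (\<lambda>x. norm (h x))" by (intro continuous_intros hc')
        show "norm (h x) \<le> C * sqrt r * L2_norm r f + C * integral {0..x} (\<lambda>t. norm (h t))" if "x \<in> {0..r}" for x
          unfolding h'[OF that]
          using norm_triangle_ineq4[of "s x" "integral {0..x} (\<lambda>t. k x t *v h t)"] C(3)[OF f that]
            C(2)[OF borel_integrable_atLeastAtMost'[OF hc'] that] by (simp add: s_def)
      qed
      also have "\<dots> \<le> (C * sqrt r * L2_norm r f) * exp (C * r)"
        using x C(1) r n0 by (intro mult_left_mono) (auto intro!: mult_left_mono)
      finally show ?thesis by (simp add: b_def mult_ac)
    qed
    define g where "g = (\<lambda>x. f x + h x)"
    have g: "L2_on r g" unfolding g_def by (intro L2_on_add f continuous_on_L2_on hc')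
    then have m: "set_borel_measurable lborel {0..r} g" by (simp add: L2_on_def)
    have le: "norm (g x) \<le> 1 * norm (f x) + b * L2_norm r f" if "x \<in> {0..r}" for x
      using hb[OF that] norm_triangle_ineq[of "f x" "h x"] by (simp add: g_def)
    have "volterra k g x = f x" if x: "x \<in> {0..r}" for x
      unfolding g_def volterra_add[OF k L2_on_set_integrable[OF f] borel_integrable_atLeastAtMost'[OF hc'] x]
      using h'[OF x] by (simp add: volterra_def s_def)
    with g L2_norm_bound(2)[OF f m less_imp_le[OF r] le] show ?thesis by blast
  qed
  then obtain R where "\<And>f. L2_on r f \<Longrightarrow> L2_on r (R f) \<and> L2_norm r (R f) \<le> sqrt (2 * 1\<^sup>2 + 2 * b\<^sup>2 * r) * L2_norm r f \<and>
      (\<forall>x\<in>{0..r}. volterra k (R f) x = f x)" by metis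
  moreover have "0 \<le> sqrt (2 * 1\<^sup>2 + 2 * b\<^sup>2 * r)" using r by simp
  ultimately show thesis using that[of "sqrt (2 * 1\<^sup>2 + 2 * b\<^sup>2 * r)" R] by blast
qed

section \<open>Factorization of K\<close>

text \<open>Pairing the hypothesis with \<open>v\<close> gives the squared length of
  \<open>cnj_transpose M *v v\<close>.\<close>

lemma cnj_transpose_kernel:
  fixes M :: "complex^'n^'m"
  assumes "(M ** cnj_transpose M) *v v = 0"
  shows "cnj_transpose M *v v = 0"
proof -
  define w where "w = cnj_transpose M *v v"
  have "M *v w = 0" using assms by (simp add: w_def matrix_vector_mul_assoc)
  then have "0 = (\<Sum>j\<in>UNIV. cnj (v $ j) * (M *v w) $ j)" by simp
  also have "\<dots> = (\<Sum>j\<in>UNIV. \<Sum>i\<in>UNIV. cnj (v $ j) * (M $ j $ i * w $ i))"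
    by (simp add: matrix_vector_mult_def sum_distrib_left)
  also have "\<dots> = (\<Sum>i\<in>UNIV. \<Sum>j\<in>UNIV. cnj (v $ j) * (M $ j $ i * w $ i))" by (rule sum.swap)
  also have "\<dots> = (\<Sum>i\<in>UNIV. cnj (w $ i) * w $ i)"
  proof (rule sum.cong[OF refl])
    fix i
    have "cnj (w $ i) = (\<Sum>j\<in>UNIV. cnj (v $ j) * M $ j $ i)"
      by (simp add: w_def cnj_transpose_def matrix_vector_mult_def mult.commute)
    then show "(\<Sum>j\<in>UNIV. cnj (v $ j) * (M $ j $ i * w $ i)) = cnj (w $ i) * w $ i"
      by (simp only: sum_distrib_right mult.assoc)
  qed
  also have "\<dots> = of_real (\<Sum>i\<in>UNIV. (norm (w $ i))\<^sup>2)"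
    unfolding of_real_sum complex_norm_square by (simp add: mult.commute)
  finally have "(\<Sum>i\<in>UNIV. (norm (w $ i))\<^sup>2) = 0" by (metis of_real_eq_0_iff)
  then have "\<forall>i\<in>UNIV. (norm (w $ i))\<^sup>2 = 0" by (subst (asm) sum_nonneg_eq_0_iff) auto
  then show ?thesis by (simp add: w_def[symmetric] vec_eq_iff)
qed

lemma mat_commute: "mat c ** A = A ** (mat c :: complex^'n^'n)"
  by (simp add: matrix_matrix_mult_def mat_def vec_eq_iff if_distrib if_distribR sum.delta mult.commute cong: if_cong)

lemma cnj_transpose_kernel_imp_invertible:
  fixes M :: "complex^'n^'n"
  assumes "\<And>v. cnj_transpose M *v v = 0 \<Longrightarrow> v = 0"
  shows "M ** matrix_inv M = mat 1" "matrix_inv M ** M = mat 1"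
proof -
  obtain B where "B ** cnj_transpose M = mat 1" using assms matrix_left_invertible_ker by blast
  then have "M ** cnj_transpose B = mat 1"
    by (metis cnj_transpose_cnj_transpose cnj_transpose_mult cnj_transpose_mat complex_cnj_one)
  then have "invertible M" unfolding invertible_def using matrix_left_right_inverse by blast
  then show "M ** matrix_inv M = mat 1" "matrix_inv M ** M = mat 1"
    unfolding invertible_def matrix_inv_def by (metis (mono_tags, lifting) someI_ex)+
qed

section \<open>Invertibility of the pair, the unitary gauge and the factorization\<close>

locale gauge_pair =
  fixes r :: real and \<phi> \<psi> \<phi>' \<psi>' :: "real \<Rightarrow> complex^'n^'n"
  assumes r: "r > 0"
    and \<phi>_der: "\<And>x. x \<in> {0..r} \<Longrightarrow> (\<phi> has_vector_derivative \<phi>' x) (at x within {0..r})"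
    and \<psi>_der: "\<And>x. x \<in> {0..r} \<Longrightarrow> (\<psi> has_vector_derivative \<psi>' x) (at x within {0..r})"
    and \<phi>'_W: "W12_class r \<phi>'" and \<psi>'_W: "W12_class r \<psi>'"
    and gram: "\<And>x. x \<in> {0..r} \<Longrightarrow> \<phi> x ** cnj_transpose (\<phi> x) = \<psi> x ** cnj_transpose (\<psi> x)"
    and wronskian: "\<And>x. x \<in> {0..r} \<Longrightarrow>
      \<phi>' x ** cnj_transpose (\<phi> x) - \<psi>' x ** cnj_transpose (\<psi> x) = mat (2 * \<i>)"
begin

lemma r0: "r \<ge> 0" using r by simp

definition "\<Phi> x = matrix_inv (\<phi> x)"
definition "\<Psi> x = matrix_inv (\<psi> x)"
definition "\<omega> x = cnj_transpose (\<Psi> x)"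

lemma common_kernel:
  assumes "x \<in> {0..r}" "cnj_transpose (\<phi> x) *v v = 0" "cnj_transpose (\<psi> x) *v v = 0"
  shows "v = 0"
proof -
  have "mat (2 * \<i>) *v v = 0"
    unfolding wronskian[OF assms(1), symmetric]
    using assms(2,3) by (simp add: mv.diff_left flip: matrix_vector_mul_assoc)
  then have "2 * \<i> * v $ i = 0" for i
    by (simp add: matrix_vector_mult_def mat_def vec_eq_iff if_distrib if_distribR sum.delta cong: if_cong)
  then show ?thesis by (simp add: vec_eq_iff)
qed

text \<open>By \<open>gram\<close> the adjoints of \<open>\<phi> x\<close> and
  \<open>\<psi> x\<close> have the same kernel, and the Wronskian identity allows no nonzero common
  kernel vector.\<close>

lemma inverses:
  assumes x: "x \<in> {0..r}"
  shows "\<phi> x ** \<Phi> x = mat 1" "\<Phi> x ** \<phi> x = mat 1" "\<psi> x ** \<Psi> x = mat 1" "\<Psi> x ** \<psi> x = mat 1"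
proof -
  have "v = 0" if "cnj_transpose (\<phi> x) *v v = 0" for v
  proof (rule common_kernel[OF x that])
    have "(\<psi> x ** cnj_transpose (\<psi> x)) *v v = 0"
      unfolding gram[OF x, symmetric] using that by (simp flip: matrix_vector_mul_assoc)
    then show "cnj_transpose (\<psi> x) *v v = 0" by (rule cnj_transpose_kernel)
  qed
  then show "\<phi> x ** \<Phi> x = mat 1" "\<Phi> x ** \<phi> x = mat 1"
    unfolding \<Phi>_def by (intro cnj_transpose_kernel_imp_invertible; blast)+
  have "v = 0" if "cnj_transpose (\<psi> x) *v v = 0" for v
  proof (rule common_kernel[OF x _ that])
    have "(\<phi> x ** cnj_transpose (\<phi> x)) *v v = 0"
      unfolding gram[OF x] using that by (simp flip: matrix_vector_mul_assoc)
    then show "cnj_transpose (\<phi> x) *v v = 0" by (rule cnj_transpose_kernel)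
  qed
  then show "\<psi> x ** \<Psi> x = mat 1" "\<Psi> x ** \<psi> x = mat 1"
    unfolding \<Psi>_def by (intro cnj_transpose_kernel_imp_invertible; blast)+
qed

lemma cancel:
  assumes x: "x \<in> {0..r}"
  shows "M ** \<phi> x ** \<Phi> x = M" "M ** \<Phi> x ** \<phi> x = M" "M ** \<psi> x ** \<Psi> x = M" "M ** \<Psi> x ** \<psi> x = M"
    "\<omega> x ** cnj_transpose (\<psi> x) = mat 1" "cnj_transpose (\<psi> x) ** \<omega> x = mat 1"
    "M ** \<omega> x ** cnj_transpose (\<psi> x) = M" "M ** cnj_transpose (\<psi> x) ** \<omega> x = M"
proof -
  show "M ** \<phi> x ** \<Phi> x = M" "M ** \<Phi> x ** \<phi> x = M" "M ** \<psi> x ** \<Psi> x = M" "M ** \<Psi> x ** \<psi> x = M"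
    using inverses[OF x] by (simp_all flip: matrix_mul_assoc)
  show 1: "\<omega> x ** cnj_transpose (\<psi> x) = mat 1" "cnj_transpose (\<psi> x) ** \<omega> x = mat 1"
    unfolding \<omega>_def cnj_transpose_mult[symmetric] inverses[OF x] cnj_transpose_mat by simp_all
  then show "M ** \<omega> x ** cnj_transpose (\<psi> x) = M" "M ** cnj_transpose (\<psi> x) ** \<omega> x = M"
    by (simp_all flip: matrix_mul_assoc)
qed

lemma \<phi>_U: "U_class r \<phi>" and \<psi>_U: "U_class r \<psi>"
  using \<phi>_der \<phi>'_W \<psi>_der \<psi>'_W unfolding U_class_iff by blast+

lemma \<Phi>_U: "U_class r \<Phi>" and \<Psi>_U: "U_class r \<Psi>"
  using U_class_matrix_inverse[OF \<phi>_U r0] U_class_matrix_inverse[OF \<psi>_U r0] inverses by blast+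

lemma \<omega>_U: "U_class r \<omega>"
  unfolding \<omega>_def by (rule U_class_bounded_linear[OF bounded_linear_cnj_transpose \<Psi>_U r0])

lemma \<Phi>_der:
  "x \<in> {0..r} \<Longrightarrow> (\<Phi> has_vector_derivative - (\<Phi> x ** \<phi>' x ** \<Phi> x)) (at x within {0..r})"
  by (rule has_vector_derivative_matrix_inverse[OF inverses(1) _ \<phi>_der])

lemma gram_inverse:
  assumes x: "x \<in> {0..r}"
  shows "cnj_transpose (\<Phi> x) ** \<Phi> x = \<omega> x ** \<Psi> x"
proof -
  have "cnj_transpose (\<phi> x) ** cnj_transpose (\<Phi> x) = mat 1"
    unfolding cnj_transpose_mult[symmetric] inverses[OF x] cnj_transpose_mat by simp
  then have "\<phi> x ** cnj_transpose (\<phi> x) ** (cnj_transpose (\<Phi> x) ** \<Phi> x) = mat 1"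
    by (metis inverses(1)[OF x] matrix_mul_assoc matrix_mul_lid)
  then have 1: "(cnj_transpose (\<Phi> x) ** \<Phi> x) ** (\<psi> x ** cnj_transpose (\<psi> x)) = mat 1"
    unfolding gram[OF x, symmetric] using matrix_left_right_inverse by blast
  have "\<psi> x ** cnj_transpose (\<psi> x) ** (\<omega> x ** \<Psi> x) = mat 1"
    by (simp add: matrix_mul_assoc cancel[OF x] inverses[OF x])
  with 1 show ?thesis by (metis matrix_mul_assoc matrix_mul_lid matrix_mul_rid)
qed

text \<open>The Wronskian identity divided by the common Gram matrix. The right-hand side is
  \<open>2 \<i>\<close> times a self-adjoint matrix, hence skew-adjoint, and this is what makes
  \<open>B\<close> skew-adjoint.\<close>

lemma log_derivative_difference:
  assumes x: "x \<in> {0..r}"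
  shows "\<phi>' x ** \<Phi> x - \<psi>' x ** \<Psi> x = mat (2 * \<i>) ** (\<omega> x ** \<Psi> x)"
proof -
  have "cnj_transpose (\<phi> x) ** cnj_transpose (\<Phi> x) = mat 1"
    unfolding cnj_transpose_mult[symmetric] inverses[OF x] cnj_transpose_mat by simp
  then have "\<phi>' x ** cnj_transpose (\<phi> x) ** (cnj_transpose (\<Phi> x) ** \<Phi> x) = \<phi>' x ** \<Phi> x"
    by (metis matrix_mul_assoc matrix_mul_lid)
  moreover have "\<psi>' x ** cnj_transpose (\<psi> x) ** (\<omega> x ** \<Psi> x) = \<psi>' x ** \<Psi> x"
    by (simp add: matrix_mul_assoc cancel[OF x])
  ultimately show ?thesis
    unfolding wronskian[OF x, symmetric] mm.diff_left gram_inverse[OF x] by simp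
qed

text \<open>As \<open>\<omega>\<close> inverts the adjoint of \<open>\<psi>\<close>, its logarithmic
  derivative is minus \<open>cnj_transpose (\<psi>' x ** \<Psi> x)\<close>. So \<open>B\<close> is
  the mean and \<open>D\<close> half the difference of the logarithmic derivatives of
  \<open>\<phi>\<close> and \<open>\<omega>\<close>; conjugated by \<open>u\<close>,
  \<open>D\<close> becomes \<open>- \<tau>\<close>.\<close>

definition "B x = (1/2) *\<^sub>R (\<phi>' x ** \<Phi> x - cnj_transpose (\<psi>' x ** \<Psi> x))"
definition "D x = (1/2) *\<^sub>R (\<phi>' x ** \<Phi> x + cnj_transpose (\<psi>' x ** \<Psi> x))"

lemma B_skew:
  assumes x: "x \<in> {0..r}"
  shows "cnj_transpose (B x) = - B x"
proof -
  have "cnj_transpose (\<omega> x ** \<Psi> x) = \<omega> x ** \<Psi> x" by (simp add: \<omega>_def cnj_transpose_mult)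
  then have "cnj_transpose (mat (2 * \<i>) ** (\<omega> x ** \<Psi> x)) = \<omega> x ** \<Psi> x ** mat (- (2 * \<i>))"
    by (simp add: cnj_transpose_mult cnj_transpose_mat)
  also have "\<dots> = mat (- (2 * \<i>)) ** (\<omega> x ** \<Psi> x)" by (rule mat_commute[symmetric])
  also have "\<dots> = - (mat (2 * \<i>) ** (\<omega> x ** \<Psi> x))"
  proof -
    have "mat (- (2 * \<i>)) = - (mat (2 * \<i>) :: complex^'n^'n)" by (simp add: mat_def vec_eq_iff)
    then show ?thesis by (simp add: mm.minus_left)
  qed
  finally have "cnj_transpose (\<phi>' x ** \<Phi> x) - cnj_transpose (\<psi>' x ** \<Psi> x) = - (\<phi>' x ** \<Phi> x - \<psi>' x ** \<Psi> x)"
    unfolding log_derivative_difference[OF x, symmetric] cnj_transpose_diff .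
  then have "cnj_transpose (\<phi>' x ** \<Phi> x) - \<psi>' x ** \<Psi> x = - (\<phi>' x ** \<Phi> x - cnj_transpose (\<psi>' x ** \<Psi> x))"
    by (simp add: algebra_simps)
  then show ?thesis
    unfolding B_def cnj_transpose_scaleR cnj_transpose_diff cnj_transpose_cnj_transpose by (simp only: scaleR_minus_right)
qed

lemma log_derivative_W12:
  "W12_class r (\<lambda>x. \<phi>' x ** \<Phi> x)" "W12_class r (\<lambda>x. cnj_transpose (\<psi>' x ** \<Psi> x))"
proof -
  obtain A where A: "\<And>x. x \<in> {0..r} \<Longrightarrow> (\<Phi> has_vector_derivative A x) (at x within {0..r})" "continuous_on {0..r} A"
    by (rule U_classE[OF \<Phi>_U]) auto
  obtain A' where A': "\<And>x. x \<in> {0..r} \<Longrightarrow> (\<Psi> has_vector_derivative A' x) (at x within {0..r})" "continuous_on {0..r} A'"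
    by (rule U_classE[OF \<Psi>_U]) auto
  show "W12_class r (\<lambda>x. \<phi>' x ** \<Phi> x)"
    by (rule W12_class_bilinear[OF bounded_bilinear.flip[OF bilinear_mm] r0 A \<phi>'_W])
  show "W12_class r (\<lambda>x. cnj_transpose (\<psi>' x ** \<Psi> x))"
    by (intro W12_class_bounded_linear[OF bounded_linear_cnj_transpose _ r0]
        W12_class_bilinear[OF bounded_bilinear.flip[OF bilinear_mm] r0 A' \<psi>'_W])
qed

lemma B_W12: "W12_class r B"
proof -
  have "W12_class r (\<lambda>x. (1/2) *\<^sub>R (\<phi>' x ** \<Phi> x + - cnj_transpose (\<psi>' x ** \<Psi> x)))"
    by (intro W12_class_bounded_linear[OF bounded_linear_scaleR_right _ r0] W12_class_add log_derivative_W12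
        W12_class_bounded_linear[OF bounded_linear_minus[OF bounded_linear_ident] _ r0])
  then show ?thesis unfolding B_def by simp
qed

lemma D_continuous: "continuous_on {0..r} D"
  unfolding D_def by (intro continuous_intros W12_class_continuous log_derivative_W12)

text \<open>A Volterra equation yields \<open>u\<close>. Membership in U comes from the differential
  equation itself, because \<open>B ** u\<close> is the product of a Sobolev function and a C1
  function.\<close>

lemma unitary_gauge:
  obtains u where "U_class r u" "u 0 = mat 1"
    "\<And>x. x \<in> {0..r} \<Longrightarrow> (u has_vector_derivative B x ** u x) (at x within {0..r})"
    "\<And>x. x \<in> {0..r} \<Longrightarrow> cnj_transpose (u x) ** u x = mat 1" "\<And>x. x \<in> {0..r} \<Longrightarrow> u x ** cnj_transpose (u x) = mat 1"
proof -
  have Bc: "continuous_on {0..r} B" by (rule W12_class_continuous[OF B_W12])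
  define Bt where "Bt = (\<lambda>s. B (max 0 (min r s)))"
  have Bt: "continuous_on UNIV Bt" unfolding Bt_def
    by (rule continuous_on_compose2[OF Bc]) (use r in \<open>auto intro!: continuous_intros\<close>)
  have Bt_eq: "Bt s = B s" if "s \<in> {0..r}" for s using that by (simp add: Bt_def)
  have "continuous_on UNIV (\<lambda>(x::real, t). Bt t)"
    unfolding case_prod_beta' by (rule continuous_on_compose2[OF Bt]) (auto intro!: continuous_intros)
  from volterra_solution[OF bilinear_mm this continuous_on_const r0, of "mat 1"]
  obtain u :: "real \<Rightarrow> complex^'n^'n" where uc: "continuous_on UNIV u"
    and u: "\<And>x. x \<in> {0..r} \<Longrightarrow> u x = mat 1 + integral {0..x} (\<lambda>t. Bt t ** u t)" by blast
  have uc': "continuous_on {0..r} u" using uc by (rule continuous_on_subset) auto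
  have u_der: "(u has_vector_derivative B x ** u x) (at x within {0..r})" if x: "x \<in> {0..r}" for x
  proof (rule has_vector_derivative_transform[OF x u])
    have c: "continuous_on {0..r} (\<lambda>t. Bt t ** u t)"
      by (intro mm.continuous_on uc' continuous_on_subset[OF Bt]) auto
    show "((\<lambda>x. mat 1 + integral {0..x} (\<lambda>t. Bt t ** u t)) has_vector_derivative B x ** u x) (at x within {0..r})"
      using has_vector_derivative_add[OF has_vector_derivative_const integral_has_vector_derivative[OF c x]] Bt_eq[OF x] by simp
  qed
  have u0: "u 0 = mat 1" using u[of 0] r by simp
  have "W12_class r (\<lambda>x. B x ** u x)"
    by (rule W12_class_bilinear[OF bounded_bilinear.flip[OF bilinear_mm] r0 u_der _ B_W12])
      (auto intro!: mm.continuous_on Bc uc')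
  then have uU: "U_class r u" unfolding U_class_iff using u_der by (intro exI[of _ "\<lambda>x. B x ** u x"]) auto
  have "((\<lambda>x. cnj_transpose (u x) ** u x) has_vector_derivative 0) (at x within {0..r})" if x: "x \<in> {0..r}" for x
  proof -
    have "((\<lambda>x. cnj_transpose (u x) ** u x) has_vector_derivative
        cnj_transpose (u x) ** (B x ** u x) + cnj_transpose (B x ** u x) ** u x) (at x within {0..r})"
      by (intro mm.has_vector_derivative u_der x bounded_linear.has_vector_derivative[OF bounded_linear_cnj_transpose])
    moreover have "cnj_transpose (u x) ** (B x ** u x) + cnj_transpose (B x ** u x) ** u x = 0"
      by (simp add: cnj_transpose_mult B_skew[OF x] mm.minus_left mm.minus_right matrix_mul_assoc)
    ultimately show ?thesis by simp
  qed
  then obtain c where c: "\<And>x. x \<in> {0..r} \<Longrightarrow> cnj_transpose (u x) ** u x = c"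
    using has_vector_derivative_zero_constant[of "{0..r}" "\<lambda>x. cnj_transpose (u x) ** u x"] by auto
  have "c = mat 1" using c[of 0] r u0 by (simp add: cnj_transpose_mat)
  with c have un: "cnj_transpose (u x) ** u x = mat 1" if "x \<in> {0..r}" for x using that by simp
  show thesis
    by (rule that[OF uU u0 u_der un]) (use un matrix_left_right_inverse in blast)+
qed

text \<open>Here the two-term kernel of \<open>K\<close> becomes a single iterated integral: up to
  the factor \<open>- 2 \<i>\<close>, the derivative of \<open>\<Phi> ** \<psi>\<close> is the
  middle factor \<open>\<Phi> ** \<omega>\<close> of the factorization.\<close>

lemma quotient_derivative:
  assumes x: "x \<in> {0..r}"
  shows "((\<lambda>x. \<Phi> x ** \<psi> x) has_vector_derivative - (mat (2 * \<i>) ** (\<Phi> x ** \<omega> x))) (at x within {0..r})"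
proof -
  have "((\<lambda>x. \<Phi> x ** \<psi> x) has_vector_derivative \<Phi> x ** \<psi>' x + - (\<Phi> x ** \<phi>' x ** \<Phi> x) ** \<psi> x) (at x within {0..r})"
    by (intro mm.has_vector_derivative \<Phi>_der \<psi>_der x)
  moreover have "\<Phi> x ** \<psi>' x + - (\<Phi> x ** \<phi>' x ** \<Phi> x) ** \<psi> x = - (\<Phi> x ** (\<phi>' x ** \<Phi> x - \<psi>' x ** \<Psi> x) ** \<psi> x)"
    by (simp add: mm.diff_left mm.diff_right mm.minus_left matrix_mul_assoc cancel[OF x])
  moreover have "\<Phi> x ** (mat (2 * \<i>) ** (\<omega> x ** \<Psi> x)) ** \<psi> x = mat (2 * \<i>) ** (\<Phi> x ** \<omega> x)"
    by (simp add: matrix_mul_assoc cancel[OF x] mat_commute[of _ "\<Phi> x"])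
  ultimately show ?thesis unfolding log_derivative_difference[OF x] by simp
qed

text \<open>In terms of \<open>\<phi>\<close> and \<open>\<psi>\<close> the left-hand side is twice
  \<open>K f\<close>. Integrating \<open>\<Phi> ** \<psi>\<close> by parts against the primitive
  \<open>w\<close> produces \<open>\<Phi> ** \<psi> ** cnj_transpose \<psi>\<close>, which equals
  the adjoint of \<open>\<phi>\<close> by \<open>gram\<close>, so the \<open>\<phi>\<close> integral
  cancels.\<close>

lemma factorization:
  assumes f: "set_integrable lborel {0..r} f" and x: "x \<in> {0..r}"
  shows "\<i> *s (\<phi> x *v integral {0..x} (\<lambda>t. cnj_transpose (\<phi> t) *v f t) -
      \<psi> x *v integral {0..x} (\<lambda>t. cnj_transpose (\<psi> t) *v f t)) =
    - (2 *\<^sub>R (\<phi> x *v integral {0..x} (\<lambda>s. (\<Phi> s ** \<omega> s) *v integral {0..s} (\<lambda>t. cnj_transpose (\<psi> t) *v f t))))"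
proof -
  have c: "continuous_on {0..r} \<phi>" "continuous_on {0..r} \<psi>" "continuous_on {0..r} \<Phi>" "continuous_on {0..r} \<omega>"
    using \<phi>_U \<psi>_U \<Phi>_U \<omega>_U by (auto elim: U_classE)
  have ct: "continuous_on {0..r} (\<lambda>t. cnj_transpose (\<phi> t))" "continuous_on {0..r} (\<lambda>t. cnj_transpose (\<psi> t))"
    by (intro bounded_linear.continuous_on[OF bounded_linear_cnj_transpose] c)+
  have psif: "set_integrable lborel {0..r} (\<lambda>t. cnj_transpose (\<psi> t) *v f t)"
    "set_integrable lborel {0..r} (\<lambda>t. cnj_transpose (\<phi> t) *v f t)"
    by (intro set_integrable_bilinear_continuous[OF bilinear_mv] ct f)+
  define w where "w = (\<lambda>s. integral {0..s} (\<lambda>t. cnj_transpose (\<psi> t) *v f t))"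
  have V'c: "continuous_on {0..r} (\<lambda>x. - (mat (2 * \<i>) ** (\<Phi> x ** \<omega> x)))"
    by (intro continuous_on_minus mm.continuous_on continuous_on_const c)
  have wc: "continuous_on {0..r} w" unfolding w_def
    by (rule indefinite_integral_continuous_1[OF set_integrable_HK(1)[OF psif(1)]])
  have sub: "{0..x} \<subseteq> {0..r}" using x by auto
  have "(\<Phi> x ** \<psi> x) *v w x = (\<Phi> 0 ** \<psi> 0) *v w 0 +
      integral {0..x} (\<lambda>s. (- (mat (2 * \<i>) ** (\<Phi> s ** \<omega> s))) *v w s + (\<Phi> s ** \<psi> s) *v (cnj_transpose (\<psi> s) *v f s))"
    by (rule bilinear_product_rule[OF bilinear_mv x quotient_derivative V'c psif(1)])
      (auto simp: w_def)
  also have "w 0 = 0" by (simp add: w_def)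
  also have "integral {0..x} (\<lambda>s. (- (mat (2 * \<i>) ** (\<Phi> s ** \<omega> s))) *v w s + (\<Phi> s ** \<psi> s) *v (cnj_transpose (\<psi> s) *v f s)) =
      integral {0..x} (\<lambda>s. (- mat (2 * \<i>)) *v ((\<Phi> s ** \<omega> s) *v w s) + cnj_transpose (\<phi> s) *v f s)"
  proof (rule integral_cong)
    fix s assume "s \<in> {0..x}"
    then have s: "s \<in> {0..r}" using x by auto
    have "\<Phi> s ** \<psi> s ** cnj_transpose (\<psi> s) = cnj_transpose (\<phi> s)"
      using gram[OF s] inverses(2)[OF s] by (metis matrix_mul_assoc matrix_mul_lid)
    then show "(- (mat (2 * \<i>) ** (\<Phi> s ** \<omega> s))) *v w s + (\<Phi> s ** \<psi> s) *v (cnj_transpose (\<psi> s) *v f s) =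
        (- mat (2 * \<i>)) *v ((\<Phi> s ** \<omega> s) *v w s) + cnj_transpose (\<phi> s) *v f s"
      by (simp add: matrix_vector_mul_assoc mm.minus_left)
  qed
  also have "\<dots> = (- mat (2 * \<i>)) *v integral {0..x} (\<lambda>s. (\<Phi> s ** \<omega> s) *v w s) + integral {0..x} (\<lambda>s. cnj_transpose (\<phi> s) *v f s)"
  proof -
    have i: "(\<lambda>s. (\<Phi> s ** \<omega> s) *v w s) integrable_on {0..x}"
      by (intro integrable_continuous_real continuous_on_subset[OF _ sub] mv.continuous_on mm.continuous_on c wc)
    have j: "(\<lambda>s. cnj_transpose (\<phi> s) *v f s) integrable_on {0..x}"
      by (rule set_integrable_HK(1)[OF set_integrable_subinterval[OF psif(2) sub]])
    show ?thesis
      using integral_linear[OF i mv.bounded_linear_right[of "- mat (2 * \<i>)"]]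
        integrable_linear[OF i mv.bounded_linear_right[of "- mat (2 * \<i>)"]] j
      by (simp add: o_def HK_add)
  qed
  finally have "(\<Phi> x ** \<psi> x) *v w x =
      (- mat (2 * \<i>)) *v integral {0..x} (\<lambda>s. (\<Phi> s ** \<omega> s) *v w s) + integral {0..x} (\<lambda>s. cnj_transpose (\<phi> s) *v f s)"
    by simp
  then have "\<phi> x *v ((\<Phi> x ** \<psi> x) *v w x) =
      \<phi> x *v ((- mat (2 * \<i>)) *v integral {0..x} (\<lambda>s. (\<Phi> s ** \<omega> s) *v w s)) + \<phi> x *v integral {0..x} (\<lambda>s. cnj_transpose (\<phi> s) *v f s)"
    by (simp add: mv.add_right)
  moreover have "\<phi> x *v ((\<Phi> x ** \<psi> x) *v w x) = \<psi> x *v w x"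
    by (simp add: matrix_vector_mul_assoc matrix_mul_assoc inverses[OF x])
  moreover have "\<phi> x *v ((- mat (2 * \<i>)) *v v) = - ((2 * \<i>) *s (\<phi> x *v v))" for v
  proof -
    have "(- mat (2 * \<i>)) *v v = - ((2 * \<i>) *s v)"
      by (simp add: mv.minus_left matrix_vector_mult_def mat_def vec_eq_iff if_distrib if_distribR sum.delta cong: if_cong)
    then show ?thesis by (simp add: mv.minus_right vector_scalar_commute)
  qed
  ultimately have eq: "\<phi> x *v integral {0..x} (\<lambda>t. cnj_transpose (\<phi> t) *v f t) - \<psi> x *v w x =
      (2 * \<i>) *s (\<phi> x *v integral {0..x} (\<lambda>s. (\<Phi> s ** \<omega> s) *v w s))"
    by simp
  have w: "integral {0..s} (\<lambda>t. cnj_transpose (\<psi> t) *v f t) = w s" for s by (simp add: w_def)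
  have "\<i> *s ((2 * \<i>) *s v) = - (2 *\<^sub>R v)" for v :: "complex^'n"
    by (simp add: vec_eq_iff scaleR_conv_of_real)
  then show ?thesis unfolding w eq .
qed

end

section \<open>The transmutation operator\<close>

text \<open>\<open>Q\<close> is the integrating factor of \<open>y' = v - \<sigma> y\<close>; as
  \<open>v\<close> is only integrable, the equation enters in integrated form.\<close>

lemma gauge_transform:
  fixes Q \<sigma> :: "real \<Rightarrow> complex^'n^'n" and y v :: "real \<Rightarrow> complex^'n"
  assumes Q: "\<And>x. x \<in> {0..r} \<Longrightarrow> (Q has_vector_derivative Q x ** \<sigma> x) (at x within {0..r})"
    and \<sigma>: "continuous_on {0..r} \<sigma>" and v: "set_integrable lborel {0..r} v" and yc: "continuous_on {0..r} y"
    and y: "\<And>x. x \<in> {0..r} \<Longrightarrow> y x = integral {0..x} (\<lambda>s. v s - \<sigma> s *v y s)" and x: "x \<in> {0..r}"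
  shows "Q x *v y x = integral {0..x} (\<lambda>s. Q s *v v s)"
proof -
  have Qc: "continuous_on {0..r} Q" by (rule has_vector_derivative_continuous_on[OF Q])
  have g: "set_integrable lborel {0..r} (\<lambda>s. v s - \<sigma> s *v y s)"
    by (intro set_integral_diff v borel_integrable_atLeastAtMost' mv.continuous_on \<sigma> yc)
  have y0: "y 0 = 0" using y[of 0] x by simp
  have "Q x *v y x = Q 0 *v y 0 + integral {0..x} (\<lambda>s. (Q s ** \<sigma> s) *v y s + Q s *v (v s - \<sigma> s *v y s))"
  proof (rule bilinear_product_rule[OF bilinear_mv x Q _ g])
    show "continuous_on {0..r} (\<lambda>s. Q s ** \<sigma> s)" by (intro mm.continuous_on Qc \<sigma>)
    show "y s = y 0 + integral {0..s} (\<lambda>s. v s - \<sigma> s *v y s)" if "s \<in> {0..r}" for s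
      using y[OF that] y0 by simp
  qed
  then show ?thesis by (simp add: y0 mv.diff_right matrix_vector_mul_assoc)
qed

text \<open>Collects what the construction delivers, so that the operator theory does not depend on
  how the kernels were found. At \<open>x = 0\<close> the condition \<open>kX_one\<close> identifies
  \<open>c\<close> as the value of \<open>(1/2) *\<^sub>R (\<phi> - \<psi>)\<close> there.\<close>

locale transmutation = gauge_pair r \<phi> \<psi> \<phi>' \<psi>'
  for r :: real and \<phi> \<psi> \<phi>' \<psi>' :: "real \<Rightarrow> complex^'n^'n" +
  fixes u \<tau> :: "real \<Rightarrow> complex^'n^'n" and kX kY :: "real \<Rightarrow> real \<Rightarrow> complex^'n^'n" and c C :: "complex^'n^'n"
  assumes u_U: "U_class r u" and u_0: "u 0 = mat 1"
    and u_der: "\<And>x. x \<in> {0..r} \<Longrightarrow> (u has_vector_derivative B x ** u x) (at x within {0..r})"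
    and u_unitary: "\<And>x. x \<in> {0..r} \<Longrightarrow> cnj_transpose (u x) ** u x = mat 1"
      "\<And>x. x \<in> {0..r} \<Longrightarrow> u x ** cnj_transpose (u x) = mat 1"
    and \<tau>_cont: "continuous_on UNIV \<tau>"
    and \<tau>: "\<And>x. x \<in> {0..r} \<Longrightarrow> \<tau> x = - (cnj_transpose (u x) ** D x ** u x)"
    and kX: "continuous_on UNIV (\<lambda>(x, t). kX x t)" and kY: "continuous_on UNIV (\<lambda>(x, t). kY x t)"
    and kX_eq: "\<And>t x. 0 \<le> t \<Longrightarrow> t \<le> x \<Longrightarrow> x \<le> r \<Longrightarrow>
      integral {t..x} (kX x) = integral {t..x} (\<lambda>s. kY s t - \<tau> s ** (mat 1 + integral {t..s} (kX s)))"
    and kY_eq: "\<And>t x. 0 \<le> t \<Longrightarrow> t \<le> x \<Longrightarrow> x \<le> r \<Longrightarrow>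
      integral {t..x} (kY x) = integral {t..x} (\<lambda>s. kX s t + \<tau> s ** (mat 1 + integral {t..s} (kY s)))"
    and kX_one: "\<And>x. x \<in> {0..r} \<Longrightarrow>
      u x ** (mat 1 + integral {0..x} (kX x)) ** c = (1/2) *\<^sub>R (\<phi> x - \<psi> x)"
    and c_inverse: "c ** C = mat 1" "C ** c = mat 1"

text \<open>At \<open>t = 0\<close> the kernel equation says that \<open>z = X 1\<close> solves
  \<open>z' = \<kappa> - \<tau> z\<close> with \<open>z 0 = 1\<close>. A prescribed C1 function
  \<open>\<gamma>\<close> with \<open>\<gamma> 0 = 1\<close> is therefore attained by the choice
  \<open>\<kappa> = \<gamma>' + \<tau> \<gamma>\<close>, and Gronwall provides the
  uniqueness.\<close>

lemma (in gauge_pair) transmutation_exists: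
  assumes c: "c = (1/2) *\<^sub>R (\<phi> 0 - \<psi> 0)" and C: "c ** C = mat 1" "C ** c = mat 1"
  shows "\<exists>u \<tau> kX kY. transmutation r \<phi> \<psi> \<phi>' \<psi>' u \<tau> kX kY c C"
proof -
  obtain u where u: "U_class r u" "u 0 = mat 1"
    "\<And>x. x \<in> {0..r} \<Longrightarrow> (u has_vector_derivative B x ** u x) (at x within {0..r})"
    "\<And>x. x \<in> {0..r} \<Longrightarrow> cnj_transpose (u x) ** u x = mat 1" "\<And>x. x \<in> {0..r} \<Longrightarrow> u x ** cnj_transpose (u x) = mat 1"
    by (rule unitary_gauge) blast
  have uc: "continuous_on {0..r} u" by (rule has_vector_derivative_continuous_on[OF u(3)])
  define cl where "cl = (\<lambda>s. max 0 (min r s))"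
  have cl: "continuous_on UNIV cl" "\<And>s. cl s \<in> {0..r}" "\<And>s. s \<in> {0..r} \<Longrightarrow> cl s = s"
    using r by (auto simp: cl_def intro!: continuous_intros)
  have clamp: "continuous_on UNIV (\<lambda>s. g (cl s))" if "continuous_on {0..r} g" for g :: "real \<Rightarrow> complex^'n^'n"
    by (rule continuous_on_compose2[OF that cl(1)]) (use cl(2) in auto)
  define \<tau>0 where "\<tau>0 = (\<lambda>x. - (cnj_transpose (u x) ** D x ** u x))"
  have \<tau>0c: "continuous_on {0..r} \<tau>0" unfolding \<tau>0_def
    by (intro continuous_on_minus mm.continuous_on bounded_linear.continuous_on[OF bounded_linear_cnj_transpose] uc D_continuous)
  \<comment> \<open>The value that \<open>kX_one\<close> demands of \<open>X 1\<close>, obtained by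
    solving for it with the inverses of \<open>u x\<close> and \<open>c\<close>.\<close>
  define \<gamma> where "\<gamma> = (\<lambda>x. cnj_transpose (u x) ** ((1/2) *\<^sub>R (\<phi> x - \<psi> x)) ** C)"
  have "U_class r \<gamma>" unfolding \<gamma>_def
    by (intro U_class_bilinear[OF bilinear_mm r0] U_class_const u(1)
        U_class_bounded_linear[OF bounded_linear_cnj_transpose _ r0]
        U_class_bounded_linear[OF bounded_linear_scaleR_right _ r0] U_class_diff \<phi>_U \<psi>_U r0)
  then obtain \<gamma>' where \<gamma>': "\<And>x. x \<in> {0..r} \<Longrightarrow> (\<gamma> has_vector_derivative \<gamma>' x) (at x within {0..r})"
    "continuous_on {0..r} \<gamma>'" "continuous_on {0..r} \<gamma>" by (rule U_classE) blast
  define \<kappa>0 where "\<kappa>0 = (\<lambda>x. \<gamma>' x + \<tau>0 x ** \<gamma> x)"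
  have \<kappa>0c: "continuous_on {0..r} \<kappa>0" unfolding \<kappa>0_def by (intro continuous_on_add mm.continuous_on \<tau>0c \<gamma>')
  obtain kX kY :: "real \<Rightarrow> real \<Rightarrow> complex^'n^'n"
  where k: "continuous_on UNIV (\<lambda>(x, t). kX x t)" "continuous_on UNIV (\<lambda>(x, t). kY x t)"
    "\<And>x. kY x 0 = \<kappa>0 (cl x)"
    "\<And>t x. 0 \<le> t \<Longrightarrow> t \<le> x \<Longrightarrow> x \<le> r \<Longrightarrow>
      integral {t..x} (kX x) = integral {t..x} (\<lambda>s. kY s t - \<tau>0 (cl s) ** (mat 1 + integral {t..s} (kX s)))"
    "\<And>t x. 0 \<le> t \<Longrightarrow> t \<le> x \<Longrightarrow> x \<le> r \<Longrightarrow>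
      integral {t..x} (kY x) = integral {t..x} (\<lambda>s. kX s t + \<tau>0 (cl s) ** (mat 1 + integral {t..s} (kY s)))"
    by (rule transmutation_kernels[OF clamp[OF \<tau>0c] clamp[OF \<kappa>0c] r0]) blast
  define z where "z = (\<lambda>x. mat 1 + integral {0..x} (kX x))"
  have zc: "continuous_on {0..r} z" unfolding z_def
    by (intro continuous_on_add continuous_on_const continuous_on_parametric_integral[OF k(1)]) (auto intro!: continuous_intros)
  have dc: "continuous_on {0..r} (\<lambda>x. z x - \<gamma> x)" by (intro continuous_on_diff zc \<gamma>')
  have d_eq: "z x - \<gamma> x = - integral {0..x} (\<lambda>s. \<tau>0 s ** (z s - \<gamma> s))" if x: "x \<in> {0..r}" for x
  proof -
    have sub: "{0..x} \<subseteq> {0..r}" using x by auto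
    have "\<gamma> 0 = mat 1" using u(2) C by (simp add: \<gamma>_def c cnj_transpose_mat)
    moreover have "(\<gamma>' has_integral \<gamma> x - \<gamma> 0) {0..x}"
      by (rule fundamental_theorem_of_calculus)
        (use x in \<open>auto intro!: has_vector_derivative_within_subset[OF \<gamma>'(1)]\<close>)
    ultimately have 1: "\<gamma> x = mat 1 + integral {0..x} \<gamma>'" by (simp add: integral_unique)
    have "z x = mat 1 + integral {0..x} (\<lambda>s. \<gamma>' s - \<tau>0 s ** (z s - \<gamma> s))"
      unfolding z_def[THEN fun_cong, of x] using x k(4)[of 0 x]
      by (auto simp: k(3) cl(3) \<kappa>0_def z_def mm.diff_right algebra_simps intro!: integral_cong)
    also have "integral {0..x} (\<lambda>s. \<gamma>' s - \<tau>0 s ** (z s - \<gamma> s)) = integral {0..x} \<gamma>' - integral {0..x} (\<lambda>s. \<tau>0 s ** (z s - \<gamma> s))"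
      by (intro HK_diff integrable_continuous_real continuous_on_subset[OF _ sub]
          mm.continuous_on \<gamma>' \<tau>0c dc)
    finally show ?thesis using 1 by simp
  qed
  obtain K where K: "K \<ge> 0" "\<And>(X :: complex^'n^'n) (Y :: complex^'n^'n). norm (X ** Y) \<le> norm X * norm Y * K"
    using mm.nonneg_bounded by blast
  obtain M where M0: "M \<ge> 0" and M: "\<And>x. x \<in> {0..r} \<Longrightarrow> norm (\<tau>0 x) \<le> M"
    by (rule continuous_image_norm_bound[OF \<tau>0c]) auto
  have "norm (z x - \<gamma> x) \<le> 0 * exp (M * K * x)" if "x \<in> {0..r}" for x
  proof (rule gronwall[OF _ _ _ that])
    show "continuous_on {0..r} (\<lambda>x. norm (z x - \<gamma> x))" by (intro continuous_on_norm dc)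
    show "M * K \<ge> 0" using M0 K by simp
    fix x assume x: "x \<in> {0..r}"
    then have sub: "{0..x} \<subseteq> {0..r}" by auto
    have "norm (integral {0..x} (\<lambda>s. \<tau>0 s ** (z s - \<gamma> s))) \<le> integral {0..x} (\<lambda>s. M * K * norm (z s - \<gamma> s))"
    proof (rule HK_norm_bound)
      fix s assume "s \<in> {0..x}"
      then have s: "s \<in> {0..r}" using sub by auto
      have "norm (\<tau>0 s ** (z s - \<gamma> s)) \<le> norm (\<tau>0 s) * norm (z s - \<gamma> s) * K" by (rule K)
      also have "\<dots> \<le> M * norm (z s - \<gamma> s) * K" using M[OF s] K(1) by (intro mult_right_mono) auto
      finally show "norm (\<tau>0 s ** (z s - \<gamma> s)) \<le> M * K * norm (z s - \<gamma> s)" by (simp add: mult_ac)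
    qed (intro integrable_continuous_real continuous_on_subset[OF _ sub] mm.continuous_on \<tau>0c dc
        continuous_on_mult continuous_on_const continuous_on_norm)+
    then show "norm (z x - \<gamma> x) \<le> 0 + M * K * integral {0..x} (\<lambda>s. norm (z s - \<gamma> s))"
      unfolding d_eq[OF x] by simp
  qed
  then have z\<gamma>: "z x = \<gamma> x" if "x \<in> {0..r}" for x using that by simp
  have "transmutation r \<phi> \<psi> \<phi>' \<psi>' u (\<lambda>s. \<tau>0 (cl s)) kX kY c C"
  proof
    show "u x ** (mat 1 + integral {0..x} (kX x)) ** c = (1/2) *\<^sub>R (\<phi> x - \<psi> x)" if x: "x \<in> {0..r}" for x
    proof -
      have "u x ** \<gamma> x ** c = u x ** cnj_transpose (u x) ** ((1/2) *\<^sub>R (\<phi> x - \<psi> x)) ** (C ** c)"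
        by (simp add: \<gamma>_def matrix_mul_assoc)
      then show ?thesis using z\<gamma>[OF x] u(5)[OF x] C by (simp add: z_def)
    qed
  qed (use u k C clamp[OF \<tau>0c] in \<open>auto simp: cl \<tau>0_def\<close>)
  then show ?thesis by blast
qed

context transmutation
begin

lemma c_cancel: "c *v (C *v v) = v" "C *v (c *v v) = v" "M ** c ** C = M"
  by (simp_all add: matrix_vector_mul_assoc c_inverse flip: matrix_mul_assoc)

lemma continuous: "continuous_on {0..r} \<phi>" "continuous_on {0..r} \<Phi>" "continuous_on {0..r} \<omega>" "continuous_on {0..r} u"
    "continuous_on {0..r} (\<lambda>t. cnj_transpose (\<psi> t))" "continuous_on {0..r} (\<lambda>t. cnj_transpose (u t))" "continuous_on {0..r} \<tau>"
  using \<phi>_U \<psi>_U \<Phi>_U \<omega>_U u_U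
  by (auto elim!: U_classE intro!: bounded_linear.continuous_on[OF bounded_linear_cnj_transpose] continuous_on_subset[OF \<tau>_cont])

lemma u_\<tau>: "x \<in> {0..r} \<Longrightarrow> u x ** \<tau> x = - (D x ** u x)"
  by (simp add: \<tau> mm.minus_right matrix_mul_assoc u_unitary)

lemma volterra_set_integrable:
  fixes k :: "real \<Rightarrow> real \<Rightarrow> complex^'n^'n"
  assumes "continuous_on UNIV (\<lambda>(x, t). k x t)" "set_integrable lborel {0..r} g"
  shows "set_integrable lborel {0..r} (volterra k g)"
  unfolding volterra_def
  by (intro set_integral_add assms(2) borel_integrable_atLeastAtMost'
      continuous_on_volterra_integral[OF bilinear_mv assms])

lemma volterra_primitive_continuous:
  fixes k :: "real \<Rightarrow> real \<Rightarrow> complex^'n^'n"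
  assumes "continuous_on UNIV (\<lambda>(x, t). k x t)" "set_integrable lborel {0..r} g"
  shows "continuous_on {0..r} (volterra k (\<lambda>s. integral {0..s} g))"
proof -
  have c: "continuous_on {0..r} (\<lambda>s. integral {0..s} g)"
    by (rule indefinite_integral_continuous_1[OF set_integrable_HK(1)[OF assms(2)]])
  show ?thesis unfolding volterra_def
    by (intro continuous_on_add c
      continuous_on_volterra_integral[OF bilinear_mv assms(1) borel_integrable_atLeastAtMost'[OF c]])
qed

text \<open>The integrating factor is \<open>\<Phi> ** u\<close>: since
  \<open>B = \<phi>' \<Phi> - D\<close>, its derivative is
  \<open>\<Phi> ** u ** \<tau>\<close>.\<close>

lemma X_primitive:
  assumes g: "set_integrable lborel {0..r} g" and x: "x \<in> {0..r}"
  shows "u x *v volterra kX (\<lambda>s. integral {0..s} g) x =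
    \<phi> x *v integral {0..x} (\<lambda>s. (\<Phi> s ** u s) *v volterra kY g s)"
proof -
  have "(\<Phi> x ** u x) *v volterra kX (\<lambda>s. integral {0..s} g) x = integral {0..x} (\<lambda>s. (\<Phi> s ** u s) *v volterra kY g s)"
  proof (rule gauge_transform[OF _ continuous(7) volterra_set_integrable[OF kY g] volterra_primitive_continuous[OF kX g] _ x])
    show "((\<lambda>x. \<Phi> x ** u x) has_vector_derivative \<Phi> s ** u s ** \<tau> s) (at s within {0..r})" if s: "s \<in> {0..r}" for s
    proof -
      have "((\<lambda>x. \<Phi> x ** u x) has_vector_derivative \<Phi> s ** (B s ** u s) + - (\<Phi> s ** \<phi>' s ** \<Phi> s) ** u s) (at s within {0..r})"
        by (intro mm.has_vector_derivative \<Phi>_der u_der s)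
      moreover have "B s = \<phi>' s ** \<Phi> s - D s" by (simp add: B_def D_def algebra_simps flip: scaleR_add_left)
      then have "\<Phi> s ** (B s ** u s) + - (\<Phi> s ** \<phi>' s ** \<Phi> s) ** u s = \<Phi> s ** (u s ** \<tau> s)"
        by (simp add: u_\<tau>[OF s] mm.diff_left mm.diff_right mm.minus_left mm.minus_right matrix_mul_assoc)
      ultimately show ?thesis by (simp add: matrix_mul_assoc)
    qed
    show "volterra kX (\<lambda>s. integral {0..s} g) x = integral {0..x} (\<lambda>s. volterra kY g s - \<tau> s *v volterra kX (\<lambda>s. integral {0..s} g) s)"
      if "x \<in> {0..r}" for x by (rule volterra_intertwining[OF kX kY \<tau>_cont g that kX_eq])
  qed
  then have "\<phi> x *v ((\<Phi> x ** u x) *v volterra kX (\<lambda>s. integral {0..s} g) x) =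
      \<phi> x *v integral {0..x} (\<lambda>s. (\<Phi> s ** u s) *v volterra kY g s)" by simp
  then show ?thesis by (simp add: matrix_vector_mul_assoc matrix_mul_assoc inverses[OF x])
qed

text \<open>The integrating factor is now \<open>\<omega>\<^sup>-\<^sup>1 u\<close>, that is
  \<open>cnj_transpose \<psi> ** u\<close>. The other expression of \<open>B\<close> through
  \<open>D\<close> reverses the sign of \<open>\<tau>\<close>, in agreement with the second kernel
  equation.\<close>

lemma Y_primitive:
  assumes g: "set_integrable lborel {0..r} g" and x: "x \<in> {0..r}"
  shows "u x *v volterra kY (\<lambda>s. integral {0..s} g) x =
    \<omega> x *v integral {0..x} (\<lambda>s. (cnj_transpose (\<psi> s) ** u s) *v volterra kX g s)"
proof -
  have "(cnj_transpose (\<psi> x) ** u x) *v volterra kY (\<lambda>s. integral {0..s} g) x =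
      integral {0..x} (\<lambda>s. (cnj_transpose (\<psi> s) ** u s) *v volterra kX g s)"
  proof (rule gauge_transform[where \<sigma>="\<lambda>s. - \<tau> s", OF _ _ volterra_set_integrable[OF kX g] volterra_primitive_continuous[OF kY g] _ x])
    show "continuous_on {0..r} (\<lambda>s. - \<tau> s)" by (intro continuous_on_minus continuous)
    show "((\<lambda>x. cnj_transpose (\<psi> x) ** u x) has_vector_derivative cnj_transpose (\<psi> s) ** u s ** - \<tau> s) (at s within {0..r})"
      if s: "s \<in> {0..r}" for s
    proof -
      have "((\<lambda>x. cnj_transpose (\<psi> x) ** u x) has_vector_derivative
          cnj_transpose (\<psi> s) ** (B s ** u s) + cnj_transpose (\<psi>' s) ** u s) (at s within {0..r})"
        by (intro mm.has_vector_derivative u_der s bounded_linear.has_vector_derivative[OF bounded_linear_cnj_transpose] \<psi>_der)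
      moreover have "B s = D s - cnj_transpose (\<psi>' s ** \<Psi> s)" by (simp add: B_def D_def algebra_simps flip: scaleR_add_left)
      then have "cnj_transpose (\<psi> s) ** B s = cnj_transpose (\<psi> s) ** D s - cnj_transpose (\<psi>' s)"
        by (simp add: mm.diff_right flip: cnj_transpose_mult) (simp add: cancel[OF s])
      then have "cnj_transpose (\<psi> s) ** (B s ** u s) + cnj_transpose (\<psi>' s) ** u s = cnj_transpose (\<psi> s) ** (- (u s ** \<tau> s))"
        by (simp add: u_\<tau>[OF s] mm.diff_left matrix_mul_assoc)
      ultimately show ?thesis by (simp add: matrix_mul_assoc mm.minus_right)
    qed
    show "volterra kY (\<lambda>s. integral {0..s} g) x = integral {0..x} (\<lambda>s. volterra kX g s - (- \<tau> s) *v volterra kY (\<lambda>s. integral {0..s} g) s)"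
      if "x \<in> {0..r}" for x
    proof (rule volterra_intertwining[OF kY kX _ g that])
      show "continuous_on UNIV (\<lambda>s. - \<tau> s)" by (intro continuous_on_minus \<tau>_cont)
    qed (simp add: kY_eq mm.minus_left)
  qed
  then have "\<omega> x *v ((cnj_transpose (\<psi> x) ** u x) *v volterra kY (\<lambda>s. integral {0..s} g) x) =
      \<omega> x *v integral {0..x} (\<lambda>s. (cnj_transpose (\<psi> s) ** u s) *v volterra kX g s)" by simp
  then show ?thesis by (simp add: matrix_vector_mul_assoc matrix_mul_assoc cancel[OF x])
qed

definition E :: "(real \<Rightarrow> complex^'n) \<Rightarrow> real \<Rightarrow> complex^'n" where
  "E f x = u x *v volterra kX (\<lambda>t. c *v f t) x"

lemma c_set_integrable: "set_integrable lborel {0..r} f \<Longrightarrow> set_integrable lborel {0..r} (\<lambda>t. M *v (f t :: complex^'n) :: complex^'n)"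
  by (rule set_integrable_bilinear_continuous[OF bilinear_mv continuous_on_const])

text \<open>Up to sign on both sides this is \<open>E A g = K E g\<close>. The outer integration
  passes through \<open>X\<close> and leaves \<open>Y\<close>, the inner one passes through
  \<open>Y\<close> and leaves \<open>X\<close> again.\<close>

lemma E_double_primitive:
  assumes g: "set_integrable lborel {0..r} g" and x: "x \<in> {0..r}"
  shows "E (\<lambda>x. integral {0..x} (\<lambda>s. integral {0..s} g)) x =
    \<phi> x *v integral {0..x} (\<lambda>s. (\<Phi> s ** \<omega> s) *v integral {0..s} (\<lambda>t. cnj_transpose (\<psi> t) *v E g t))"
proof -
  define g1 where "g1 = (\<lambda>s. integral {0..s} (\<lambda>t. c *v g t))"
  have cg: "set_integrable lborel {0..r} (\<lambda>t. c *v g t)" by (rule c_set_integrable[OF g])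
  have gi: "g integrable_on {0..s}" if "s \<in> {0..r}" for s
    by (rule set_integrable_HK(1)[OF set_integrable_subinterval[OF g]]) (use that in auto)
  have g1: "c *v integral {0..s} g = g1 s" if "s \<in> {0..r}" for s
    using integral_linear[OF gi[OF that] mv.bounded_linear_right[of c]] by (simp add: o_def g1_def)
  have gic: "continuous_on {0..r} (\<lambda>s. integral {0..s} g)"
    by (rule indefinite_integral_continuous_1[OF set_integrable_HK(1)[OF g]])
  have g1c: "continuous_on {0..r} g1" unfolding g1_def
    by (rule indefinite_integral_continuous_1[OF set_integrable_HK(1)[OF cg]])
  have g2: "c *v integral {0..y} (\<lambda>s. integral {0..s} g) = integral {0..y} g1" if "y \<in> {0..r}" for y
  proof -
    have "(\<lambda>s. integral {0..s} g) integrable_on {0..y}"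
      by (rule integrable_continuous_real[OF continuous_on_subset[OF gic]]) (use that in auto)
    from integral_linear[OF this mv.bounded_linear_right[of c]]
    have "c *v integral {0..y} (\<lambda>s. integral {0..s} g) = integral {0..y} (\<lambda>s. c *v integral {0..s} g)" by (simp add: o_def)
    also have "\<dots> = integral {0..y} g1" by (rule integral_cong) (use that in \<open>auto intro!: g1\<close>)
    finally show ?thesis .
  qed
  have "volterra kX (\<lambda>t. c *v integral {0..t} (\<lambda>s. integral {0..s} g)) x = volterra kX (\<lambda>t. integral {0..t} g1) x"
    by (rule volterra_cong) (use x in \<open>auto intro!: g2\<close>)
  then have "E (\<lambda>x. integral {0..x} (\<lambda>s. integral {0..s} g)) x = \<phi> x *v integral {0..x} (\<lambda>s. (\<Phi> s ** u s) *v volterra kY g1 s)"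
    unfolding E_def using X_primitive[OF borel_integrable_atLeastAtMost'[OF g1c] x] by simp
  also have "integral {0..x} (\<lambda>s. (\<Phi> s ** u s) *v volterra kY g1 s) =
     integral {0..x} (\<lambda>s. (\<Phi> s ** \<omega> s) *v integral {0..s} (\<lambda>t. cnj_transpose (\<psi> t) *v E g t))"
  proof (rule integral_cong)
    fix s assume "s \<in> {0..x}"
    then have s: "s \<in> {0..r}" using x by auto
    have "(\<Phi> s ** u s) *v volterra kY g1 s = \<Phi> s *v (u s *v volterra kY g1 s)" by (simp add: matrix_vector_mul_assoc)
    also have "\<dots> = \<Phi> s *v (\<omega> s *v integral {0..s} (\<lambda>t. (cnj_transpose (\<psi> t) ** u t) *v volterra kX (\<lambda>t. c *v g t) t))"
      unfolding g1_def using Y_primitive[OF cg s] by simp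
    finally show "(\<Phi> s ** u s) *v volterra kY g1 s = (\<Phi> s ** \<omega> s) *v integral {0..s} (\<lambda>t. cnj_transpose (\<psi> t) *v E g t)"
      by (simp add: E_def matrix_vector_mul_assoc)
  qed
  finally show ?thesis .
qed

text \<open>The place where the normalization \<open>kX_one\<close> takes effect: columns of the
  identity go to columns of the second block, which is (ii).\<close>

lemma E_const:
  assumes x: "x \<in> {0..r}"
  shows "E (\<lambda>t. v) x = ((1/2) *\<^sub>R (\<phi> x - \<psi> x)) *v v"
  unfolding E_def volterra_const[OF kX] kX_one[OF x, symmetric] by (simp add: matrix_vector_mul_assoc matrix_mul_assoc)

lemma E_linear:
  assumes x: "x \<in> {0..r}"
  shows "E (\<lambda>t. t *\<^sub>R v) x = \<phi> x *v integral {0..x} (\<lambda>s. (\<Phi> s ** u s ** (mat 1 + integral {0..s} (kY s)) ** c) *v v)"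
proof -
  have "E (\<lambda>t. t *\<^sub>R v) x = u x *v volterra kX (\<lambda>s. integral {0..s} (\<lambda>t. c *v v)) x"
    unfolding E_def using x by (intro arg_cong[of _ _ "(*v) (u x)"] volterra_cong) (auto simp: mv.scaleR_right)
  also have "\<dots> = \<phi> x *v integral {0..x} (\<lambda>s. (\<Phi> s ** u s) *v volterra kY (\<lambda>t. c *v v) s)"
    by (rule X_primitive[OF borel_integrable_atLeastAtMost'[OF continuous_on_const] x])
  finally show ?thesis by (simp add: volterra_const[OF kY] matrix_vector_mul_assoc matrix_mul_assoc)
qed

lemma E_add:
  assumes "set_integrable lborel {0..r} f" "set_integrable lborel {0..r} g" "x \<in> {0..r}"
  shows "E (\<lambda>t. f t + g t) x = E f x + E g x"
  unfolding E_def mv.add_right volterra_add[OF kX c_set_integrable[OF assms(1)] c_set_integrable[OF assms(2)] assms(3)] ..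

text \<open>With \<open>kY\<close> merely continuous, differentiability is invisible in the formula;
  the kernel equation at \<open>t = 0\<close> exhibits the function as a primitive of a continuous
  one.\<close>

lemma Y_one_C1:
  obtains y' where
    "\<And>x. x \<in> {0..r} \<Longrightarrow> ((\<lambda>x. mat 1 + integral {0..x} (kY x)) has_vector_derivative y' x) (at x within {0..r})"
    "continuous_on {0..r} y'"
proof -
  define y where "y = (\<lambda>x. mat 1 + integral {0..x} (kY x))"
  have yc: "continuous_on {0..r} y" unfolding y_def
    by (intro continuous_on_add continuous_on_const continuous_on_parametric_integral[OF kY]) (auto intro!: continuous_intros)
  define y' where "y' = (\<lambda>s. kX s 0 + \<tau> s ** y s)"
  have y'c: "continuous_on {0..r} y'" unfolding y'_def
    by (intro continuous_on_add mm.continuous_on yc continuous kernel_section_continuous(2)[OF kX])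
  have y: "y x = mat 1 + integral {0..x} y'" if "x \<in> {0..r}" for x
    using kY_eq[of 0 x] that by (simp add: y_def y'_def)
  have "(y has_vector_derivative y' x) (at x within {0..r})" if x: "x \<in> {0..r}" for x
    by (rule has_vector_derivative_transform[OF x y])
      (use has_vector_derivative_add[OF has_vector_derivative_const integral_has_vector_derivative[OF y'c x]] in simp)+
  then show thesis using that[of y'] y'c by (simp add: y_def)
qed

end

section \<open>Boundedness, invertibility and smoothness\<close>

lemma L2_norm_cong:
  assumes "\<And>x. x \<in> {0..r} \<Longrightarrow> f x = g x"
  shows "L2_norm r f = L2_norm r g"
proof -
  have "(\<lambda>x. indicator {0..r} x *\<^sub>R (norm (f x))\<^sup>2) = (\<lambda>x. indicator {0..r} x *\<^sub>R (norm (g x))\<^sup>2)"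
    using assms by (auto simp: indicator_def fun_eq_iff)
  then show ?thesis unfolding L2_norm_def set_lebesgue_integral_def by simp
qed

lemma L2_bounded_multiplication:
  fixes M :: "real \<Rightarrow> complex^'n^'m"
  assumes M: "continuous_on {0..r} M" and r: "r > 0"
  obtains C where "C \<ge> 0" "\<And>f. L2_on r f \<Longrightarrow> L2_on r (\<lambda>x. M x *v f x)"
    "\<And>f. L2_on r f \<Longrightarrow> L2_norm r (\<lambda>x. M x *v f x) \<le> C * L2_norm r f"
proof -
  obtain K where K: "K \<ge> 0" "\<And>(X :: complex^'n^'m) (b :: complex^'n). norm (X *v b) \<le> norm X * norm b * K"
    using mv.nonneg_bounded by blast
  obtain b where b0: "b \<ge> 0" and b: "\<And>t. t \<in> {0..r} \<Longrightarrow> norm (M t) \<le> b"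
    by (rule continuous_image_norm_bound[OF M]) auto
  have L2: "L2_on r (\<lambda>x. M x *v f x)" if "L2_on r f" for f
    using that r by (intro L2_on_bilinear[OF bilinear_mv M]) auto
  have "L2_norm r (\<lambda>x. M x *v f x) \<le> sqrt (2 * (b * K)\<^sup>2 + 2 * 0\<^sup>2 * r) * L2_norm r f" if f: "L2_on r f" for f
  proof (rule L2_norm_bound(2)[OF f])
    show "set_borel_measurable lborel {0..r} (\<lambda>x. M x *v f x)" using L2[OF f] by (simp add: L2_on_def)
    fix x assume x: "x \<in> {0..r}"
    have "norm (M x *v f x) \<le> norm (M x) * norm (f x) * K" by (rule K)
    also have "\<dots> \<le> b * norm (f x) * K" using b[OF x] K(1) by (intro mult_right_mono) auto
    finally show "norm (M x *v f x) \<le> b * K * norm (f x) + 0 * L2_norm r f" by (simp add: mult_ac)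
  qed (use r in simp)
  moreover have "0 \<le> sqrt (2 * (b * K)\<^sup>2 + 2 * 0\<^sup>2 * r)" by simp
  ultimately show thesis using that L2 by blast
qed

context transmutation
begin

lemma E_bounded:
  obtains C' where "\<And>f. L2_on r f \<Longrightarrow> L2_on r (E f)" "\<And>f. L2_on r f \<Longrightarrow> L2_norm r (E f) \<le> C' * L2_norm r f"
proof -
  obtain C1 where C1: "C1 \<ge> 0" "\<And>f. L2_on r f \<Longrightarrow> L2_on r (\<lambda>x. c *v f x)"
    "\<And>f. L2_on r f \<Longrightarrow> L2_norm r (\<lambda>x. c *v f x) \<le> C1 * L2_norm r f"
    by (rule L2_bounded_multiplication[OF continuous_on_const r]) blast
  obtain C2 where C2: "C2 \<ge> 0" "\<And>f. L2_on r f \<Longrightarrow> L2_on r (volterra kX f)"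
    "\<And>f. L2_on r f \<Longrightarrow> L2_norm r (volterra kX f) \<le> C2 * L2_norm r f"
    by (rule volterra_bounded[OF kX r]) blast
  obtain C3 where C3: "C3 \<ge> 0" "\<And>f. L2_on r f \<Longrightarrow> L2_on r (\<lambda>x. u x *v f x)"
    "\<And>f. L2_on r f \<Longrightarrow> L2_norm r (\<lambda>x. u x *v f x) \<le> C3 * L2_norm r f"
    by (rule L2_bounded_multiplication[OF continuous(4) r]) blast
  show thesis
  proof
    fix f :: "real \<Rightarrow> complex^'n" assume f: "L2_on r f"
    show "L2_on r (E f)" unfolding E_def by (intro C3 C2 C1 f)
    have "L2_norm r (E f) \<le> C3 * L2_norm r (volterra kX (\<lambda>t. c *v f t))"
      unfolding E_def by (intro C3 C2 C1 f)
    also have "\<dots> \<le> C3 * (C2 * L2_norm r (\<lambda>t. c *v f t))" by (intro mult_left_mono C3 C2 C1 f)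
    also have "\<dots> \<le> C3 * (C2 * (C1 * L2_norm r f))" by (intro mult_left_mono C3 C2 C1 f)
    finally show "L2_norm r (E f) \<le> (C3 * C2 * C1) * L2_norm r f" by (simp add: mult_ac)
  qed
qed

lemma E_injective:
  assumes f: "L2_on r f" and g: "L2_on r g" and eq: "ae_eq_on r (E f) (E g)"
  shows "ae_eq_on r f g"
proof -
  have cL2: "L2_on r (\<lambda>t. c *v h t)" if "L2_on r h" for h
    by (rule L2_on_bilinear[OF bilinear_mv continuous_on_const r0 that])
  have "ae_eq_on r (volterra kX (\<lambda>t. c *v f t)) (volterra kX (\<lambda>t. c *v g t))"
    using eq
  proof (rule ae_eq_on_map2)
    fix x assume x: "x \<in> {0..r}" and "E f x = E g x"
    then have "cnj_transpose (u x) *v E f x = cnj_transpose (u x) *v E g x" by simp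
    then show "volterra kX (\<lambda>t. c *v f t) x = volterra kX (\<lambda>t. c *v g t) x"
      by (simp add: E_def matrix_vector_mul_assoc u_unitary[OF x])
  qed
  then have "ae_eq_on r (\<lambda>t. c *v f t) (\<lambda>t. c *v g t)"
    by (rule volterra_injective[OF kX r cL2[OF f] cL2[OF g]])
  then show ?thesis by (rule ae_eq_on_map2) (metis c_cancel(2))
qed

lemma E_inverse:
  obtains F C' where "\<And>f. L2_on r f \<Longrightarrow> L2_on r (F f)" "\<And>f. L2_on r f \<Longrightarrow> L2_norm r (F f) \<le> C' * L2_norm r f"
    "\<And>f x. L2_on r f \<Longrightarrow> x \<in> {0..r} \<Longrightarrow> E (F f) x = f x"
proof -
  obtain C1 where C1: "C1 \<ge> 0" "\<And>f. L2_on r f \<Longrightarrow> L2_on r (\<lambda>x. cnj_transpose (u x) *v f x)"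
    "\<And>f. L2_on r f \<Longrightarrow> L2_norm r (\<lambda>x. cnj_transpose (u x) *v f x) \<le> C1 * L2_norm r f"
    by (rule L2_bounded_multiplication[OF continuous(6) r]) blast
  obtain R C2 where C2: "C2 \<ge> 0" "\<And>f. L2_on r f \<Longrightarrow> L2_on r (R f)"
    "\<And>f. L2_on r f \<Longrightarrow> L2_norm r (R f) \<le> C2 * L2_norm r f"
    "\<And>f x. L2_on r f \<Longrightarrow> x \<in> {0..r} \<Longrightarrow> volterra kX (R f) x = f x"
    by (rule volterra_inverse[OF kX r]) blast
  obtain C3 where C3: "C3 \<ge> 0" "\<And>f. L2_on r f \<Longrightarrow> L2_on r (\<lambda>x. C *v f x)"
    "\<And>f. L2_on r f \<Longrightarrow> L2_norm r (\<lambda>x. C *v f x) \<le> C3 * L2_norm r f"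
    by (rule L2_bounded_multiplication[OF continuous_on_const r]) blast
  \<comment> \<open>The three factors of \<open>E\<close> are undone in turn: multiplication by
    \<open>u\<close>, the Volterra operator, multiplication by \<open>c\<close>.\<close>
  define F where "F = (\<lambda>f x. C *v R (\<lambda>t. cnj_transpose (u t) *v f t) x)"
  show thesis
  proof
    fix f :: "real \<Rightarrow> complex^'n" assume f: "L2_on r f"
    show "L2_on r (F f)" unfolding F_def by (intro C3 C2 C1 f)
    have "L2_norm r (F f) \<le> C3 * L2_norm r (R (\<lambda>t. cnj_transpose (u t) *v f t))"
      unfolding F_def by (intro C3 C2 C1 f)
    also have "\<dots> \<le> C3 * (C2 * L2_norm r (\<lambda>t. cnj_transpose (u t) *v f t))" by (intro mult_left_mono C3 C2 C1 f)
    also have "\<dots> \<le> C3 * (C2 * (C1 * L2_norm r f))" by (intro mult_left_mono C3 C2 C1 f)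
    finally show "L2_norm r (F f) \<le> (C3 * C2 * C1) * L2_norm r f" by (simp add: mult_ac)
    fix x assume x: "x \<in> {0..r}"
    show "E (F f) x = f x"
      unfolding E_def F_def c_cancel C2(4)[OF C1(2)[OF f] x]
      by (simp add: matrix_vector_mul_assoc u_unitary[OF x])
  qed
qed

lemma U_class_L2: "U_class r f \<Longrightarrow> L2_on r f" for f :: "real \<Rightarrow> 'b::euclidean_space"
  by (rule continuous_on_L2_on) (auto elim: U_classE)

text \<open>Each integration gains one degree, from L2 to the Sobolev class to U, and the factors in
  between are smooth enough to preserve it.\<close>

lemma U_class_E_double_primitive:
  assumes g: "L2_on r g"
  shows "U_class r (\<lambda>x. \<phi> x *v integral {0..x} (\<lambda>s. (\<Phi> s ** \<omega> s) *v integral {0..s} (\<lambda>t. cnj_transpose (\<psi> t) *v g t)))"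
proof -
  have "U_class r (\<lambda>s. \<Phi> s ** \<omega> s)"
    by (intro U_class_bilinear[OF bilinear_mm r0] \<Phi>_U \<omega>_U)
  then obtain R' where R': "\<And>x. x \<in> {0..r} \<Longrightarrow> ((\<lambda>s. \<Phi> s ** \<omega> s) has_vector_derivative R' x) (at x within {0..r})"
    "continuous_on {0..r} R'" by (rule U_classE) blast
  show ?thesis
    by (intro U_class_bilinear[OF bilinear_mv r0] \<phi>_U U_class_integral
        W12_class_bilinear[OF bilinear_mv r0 R'] W12_class_integral
        L2_on_bilinear[OF bilinear_mv _ r0] continuous g)
qed

text \<open>The matrix under the integral in \<open>E (\<lambda>t. t *\<^sub>R v)\<close>. Its value
  at 0 is \<open>\<Phi> 0 ** c\<close>, which is invertible.\<close>

definition Q :: "real \<Rightarrow> complex^'n^'n" where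
  "Q s = \<Phi> s ** u s ** (mat 1 + integral {0..s} (kY s)) ** c"

lemma Q_W12: "W12_class r Q"
proof -
  obtain y' where y': "\<And>x. x \<in> {0..r} \<Longrightarrow> ((\<lambda>x. mat 1 + integral {0..x} (kY x)) has_vector_derivative y' x) (at x within {0..r})"
    "continuous_on {0..r} y'" by (rule Y_one_C1) blast
  have "U_class r (\<lambda>s. \<Phi> s ** u s)"
    by (intro U_class_bilinear[OF bilinear_mm r0] \<Phi>_U u_U)
  then obtain R' where R': "\<And>x. x \<in> {0..r} \<Longrightarrow> ((\<lambda>s. \<Phi> s ** u s) has_vector_derivative R' x) (at x within {0..r})"
    "continuous_on {0..r} R'" by (rule U_classE) blast
  show ?thesis unfolding Q_def
    by (intro W12_class_bounded_linear[OF mm.bounded_linear_left _ r0]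
        W12_class_bilinear[OF bilinear_mm r0 R'] C1_imp_W12_class[OF y'])
qed

text \<open>The kernel of \<open>E\<close> is only continuous, so \<open>E f\<close> is not
  differentiated under the integral sign; its smoothness is read off from the formulas for
  \<open>E\<close> on constants, on linear functions and on double primitives.\<close>

lemma U_class_E:
  assumes f: "U_class r f"
  shows "U_class r (E f)"
proof -
  obtain f' where f': "\<And>x. x \<in> {0..r} \<Longrightarrow> (f has_vector_derivative f' x) (at x within {0..r})"
    "W12_class r f'" "continuous_on {0..r} f'" by (rule U_classE[OF f]) blast
  obtain g where g: "L2_on r g" "\<And>x. x \<in> {0..r} \<Longrightarrow> f' x = f' 0 + integral {0..x} g"
    using f'(2) unfolding W12_class_def by blast
  have gs: "set_integrable lborel {0..r} g" by (rule L2_on_set_integrable[OF g(1)])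
  have gc: "continuous_on {0..r} (\<lambda>s. integral {0..s} g)"
    by (rule W12_class_continuous[OF W12_class_integral[OF g(1)]])
  have f_eq: "f x = (f 0 + x *\<^sub>R f' 0) + integral {0..x} (\<lambda>s. integral {0..s} g)" if x: "x \<in> {0..r}" for x
  proof -
    have "(f' has_integral f x - f 0) {0..x}"
      by (rule fundamental_theorem_of_calculus)
        (use x in \<open>auto intro!: has_vector_derivative_within_subset[OF f'(1)]\<close>)
    then have "f x - f 0 = integral {0..x} f'" by (simp add: integral_unique)
    also have "\<dots> = integral {0..x} (\<lambda>s. f' 0 + integral {0..s} g)"
      by (rule integral_cong, rule g(2)) (use x in auto)
    also have "\<dots> = integral {0..x} (\<lambda>s. f' 0) + integral {0..x} (\<lambda>s. integral {0..s} g)"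
      by (intro HK_add integrable_continuous_real continuous_on_const
          continuous_on_subset[OF gc]) (use x in auto)
    finally show ?thesis using x by (simp add: algebra_simps)
  qed
  have lin: "set_integrable lborel {0..r} (\<lambda>t. f 0)" "set_integrable lborel {0..r} (\<lambda>t. t *\<^sub>R f' 0)"
    "set_integrable lborel {0..r} (\<lambda>t. f 0 + t *\<^sub>R f' 0)"
    "set_integrable lborel {0..r} (\<lambda>t. integral {0..t} (\<lambda>s. integral {0..s} g))"
    by (intro borel_integrable_atLeastAtMost' continuous_intros indefinite_integral_continuous_1
      integrable_continuous_real gc)+
  have "E f x = ((1/2) *\<^sub>R (\<phi> x - \<psi> x)) *v f 0 + \<phi> x *v integral {0..x} (\<lambda>s. Q s *v f' 0) +
      \<phi> x *v integral {0..x} (\<lambda>s. (\<Phi> s ** \<omega> s) *v integral {0..s} (\<lambda>t. cnj_transpose (\<psi> t) *v E g t))"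
    if x: "x \<in> {0..r}" for x
  proof -
    have "E f x = E (\<lambda>x. (f 0 + x *\<^sub>R f' 0) + integral {0..x} (\<lambda>s. integral {0..s} g)) x"
      unfolding E_def using x
      by (intro arg_cong[of _ _ "(*v) (u x)"] volterra_cong) (auto simp only: f_eq atLeastAtMost_iff intro!: arg_cong[of _ _ "(*v) c"] f_eq)
    also have "\<dots> = E (\<lambda>t. f 0) x + E (\<lambda>t. t *\<^sub>R f' 0) x + E (\<lambda>x. integral {0..x} (\<lambda>s. integral {0..s} g)) x"
      unfolding E_add[OF lin(3,4) x] E_add[OF lin(1,2) x] ..
    finally show ?thesis unfolding E_const[OF x] E_linear[OF x] E_double_primitive[OF gs x] Q_def .
  qed
  moreover have "U_class r (\<lambda>x. ((1/2) *\<^sub>R (\<phi> x - \<psi> x)) *v f 0 + \<phi> x *v integral {0..x} (\<lambda>s. Q s *v f' 0) +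
      \<phi> x *v integral {0..x} (\<lambda>s. (\<Phi> s ** \<omega> s) *v integral {0..s} (\<lambda>t. cnj_transpose (\<psi> t) *v E g t)))"
  proof (intro U_class_add U_class_E_double_primitive)
    show "U_class r (\<lambda>x. ((1/2) *\<^sub>R (\<phi> x - \<psi> x)) *v f 0)"
      by (intro U_class_bilinear[OF bilinear_mv r0] U_class_const
        U_class_bounded_linear[OF bounded_linear_scaleR_right _ r0] U_class_diff \<phi>_U \<psi>_U r0)
    show "U_class r (\<lambda>x. \<phi> x *v integral {0..x} (\<lambda>s. Q s *v f' 0))"
      by (intro U_class_bilinear[OF bilinear_mv r0] \<phi>_U U_class_integral
        W12_class_bounded_linear[OF mv.bounded_linear_left _ r0] Q_W12)
    show "L2_on r (E g)" by (rule E_bounded) (use g(1) in blast)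
  qed
  ultimately show ?thesis using U_class_cong by (metis (no_types, lifting))
qed

text \<open>Gives invariance of U under the inverse without any kernel for the inverse. A preimage
  \<open>v1 + x v2 + I I g\<close> is found by matching \<open>f\<close> at 0, then a derivative at
  0, then the remainder.\<close>

lemma U_class_E_surjective:
  assumes f: "U_class r f"
  obtains h where "U_class r h" "\<And>x. x \<in> {0..r} \<Longrightarrow> E h x = f x"
proof -
  obtain F C' where F: "\<And>f. L2_on r f \<Longrightarrow> L2_on r (F f)" "\<And>f x. L2_on r f \<Longrightarrow> x \<in> {0..r} \<Longrightarrow> E (F f) x = f x"
    by (rule E_inverse) blast
  have zero: "0 \<in> {0..r}" using r0 by simp
  have c: "(1/2) *\<^sub>R (\<phi> 0 - \<psi> 0) = c" using kX_one[OF zero] u_0 by simp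
  have Q0: "Q 0 = \<Phi> 0 ** c" using u_0 by (simp add: Q_def)
  \<comment> \<open>At 0 the constant contributes \<open>c *v v1\<close> while the other two pieces
    vanish.\<close>
  define v1 where "v1 = C *v f 0"
  define q where "q = (\<lambda>x. \<Phi> x *v (f x - ((1/2) *\<^sub>R (\<phi> x - \<psi> x)) *v v1))"
  have "U_class r q" unfolding q_def
    by (intro U_class_bilinear[OF bilinear_mv r0] U_class_const \<Phi>_U f
        U_class_bounded_linear[OF bounded_linear_scaleR_right _ r0] U_class_diff \<phi>_U \<psi>_U r0)
  then obtain q' where q': "\<And>x. x \<in> {0..r} \<Longrightarrow> (q has_vector_derivative q' x) (at x within {0..r})"
    "W12_class r q'" "continuous_on {0..r} q'" by (rule U_classE) blast
  have q0: "q 0 = 0" by (simp add: q_def c v1_def c_cancel)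
  \<comment> \<open>The double-primitive piece contributes to \<open>q'\<close> a term that vanishes
    at 0, so \<open>Q 0 *v v2\<close> has to equal \<open>q' 0\<close>.\<close>
  define v2 where "v2 = C *v (\<phi> 0 *v q' 0)"
  have Qv2: "Q 0 *v v2 = q' 0"
    unfolding v2_def Q0 matrix_vector_mul_assoc[symmetric] c_cancel by (simp add: matrix_vector_mul_assoc inverses[OF zero])
  have Qc: "continuous_on {0..r} Q" by (rule W12_class_continuous[OF Q_W12])
  have "U_class r (\<lambda>s. cnj_transpose (\<psi> s) ** \<phi> s)"
    by (intro U_class_bilinear[OF bilinear_mm r0] \<phi>_U U_class_bounded_linear[OF bounded_linear_cnj_transpose \<psi>_U r0])
  then obtain R' where R': "\<And>x. x \<in> {0..r} \<Longrightarrow> ((\<lambda>s. cnj_transpose (\<psi> s) ** \<phi> s) has_vector_derivative R' x) (at x within {0..r})"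
    "continuous_on {0..r} R'" by (rule U_classE) blast
  \<comment> \<open>\<open>cnj_transpose \<psi> ** \<phi>\<close> inverts
    \<open>\<Phi> ** \<omega>\<close>. So \<open>p\<close> must be the primitive of
    \<open>cnj_transpose (\<psi> t) *v E g t\<close>; being Sobolev with \<open>p 0 = 0\<close>, it
    is a primitive of some \<open>h\<close> in L2, and \<open>E g = \<omega> h\<close> determines
    \<open>g\<close>.\<close>
  define p where "p = (\<lambda>s. (cnj_transpose (\<psi> s) ** \<phi> s) *v (q' s + - (Q s *v v2)))"
  have "W12_class r p" unfolding p_def
    by (intro W12_class_bilinear[OF bilinear_mv r0 R'] W12_class_add q'(2)
        W12_class_bounded_linear[OF bounded_linear_minus[OF bounded_linear_ident] _ r0]
        W12_class_bounded_linear[OF mv.bounded_linear_left _ r0] Q_W12)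
  moreover have "p 0 = 0" by (simp add: p_def Qv2)
  ultimately obtain h where h: "L2_on r h" "\<And>x. x \<in> {0..r} \<Longrightarrow> p x = integral {0..x} h"
    unfolding W12_class_def by auto
  have \<omega>h: "L2_on r (\<lambda>x. \<omega> x *v h x)"
    by (rule L2_on_bilinear[OF bilinear_mv continuous(3) r0 h(1)])
  define g where "g = F (\<lambda>x. \<omega> x *v h x)"
  have g: "L2_on r g" unfolding g_def by (rule F(1)[OF \<omega>h])
  have q'_eq: "q' s = Q s *v v2 + (\<Phi> s ** \<omega> s) *v integral {0..s} (\<lambda>t. cnj_transpose (\<psi> t) *v E g t)" if s: "s \<in> {0..r}" for s
  proof -
    have "integral {0..s} (\<lambda>t. cnj_transpose (\<psi> t) *v E g t) = integral {0..s} h"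
      by (rule integral_cong)
        (use s in \<open>auto simp: g_def F(2)[OF \<omega>h] matrix_vector_mul_assoc cancel\<close>)
    also have "\<dots> = p s" by (rule h(2)[OF s, symmetric])
    also have "(\<Phi> s ** \<omega> s) *v p s = q' s + - (Q s *v v2)"
      by (simp add: p_def matrix_vector_mul_assoc matrix_mul_assoc cancel[OF s] inverses[OF s])
    finally show ?thesis by simp
  qed
  define W where "W = (\<lambda>s. (\<Phi> s ** \<omega> s) *v integral {0..s} (\<lambda>t. cnj_transpose (\<psi> t) *v E g t))"
  have q_eq: "q x = integral {0..x} (\<lambda>s. Q s *v v2) + integral {0..x} W" if x: "x \<in> {0..r}" for x
  proof -
    have sub: "{0..x} \<subseteq> {0..r}" using x by auto
    have Qi: "(\<lambda>s. Q s *v v2) integrable_on {0..x}"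
      by (intro integrable_continuous_real continuous_on_subset[OF _ sub] mv.continuous_on Qc continuous_on_const)
    have "continuous_on {0..r} (\<lambda>s. q' s - Q s *v v2)" by (intro continuous_on_diff q' mv.continuous_on Qc continuous_on_const)
    then have "continuous_on {0..r} W" by (rule continuous_on_eq) (simp add: q'_eq W_def)
    then have Wi: "W integrable_on {0..x}" by (intro integrable_continuous_real continuous_on_subset[OF _ sub])
    have "(q' has_integral q x - q 0) {0..x}"
      by (rule fundamental_theorem_of_calculus)
        (use x in \<open>auto intro!: has_vector_derivative_within_subset[OF q'(1)]\<close>)
    then have "q x = integral {0..x} q'" by (simp add: integral_unique q0)
    also have "\<dots> = integral {0..x} (\<lambda>s. Q s *v v2 + W s)"
      by (rule integral_cong) (use x in \<open>auto simp: q'_eq W_def\<close>)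
    also have "\<dots> = integral {0..x} (\<lambda>s. Q s *v v2) + integral {0..x} W"
      by (rule HK_add[OF Qi Wi])
    finally show ?thesis .
  qed
  have gs: "set_integrable lborel {0..r} g" by (rule L2_on_set_integrable[OF g])
  have gW: "W12_class r (\<lambda>s. integral {0..s} g)" by (rule W12_class_integral[OF g])
  have lin: "set_integrable lborel {0..r} (\<lambda>t. v1)" "set_integrable lborel {0..r} (\<lambda>t. t *\<^sub>R v2)"
    "set_integrable lborel {0..r} (\<lambda>t. v1 + t *\<^sub>R v2)"
    "set_integrable lborel {0..r} (\<lambda>t. integral {0..t} (\<lambda>s. integral {0..s} g))"
    by (intro borel_integrable_atLeastAtMost' continuous_intros indefinite_integral_continuous_1
      integrable_continuous_real W12_class_continuous[OF gW])+
  show thesis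
  proof
    show "U_class r (\<lambda>x. (v1 + x *\<^sub>R v2) + integral {0..x} (\<lambda>s. integral {0..s} g))"
      by (intro U_class_add[OF U_class_linear_function] U_class_integral gW)
    fix x assume x: "x \<in> {0..r}"
    have "E (\<lambda>x. (v1 + x *\<^sub>R v2) + integral {0..x} (\<lambda>s. integral {0..s} g)) x =
       ((1/2) *\<^sub>R (\<phi> x - \<psi> x)) *v v1 + \<phi> x *v (integral {0..x} (\<lambda>s. Q s *v v2) + integral {0..x} W)"
      unfolding E_add[OF lin(3,4) x] E_add[OF lin(1,2) x] E_const[OF x] E_linear[OF x] E_double_primitive[OF gs x]
        Q_def W_def by (simp add: mv.add_right)
    also have "\<dots> = f x"
      unfolding q_eq[OF x, symmetric] q_def by (simp add: matrix_vector_mul_assoc inverses[OF x])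
    finally show "E (\<lambda>x. (v1 + x *\<^sub>R v2) + integral {0..x} (\<lambda>s. integral {0..s} g)) x = f x" .
  qed
qed

end

section \<open>Similarity of K to A\<close>

lemma bounded_linear_blk1: "bounded_linear (blk1 :: complex^('p::finite + 'p)^'p \<Rightarrow> complex^'p^'p)"
  and bounded_linear_blk2: "bounded_linear (blk2 :: complex^('p::finite + 'p)^'p \<Rightarrow> complex^'p^'p)"
  unfolding linear_conv_bounded_linear[symmetric]
  by (auto simp: blk1_def blk2_def vec_eq_iff intro!: linearI)

text \<open>Polarization: passing to the sum and the difference of the blocks makes the indefinite
  form half a difference of two Gram-type products.\<close>

lemma Jmat_form_diagonalized:
  fixes M N :: "complex^('p::finite + 'p)^'p"
  shows "M ** Jmat ** cnj_transpose N = (1/2) *\<^sub>R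
    ((blk1 M + blk2 M) ** cnj_transpose (blk1 N + blk2 N) - (blk1 M - blk2 M) ** cnj_transpose (blk1 N - blk2 N))"
proof -
  have sum_split: "sum g UNIV = (\<Sum>j\<in>UNIV. g (Inl j)) + (\<Sum>j\<in>UNIV. g (Inr j))" for g :: "'p + 'p \<Rightarrow> complex"
    using sum.Plus[of UNIV UNIV g] by (simp add: o_def)
  have MJ: "(M ** Jmat) $ i $ Inl j = M $ i $ Inr j" "(M ** Jmat) $ i $ Inr j = M $ i $ Inl j" for i j
    by (simp_all add: matrix_matrix_mult_def sum_split Jmat_def if_distrib sum.delta cong: if_cong)
  have "M ** Jmat ** cnj_transpose N = blk2 M ** cnj_transpose (blk1 N) + blk1 M ** cnj_transpose (blk2 N)"
    unfolding matrix_matrix_mult_def[of "M ** Jmat"]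
    by (simp add: vec_eq_iff sum_split MJ) (simp add: matrix_matrix_mult_def cnj_transpose_def blk1_def blk2_def)
  also have "\<dots> = (1/2) *\<^sub>R
    ((blk1 M + blk2 M) ** cnj_transpose (blk1 N + blk2 N) - (blk1 M - blk2 M) ** cnj_transpose (blk1 N - blk2 N))"
    by (simp add: cnj_transpose_add cnj_transpose_diff mm.add_left mm.add_right mm.diff_left mm.diff_right
        algebra_simps flip: scaleR_add_left)
  finally show ?thesis .
qed

lemma second_primitive:
  fixes f :: "real \<Rightarrow> complex^'n"
  assumes "set_integrable lborel {0..x} f"
  shows "integral {0..x} (\<lambda>t. complex_of_real (t - x) *s f t) = - integral {0..x} (\<lambda>s. integral {0..s} f)"
proof -
  have "integral {0..x} (\<lambda>s. integral {0..s} (\<lambda>t. (1::real) *\<^sub>R f t)) = integral {0..x} (\<lambda>t. integral {t..x} (\<lambda>s. 1::real) *\<^sub>R f t)"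
    by (rule integral_swap_triangle(1)[OF bounded_bilinear_scaleR _ assms]) (simp add: case_prod_beta')
  also have "\<dots> = integral {0..x} (\<lambda>t. - (complex_of_real (t - x) *s f t))"
    by (rule integral_cong) (simp add: vec_eq_iff scaleR_conv_of_real[where 'a=complex] algebra_simps)
  also have "\<dots> = - integral {0..x} (\<lambda>t. complex_of_real (t - x) *s f t)" by (rule Henstock_Kurzweil_Integration.integral_neg)
  finally show ?thesis by (simp only: scaleR_one minus_minus)
qed

text \<open>Since operators act on representatives, the inverse \<open>F\<close> is required to
  respect equality almost everywhere, and its values carry meaning only up to null sets; this is why
  (i) to (iii) are expressed with \<open>ae_eq_on\<close>.\<close>

theorem theorem2p4:
  fixes r :: real
    and \<beta> :: "real \<Rightarrow> complex^('p::finite + 'p)^'p"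
  assumes r_pos: "r > 0"
    and \<beta>_U: "U_class r \<beta>"
    and h1: "\<forall>x\<in>{0..r}. \<beta> x ** Jmat ** cnj_transpose (\<beta> x) = 0"
    and h2: "\<forall>x\<in>{0..r}. vector_derivative \<beta> (at x within {0..r}) ** Jmat ** cnj_transpose (\<beta> x)
                = mat \<i>"
    and det_ne: "det (blk2 (\<beta> 0)) \<noteq> 0"
  defines "A \<equiv> (\<lambda>(f::real \<Rightarrow> complex^'p) x. integral {0..x} (\<lambda>t. complex_of_real (t - x) *s f t))"
    and "K \<equiv> (\<lambda>(f::real \<Rightarrow> complex^'p) x.
              \<i> *s (\<beta> x ** Jmat *v integral {0..x} (\<lambda>t. cnj_transpose (\<beta> t) *v f t)))"
  shows "\<exists>(u::real \<Rightarrow> complex^'p^'p) (\<E>::real \<Rightarrow> real \<Rightarrow> complex^'p^'p).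
     let E = (\<lambda>(f::real \<Rightarrow> complex^'p) x.
                (u x ** blk2 (\<beta> 0)) *v f x + integral {0..x} (\<lambda>t. \<E> x t *v f t)) in
     U_class r u \<and>
     (\<forall>x\<in>{0..r}. cnj_transpose (u x) ** u x = mat 1 \<and> u x ** cnj_transpose (u x) = mat 1) \<and>
     u 0 = mat 1 \<and>
     (\<forall>f x. L2_on r f \<and> x \<in> {0..r} \<longrightarrow> (\<lambda>t. \<E> x t *v f t) integrable_on {0..x}) \<and>
     (\<exists>C. \<forall>f. L2_on r f \<longrightarrow> L2_on r (E f) \<and> L2_norm r (E f) \<le> C * L2_norm r f) \<and>
     (\<exists>F C'.
        (\<forall>f. L2_on r f \<longrightarrow> L2_on r (F f) \<and> L2_norm r (F f) \<le> C' * L2_norm r f) \<and>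
        (\<forall>f g. L2_on r f \<and> L2_on r g \<and> ae_eq_on r f g \<longrightarrow> ae_eq_on r (F f) (F g)) \<and>
        (\<forall>f. L2_on r f \<longrightarrow> ae_eq_on r (E (F f)) f \<and> ae_eq_on r (F (E f)) f) \<and>
        (\<forall>f. L2_on r f \<longrightarrow> ae_eq_on r (K f) (E (A (F f)))) \<and>
        (\<forall>j. ae_eq_on r (F (\<lambda>x. column j (blk2 (\<beta> x)))) (\<lambda>x. axis j 1)) \<and>
        (\<forall>f. U_class r f \<longrightarrow> (\<exists>g. U_class r g \<and> ae_eq_on r (E f) g)) \<and>
        (\<forall>f. U_class r f \<longrightarrow> (\<exists>g. U_class r g \<and> ae_eq_on r (F f) g)))"
proof -
  have r0: "r \<ge> 0" using r_pos by simp
  obtain \<beta>' where \<beta>': "\<And>x. x \<in> {0..r} \<Longrightarrow> (\<beta> has_vector_derivative \<beta>' x) (at x within {0..r})"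
    "W12_class r \<beta>'" "continuous_on {0..r} \<beta>'" "continuous_on {0..r} \<beta>" by (rule U_classE[OF \<beta>_U]) blast
  \<comment> \<open>The derivative within the interval is unique, also at the endpoints, because
    \<open>r > 0\<close>.\<close>
  have vd: "vector_derivative \<beta> (at x within {0..r}) = \<beta>' x" if "x \<in> {0..r}" for x
    using vector_derivative_within_cbox[of 0 r x \<beta> "\<beta>' x"] \<beta>'(1)[OF that] r_pos that by simp
  define \<phi> \<psi> where "\<phi> = (\<lambda>x. blk1 (\<beta> x) + blk2 (\<beta> x))" and "\<psi> = (\<lambda>x. blk1 (\<beta> x) - blk2 (\<beta> x))"
  define \<phi>' \<psi>' where "\<phi>' = (\<lambda>x. blk1 (\<beta>' x) + blk2 (\<beta>' x))" and "\<psi>' = (\<lambda>x. blk1 (\<beta>' x) - blk2 (\<beta>' x))"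
  note bl_add = bounded_linear_add[OF bounded_linear_blk1 bounded_linear_blk2]
    and bl_diff = bounded_linear_sub[OF bounded_linear_blk1 bounded_linear_blk2]
  define c where "c = blk2 (\<beta> 0)"
  obtain C where C: "c ** C = mat 1" "C ** c = mat 1"
    using det_ne invertible_det_nz[of c] unfolding c_def invertible_def by blast
  have half: "(1/2) *\<^sub>R (\<phi> x - \<psi> x) = blk2 (\<beta> x)" for x
    by (simp add: \<phi>_def \<psi>_def flip: scaleR_2)
  interpret gauge_pair r \<phi> \<psi> \<phi>' \<psi>'
  proof
    show "r > 0" by (rule r_pos)
    fix x assume x: "x \<in> {0..r}"
    show "(\<phi> has_vector_derivative \<phi>' x) (at x within {0..r})" "(\<psi> has_vector_derivative \<psi>' x) (at x within {0..r})"
      unfolding \<phi>_def \<phi>'_def \<psi>_def \<psi>'_def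
      by (rule bounded_linear.has_vector_derivative[OF bl_add \<beta>'(1)[OF x]] bounded_linear.has_vector_derivative[OF bl_diff \<beta>'(1)[OF x]])+
    show "\<phi> x ** cnj_transpose (\<phi> x) = \<psi> x ** cnj_transpose (\<psi> x)"
      using h1 x unfolding Jmat_form_diagonalized by (simp add: \<phi>_def \<psi>_def)
    have "(1/2) *\<^sub>R (\<phi>' x ** cnj_transpose (\<phi> x) - \<psi>' x ** cnj_transpose (\<psi> x)) = mat \<i>"
      using h2 x unfolding Jmat_form_diagonalized by (simp add: vd \<phi>_def \<psi>_def \<phi>'_def \<psi>'_def)
    then have "2 *\<^sub>R ((1/2) *\<^sub>R (\<phi>' x ** cnj_transpose (\<phi> x) - \<psi>' x ** cnj_transpose (\<psi> x))) = 2 *\<^sub>R mat \<i>" by simp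
    also have "2 *\<^sub>R mat \<i> = (mat (2 * \<i>) :: complex^'p^'p)"
      by (simp add: mat_def vec_eq_iff scaleR_conv_of_real)
    finally show "\<phi>' x ** cnj_transpose (\<phi> x) - \<psi>' x ** cnj_transpose (\<psi> x) = mat (2 * \<i>)" by simp
  next
    show "W12_class r \<phi>'" "W12_class r \<psi>'" unfolding \<phi>'_def \<psi>'_def
      by (rule W12_class_bounded_linear[OF bl_add \<beta>'(2) r0] W12_class_bounded_linear[OF bl_diff \<beta>'(2) r0])+
  qed
  obtain u \<tau> kX kY where "transmutation r \<phi> \<psi> \<phi>' \<psi>' u \<tau> kX kY c C"
    using transmutation_exists[OF _ C] half[of 0] unfolding c_def by metis
  then interpret transmutation r \<phi> \<psi> \<phi>' \<psi>' u \<tau> kX kY c C .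
  define Ek where "Ek = (\<lambda>x t. u x ** kX x t ** c)"
  \<comment> \<open>The operator in the required shape. Moving \<open>u x\<close> under the integral
    uses integrability, so agreement with \<open>E\<close> is established for \<open>f\<close> in
    L2.\<close>
  define E' where "E' = (\<lambda>f x. (u x ** blk2 (\<beta> 0)) *v f x + integral {0..x} (\<lambda>t. Ek x t *v f t))"
  have E_int: "(\<lambda>t. Ek x t *v f t) integrable_on {0..x}" and E'_eq: "E' f x = E f x"
    if f: "L2_on r f" and x: "x \<in> {0..r}" for f x
  proof -
    have i: "(\<lambda>t. kX x t *v (c *v f t)) integrable_on {0..x}"
      by (rule kernel_mult_integrable[OF kX c_set_integrable[OF L2_on_set_integrable[OF f]] x])
    have eq: "Ek x t *v f t = u x *v (kX x t *v (c *v f t))" for t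
      by (simp add: Ek_def matrix_vector_mul_assoc matrix_mul_assoc)
    show "(\<lambda>t. Ek x t *v f t) integrable_on {0..x}"
      using integrable_linear[OF i mv.bounded_linear_right[of "u x"]] by (simp add: o_def eq)
    show "E' f x = E f x"
      using integral_linear[OF i mv.bounded_linear_right[of "u x"]]
      by (simp add: E'_def E_def volterra_def eq o_def mv.add_right matrix_vector_mul_assoc flip: c_def)
  qed
  obtain CE where CE: "\<And>f. L2_on r f \<Longrightarrow> L2_on r (E f)" "\<And>f. L2_on r f \<Longrightarrow> L2_norm r (E f) \<le> CE * L2_norm r f"
    by (rule E_bounded) blast
  obtain F CF where F: "\<And>f. L2_on r f \<Longrightarrow> L2_on r (F f)" "\<And>f. L2_on r f \<Longrightarrow> L2_norm r (F f) \<le> CF * L2_norm r f"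
    "\<And>f x. L2_on r f \<Longrightarrow> x \<in> {0..r} \<Longrightarrow> E (F f) x = f x"
    by (rule E_inverse) blast
  \<comment> \<open>\<open>F\<close> came from a choice of solutions; injectivity of
    \<open>E\<close> determines \<open>F f\<close> almost everywhere, and the identifications of
    values of \<open>F\<close> below rest on this.\<close>
  have F_unique: "ae_eq_on r (F f) g" if f: "L2_on r f" and g: "L2_on r g" and eq: "ae_eq_on r (E g) f" for f g
    by (rule E_injective[OF F(1)[OF f] g], rule ae_eq_on_trans[OF ae_eq_onI ae_eq_on_sym[OF eq]]) (rule F(3)[OF f])
  \<comment> \<open>The equality holds at every point, because \<open>E (F f)\<close> equals
    \<open>f\<close> everywhere on the interval.\<close>
  have KA: "K f x = E (A (F f)) x" if f: "L2_on r f" and x: "x \<in> {0..r}" for f x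
  proof -
    have fs: "set_integrable lborel {0..r} f" by (rule L2_on_set_integrable[OF f])
    have \<beta>c: "continuous_on {0..r} (\<lambda>t. cnj_transpose (\<beta> t))"
      by (rule bounded_linear.continuous_on[OF bounded_linear_cnj_transpose \<beta>'(4)])
    have sub: "{0..x} \<subseteq> {0..r}" using x by auto
    have int: "(\<lambda>t. k t *v f t) integrable_on {0..x}" if "continuous_on {0..r} k" for k :: "real \<Rightarrow> complex^'p^'m::finite"
      by (rule set_integrable_HK(1)[OF set_integrable_subinterval[OF
          set_integrable_bilinear_continuous[OF bilinear_mv that fs] sub]])
    have \<phi>c: "continuous_on {0..r} (\<lambda>t. cnj_transpose (\<phi> t))"
      by (rule bounded_linear.continuous_on[OF bounded_linear_cnj_transpose continuous(1)])
    have "(\<beta> x ** Jmat) *v integral {0..x} (\<lambda>t. cnj_transpose (\<beta> t) *v f t) =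
        integral {0..x} (\<lambda>t. (\<beta> x ** Jmat ** cnj_transpose (\<beta> t)) *v f t)"
      using integral_linear[OF int[OF \<beta>c] mv.bounded_linear_right[of "\<beta> x ** Jmat"]]
      by (simp add: o_def matrix_vector_mul_assoc)
    also have "\<dots> = integral {0..x} (\<lambda>t. (1/2) *\<^sub>R (\<phi> x *v (cnj_transpose (\<phi> t) *v f t) - \<psi> x *v (cnj_transpose (\<psi> t) *v f t)))"
      unfolding Jmat_form_diagonalized by (simp add: \<phi>_def \<psi>_def mv.scaleR_left mv.diff_left matrix_vector_mul_assoc)
    also have "\<dots> = (1/2) *\<^sub>R (\<phi> x *v integral {0..x} (\<lambda>t. cnj_transpose (\<phi> t) *v f t) -
        \<psi> x *v integral {0..x} (\<lambda>t. cnj_transpose (\<psi> t) *v f t))"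
      using integral_linear[OF int[OF \<phi>c] mv.bounded_linear_right[of "\<phi> x"]] integrable_linear[OF int[OF \<phi>c] mv.bounded_linear_right[of "\<phi> x"]]
        integral_linear[OF int[OF continuous(5)] mv.bounded_linear_right[of "\<psi> x"]] integrable_linear[OF int[OF continuous(5)] mv.bounded_linear_right[of "\<psi> x"]]
      by (simp add: o_def HK_diff)
    finally have "K f x = (1/2) *\<^sub>R (\<i> *s (\<phi> x *v integral {0..x} (\<lambda>t. cnj_transpose (\<phi> t) *v f t) -
        \<psi> x *v integral {0..x} (\<lambda>t. cnj_transpose (\<psi> t) *v f t)))"
      unfolding K_def by (simp add: vec_eq_iff right_diff_distrib)
    then have Kf: "K f x = - (\<phi> x *v integral {0..x} (\<lambda>s. (\<Phi> s ** \<omega> s) *v integral {0..s} (\<lambda>t. cnj_transpose (\<psi> t) *v f t)))"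
      unfolding factorization[OF fs x] by simp
    have Fs: "set_integrable lborel {0..r} (F f)" by (rule L2_on_set_integrable[OF F(1)[OF f]])
    have "E (A (F f)) x = E (\<lambda>x. - integral {0..x} (\<lambda>s. integral {0..s} (F f))) x"
      unfolding E_def
    proof (intro arg_cong[of _ _ "(*v) (u x)"] volterra_cong)
      fix t assume "t \<in> {0..x}"
      then have "set_integrable lborel {0..t} (F f)" using x by (intro set_integrable_subinterval[OF Fs]) auto
      then show "c *v A (F f) t = c *v - integral {0..t} (\<lambda>s. integral {0..s} (F f))"
        unfolding A_def by (simp only: second_primitive)
    qed (use x in simp)
    also have "\<dots> = - E (\<lambda>x. integral {0..x} (\<lambda>s. integral {0..s} (F f))) x"
      by (simp add: E_def volterra_def mv.minus_right mv.add_right mv.diff_right)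
    also have "\<dots> = - (\<phi> x *v integral {0..x} (\<lambda>s. (\<Phi> s ** \<omega> s) *v integral {0..s} (\<lambda>t. cnj_transpose (\<psi> t) *v E (F f) t)))"
      unfolding E_double_primitive[OF Fs x] ..
    also have "\<dots> = K f x"
    proof -
      have "integral {0..s} (\<lambda>t. cnj_transpose (\<psi> t) *v E (F f) t) = integral {0..s} (\<lambda>t. cnj_transpose (\<psi> t) *v f t)"
        if "s \<in> {0..x}" for s
        by (rule integral_cong) (use that x in \<open>auto simp: F(3)[OF f]\<close>)
      then show ?thesis unfolding Kf by (auto intro!: arg_cong[of _ _ "(*v) (\<phi> x)"] integral_cong)
    qed
    finally show ?thesis by simp
  qed
  \<comment> \<open>Allows \<open>E'\<close> and \<open>E\<close> to be exchanged at the argument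
    \<open>A (F f)\<close>.\<close>
  have A_L2: "L2_on r (A f)" if f: "L2_on r f" for f
  proof -
    have fs: "set_integrable lborel {0..r} f" by (rule L2_on_set_integrable[OF f])
    have "continuous_on {0..r} (\<lambda>x. integral {0..x} (\<lambda>t. (mat (complex_of_real (t - x)) :: complex^'p^'p) *v f t))"
    proof (rule continuous_on_volterra_integral[OF bilinear_mv _ fs])
      have "mat (complex_of_real z) = z *\<^sub>R (mat 1 :: complex^'p^'p)" for z
        by (simp add: mat_def vec_eq_iff scaleR_conv_of_real[where 'a=complex])
      then show "continuous_on UNIV (\<lambda>(x, t). mat (complex_of_real (t - x)) :: complex^'p^'p)"
        by (simp only: case_prod_beta') (intro continuous_intros)
    qed
    moreover have "(mat z :: complex^'p^'p) *v v = z *s v" for z v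
      by (simp add: matrix_vector_mult_def mat_def vec_eq_iff if_distrib if_distribR sum.delta cong: if_cong)
    ultimately show ?thesis unfolding A_def by (intro continuous_on_L2_on) simp
  qed
  have E'_L2: "L2_on r (E' f)" and E'_norm: "L2_norm r (E' f) \<le> CE * L2_norm r f" if f: "L2_on r f" for f
  proof -
    show "L2_on r (E' f)" by (rule L2_on_cong[OF CE(1)[OF f]]) (simp add: E'_eq[OF f])
    show "L2_norm r (E' f) \<le> CE * L2_norm r f"
      using CE(2)[OF f] L2_norm_cong[of r "E' f" "E f"] E'_eq[OF f] by simp
  qed
  then have E'_bounded: "\<exists>C. \<forall>f. L2_on r f \<longrightarrow> L2_on r (E' f) \<and> L2_norm r (E' f) \<le> C * L2_norm r f" by blast
  have "U_class r u \<and>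
     (\<forall>x\<in>{0..r}. cnj_transpose (u x) ** u x = mat 1 \<and> u x ** cnj_transpose (u x) = mat 1) \<and>
     u 0 = mat 1 \<and>
     (\<forall>f x. L2_on r f \<and> x \<in> {0..r} \<longrightarrow> (\<lambda>t. Ek x t *v f t) integrable_on {0..x}) \<and>
     (\<exists>C. \<forall>f. L2_on r f \<longrightarrow> L2_on r (E' f) \<and> L2_norm r (E' f) \<le> C * L2_norm r f) \<and>
     (\<exists>F C'.
        (\<forall>f. L2_on r f \<longrightarrow> L2_on r (F f) \<and> L2_norm r (F f) \<le> C' * L2_norm r f) \<and>
        (\<forall>f g. L2_on r f \<and> L2_on r g \<and> ae_eq_on r f g \<longrightarrow> ae_eq_on r (F f) (F g)) \<and>
        (\<forall>f. L2_on r f \<longrightarrow> ae_eq_on r (E' (F f)) f \<and> ae_eq_on r (F (E' f)) f) \<and>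
        (\<forall>f. L2_on r f \<longrightarrow> ae_eq_on r (K f) (E' (A (F f)))) \<and>
        (\<forall>j. ae_eq_on r (F (\<lambda>x. column j (blk2 (\<beta> x)))) (\<lambda>x. axis j 1)) \<and>
        (\<forall>f. U_class r f \<longrightarrow> (\<exists>g. U_class r g \<and> ae_eq_on r (E' f) g)) \<and>
        (\<forall>f. U_class r f \<longrightarrow> (\<exists>g. U_class r g \<and> ae_eq_on r (F f) g)))"
  proof (intro conjI E'_bounded exI[of _ F] exI[of _ CF] allI ballI impI)
    fix f :: "real \<Rightarrow> complex^'p" assume f: "L2_on r f"
    show "ae_eq_on r (E' (F f)) f" by (rule ae_eq_onI) (simp add: E'_eq[OF F(1)[OF f]] F(3)[OF f])
    show "ae_eq_on r (F (E' f)) f"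
      by (rule F_unique[OF E'_L2[OF f] f]) (rule ae_eq_onI, simp add: E'_eq[OF f])
    show "ae_eq_on r (K f) (E' (A (F f)))"
      by (rule ae_eq_onI) (simp add: E'_eq[OF A_L2[OF F(1)[OF f]]] KA[OF f])
  next
    fix f g :: "real \<Rightarrow> complex^'p" assume fg: "L2_on r f \<and> L2_on r g \<and> ae_eq_on r f g"
    have "ae_eq_on r (E (F g)) f"
      by (rule ae_eq_on_trans[OF ae_eq_onI ae_eq_on_sym[of r f g]]) (use fg F(3) in auto)
    then show "ae_eq_on r (F f) (F g)" using fg by (intro F_unique F) auto
  next
    fix j :: 'p
    have bc: "continuous_on {0..r} (\<lambda>x. blk2 (\<beta> x))"
      by (rule bounded_linear.continuous_on[OF bounded_linear_blk2 \<beta>'(4)])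
    have col: "(\<lambda>x. column j (blk2 (\<beta> x))) = (\<lambda>x. blk2 (\<beta> x) *v axis j 1)"
      by (simp add: fun_eq_iff column_def matrix_vector_mult_def axis_def vec_eq_iff if_distrib sum.delta cong: if_cong)
    show "ae_eq_on r (F (\<lambda>x. column j (blk2 (\<beta> x)))) (\<lambda>x. axis j 1)"
      unfolding col
    proof (rule F_unique)
      show "L2_on r (\<lambda>x. blk2 (\<beta> x) *v axis j 1)" "L2_on r (\<lambda>x. axis j 1 :: complex^'p)"
        by (intro continuous_on_L2_on mv.continuous_on bc continuous_on_const)+
      show "ae_eq_on r (E (\<lambda>x. axis j 1)) (\<lambda>x. blk2 (\<beta> x) *v axis j 1)"
        by (rule ae_eq_onI) (simp only: E_const half)
    qed
  next
    fix f :: "real \<Rightarrow> complex^'p" assume f: "U_class r f"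
    show "\<exists>g. U_class r g \<and> ae_eq_on r (E' f) g"
      using U_class_E[OF f] E'_eq[OF U_class_L2[OF f]] by (auto intro!: exI[of _ "E f"] ae_eq_onI)
    obtain h where h: "U_class r h" "\<And>x. x \<in> {0..r} \<Longrightarrow> E h x = f x" by (rule U_class_E_surjective[OF f]) blast
    then show "\<exists>g. U_class r g \<and> ae_eq_on r (F f) g"
      by (intro exI[of _ h] conjI F_unique U_class_L2 f ae_eq_onI) auto
  next
    fix f :: "real \<Rightarrow> complex^'p" and x assume "L2_on r f \<and> x \<in> {0..r}"
    then show "(\<lambda>t. Ek x t *v f t) integrable_on {0..x}" using E_int by blast
  qed (use u_U u_0 u_unitary F in auto)
  then show ?thesis unfolding Let_def E'_def by blast
qed

end
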